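(* Let $\langle \mathsf B,\mathcal F\rangle$ be a display map category with units and $\mathcal F$-dependent coproducts. A fibration $\mathsf p:\mathsf E\to\mathsf B$ with $\mathcal F$-products is an instance of an $\mathcal F$-product completion, up to fibred equivalence (i.e. there is a fibration $\mathsf q$ over $\mathsf B$ with $\mathsf p\simeq\Pi_{\mathcal F}(\mathsf q)$ as fibrations over $\mathsf B$), if and only if $\mathsf p$ has enough $(\mathcal F,\prod)$-quantifier-free objects.
   Context: Fibrations $\mathsf p:\mathsf E\to\mathsf B$ are cloven Grothendieck fibrations; $\mathsf E_A$ is the fibre over $A$; vertical arrows are those over identities; $u^*$ is reindexing along $u$; canonical isomorphisms such as $g^*u^*\cong(ug)^*$ are suppressed. A display map category $\langle\mathsf B,\mathcal F\rangle$ is a category with a class $\mathcal F$ of morphisms such that pullbacks of $\mathcal F$-maps along arbitrary maps exist and lie in $\mathcal F$. Arrows of $\mathcal F$ are written $\twoheadrightarrow$. It has units if all isomorphisms are in $\mathcal F$, and $\mathcal F$-dependent coproducts if $\mathcal F$ is closed under composition. $\mathsf p$ has $\mathcal F$-products if for each $v\in\mathcal F$ the functor $v^*$ has a right adjoint $\prod_v$ and, for every pullback square with $v:L\twoheadrightarrow J$, $f:I\to J$ arbitrary, $u:K\twoheadrightarrow I$, $g:K\to L$, the canonical map $f^*\prod_v\Rightarrow\prod_u g^*$ is an isomorphism (Beck–Chevalley). $\alpha\in\mathsf E_A$ is $(\mathcal F,\prod)$-quantifier splitting if for every $u:B\twoheadrightarrow A$ in $\mathcal F$, every $\beta\in\mathsf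 E_B$ and every vertical $h:\prod_u\beta\to\alpha$ there exist a unique section $g:A\to B$ of $u$ and a unique vertical $\overline h:g^*\beta\to\alpha$ with $h=\overline h\circ g^*(\varepsilon_\beta)$, where $\varepsilon$ is the counit of $u^*\dashv\prod_u$ and $g^*u^*\prod_u\beta\cong\prod_u\beta$. It is $(\mathcal F,\prod)$-quantifier-free if $f^*\alpha$ is $(\mathcal F,\prod)$-quantifier splitting for every $f:I\to A$ in $\mathsf B$. $\mathsf p$ has enough $(\mathcal F,\prod)$-quantifier-free objects if it has $\mathcal F$-products and for every $\alpha\in\mathsf E_I$ there are $f:A\twoheadrightarrow I$ in $\mathcal F$ and a $(\mathcal F,\prod)$-quantifier-free $\beta\in\mathsf E_A$ with $\alpha\cong\prod_f\beta$. The $\mathcal F$-product completion $\Pi_{\mathcal F}(\mathsf p):\Pi_{\mathcal F}(\mathsf E)\to\mathsf B$ of a fibration $\mathsf p$: objects over $I$ are pairs $(g:X\twoheadrightarrow I,\ \alpha\in\mathsf E_X)$ with $g\in\mathcal F$; a morphism $(g:X\twoheadrightarrow I,\alpha)\to(h:Y\twoheadrightarrow J,\beta)$ over $f_0:I\to J$ consists of $f_1:I\times_JY\to X$ over $I$ and a vertical arrow $\phi:f_1^*\alpha\to(f_0')^*\beta$ over $I\times_JY$, where $f_0':I\times_JY\to Y$ is the projection, with the evident composition (so that $\Pi_{\mathcal F}(\mathsf p)$ is the fibrewise opposite of $\Sigma_{\mathcal F}$ applied to the fibrewise opposite of $\mathsf p$, where $\Sigma_{\mathcal F}(\mathsf p)$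 has the same objects and its morphisms $(g:X\twoheadrightarrow I,\alpha)\to(h:Y\twoheadrightarrow J,\beta)$ over $f_0$ are pairs of $f_1:X\to Y$ with $hf_1=f_0g$ and $\phi:\alpha\to\beta$ over $f_1$). *)

theory Defs
  imports Main
begin

section \<open>Categories, functors, adjunctions\<close>

record ('o, 'a) cat =
  Obj :: "'o set"
  Arr :: "'a set"
  Dom :: "'a \<Rightarrow> 'o"
  Cod :: "'a \<Rightarrow> 'o"
  Ident :: "'o \<Rightarrow> 'a"
  Comp :: "'a \<Rightarrow> 'a \<Rightarrow> 'a"  (infixr "\<cdot>\<index>" 70)

text \<open>Composition is in applicative order: \<open>g \<cdot>\<^bsub>C\<^esub> f\<close> is ``first \<open>f\<close>, then \<open>g\<close>''.\<close>

definition hom :: "('o, 'a) cat \<Rightarrow> 'o \<Rightarrow> 'o \<Rightarrow> 'a set" where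
  "hom C a b = {f \<in> Arr C. Dom C f = a \<and> Cod C f = b}"

locale category =
  fixes C :: "('o, 'a) cat" (structure)
  assumes dom_closed: "f \<in> Arr C \<Longrightarrow> Dom C f \<in> Obj C"
    and cod_closed: "f \<in> Arr C \<Longrightarrow> Cod C f \<in> Obj C"
    and id_closed: "a \<in> Obj C \<Longrightarrow> Ident C a \<in> hom C a a"
    and comp_closed: "f \<in> hom C a b \<Longrightarrow> g \<in> hom C b c \<Longrightarrow> g \<cdot> f \<in> hom C a c"
    and id_left: "f \<in> hom C a b \<Longrightarrow> Ident C b \<cdot> f = f"
    and id_right: "f \<in> hom C a b \<Longrightarrow> f \<cdot> Ident C a = f"
    and comp_assoc: "f \<in> hom C a b \<Longrightarrow> g \<in> hom C b c \<Longrightarrow> h \<in> hom C c d \<Longrightarrow>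
           (h \<cdot> g) \<cdot> f = h \<cdot> (g \<cdot> f)"

definition iso :: "('o, 'a) cat \<Rightarrow> 'a \<Rightarrow> bool" where
  "iso C f \<longleftrightarrow> f \<in> Arr C \<and>
     (\<exists>g \<in> hom C (Cod C f) (Dom C f).
        g \<cdot>\<^bsub>C\<^esub> f = Ident C (Dom C f) \<and> f \<cdot>\<^bsub>C\<^esub> g = Ident C (Cod C f))"

definition isomorphic :: "('o, 'a) cat \<Rightarrow> 'o \<Rightarrow> 'o \<Rightarrow> bool" where
  "isomorphic C a b \<longleftrightarrow> (\<exists>f \<in> hom C a b. iso C f)"

record ('o, 'a, 'p, 'b) ftr =
  fobj :: "'o \<Rightarrow> 'p"
  farr :: "'a \<Rightarrow> 'b"

definition is_functor :: "('o, 'a) cat \<Rightarrow> ('p, 'b) cat \<Rightarrow> ('o, 'a, 'p, 'b) ftr \<Rightarrow> bool" where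
  "is_functor C D H \<longleftrightarrow>
     (\<forall>a \<in> Obj C. fobj H a \<in> Obj D \<and> farr H (Ident C a) = Ident D (fobj H a)) \<and>
     (\<forall>f \<in> Arr C. farr H f \<in> hom D (fobj H (Dom C f)) (fobj H (Cod C f))) \<and>
     (\<forall>f \<in> Arr C. \<forall>g \<in> Arr C. Dom C g = Cod C f \<longrightarrow>
        farr H (g \<cdot>\<^bsub>C\<^esub> f) = farr H g \<cdot>\<^bsub>D\<^esub> farr H f)"

definition id_ftr :: "('o, 'a, 'o, 'a) ftr" where
  "id_ftr = \<lparr>fobj = (\<lambda>a. a), farr = (\<lambda>f. f)\<rparr>"

definition comp_ftr ::
  "('p, 'b, 'q, 'c) ftr \<Rightarrow> ('o, 'a, 'p, 'b) ftr \<Rightarrow> ('o, 'a, 'q, 'c) ftr" where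
  "comp_ftr K H = \<lparr>fobj = fobj K \<circ> fobj H, farr = farr K \<circ> farr H\<rparr>"

definition nat_trans ::
  "('o, 'a) cat \<Rightarrow> ('p, 'b) cat \<Rightarrow> ('o, 'a, 'p, 'b) ftr \<Rightarrow> ('o, 'a, 'p, 'b) ftr \<Rightarrow> ('o \<Rightarrow> 'b) \<Rightarrow> bool"
  where
  "nat_trans C D H K t \<longleftrightarrow>
     (\<forall>a \<in> Obj C. t a \<in> hom D (fobj H a) (fobj K a)) \<and>
     (\<forall>f \<in> Arr C. t (Cod C f) \<cdot>\<^bsub>D\<^esub> farr H f = farr K f \<cdot>\<^bsub>D\<^esub> t (Dom C f))"

definition nat_iso ::
  "('o, 'a) cat \<Rightarrow> ('p, 'b) cat \<Rightarrow> ('o, 'a, 'p, 'b) ftr \<Rightarrow> ('o, 'a, 'p, 'b) ftr \<Rightarrow> ('o \<Rightarrow> 'b) \<Rightarrow> bool"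
  where
  "nat_iso C D H K t \<longleftrightarrow> nat_trans C D H K t \<and> (\<forall>a \<in> Obj C. iso D (t a))"

text \<open>\<open>L : C \<rightarrow> D\<close> is left adjoint to \<open>R : D \<rightarrow> C\<close>, with unit \<open>\<eta>\<close> and counit \<open>\<epsilon>\<close>.\<close>

definition adjunction ::
  "('o, 'a) cat \<Rightarrow> ('p, 'b) cat \<Rightarrow> ('o, 'a, 'p, 'b) ftr \<Rightarrow> ('p, 'b, 'o, 'a) ftr \<Rightarrow>
   ('o \<Rightarrow> 'a) \<Rightarrow> ('p \<Rightarrow> 'b) \<Rightarrow> bool" where
  "adjunction C D L R \<eta> \<epsilon> \<longleftrightarrow>
     is_functor C D L \<and> is_functor D C R \<and>
     nat_trans C C id_ftr (comp_ftr R L) \<eta> \<and>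
     nat_trans D D (comp_ftr L R) id_ftr \<epsilon> \<and>
     (\<forall>a \<in> Obj C. \<epsilon> (fobj L a) \<cdot>\<^bsub>D\<^esub> farr L (\<eta> a) = Ident D (fobj L a)) \<and>
     (\<forall>b \<in> Obj D. farr R (\<epsilon> b) \<cdot>\<^bsub>C\<^esub> \<eta> (fobj R b) = Ident C (fobj R b))"


section \<open>Display map categories\<close>

text \<open>
  \<open>is_pullback C v f u g\<close>: the square
  \<open>v : L \<rightarrow> J\<close>, \<open>f : I \<rightarrow> J\<close>, \<open>u : K \<rightarrow> I\<close>, \<open>g : K \<rightarrow> L\<close> with \<open>v g = f u\<close> is a pullback.
\<close>

definition is_pullback :: "('o, 'a) cat \<Rightarrow> 'a \<Rightarrow> 'a \<Rightarrow> 'a \<Rightarrow> 'a \<Rightarrow> bool" where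
  "is_pullback C v f u g \<longleftrightarrow>
     v \<in> Arr C \<and> f \<in> Arr C \<and> Cod C v = Cod C f \<and>
     u \<in> Arr C \<and> Cod C u = Dom C f \<and> g \<in> hom C (Dom C u) (Dom C v) \<and>
     v \<cdot>\<^bsub>C\<^esub> g = f \<cdot>\<^bsub>C\<^esub> u \<and>
     (\<forall>a \<in> Arr C. \<forall>b \<in> Arr C.
        Dom C a = Dom C b \<and> Cod C a = Dom C f \<and> Cod C b = Dom C v \<and> v \<cdot>\<^bsub>C\<^esub> b = f \<cdot>\<^bsub>C\<^esub> a \<longrightarrow>
        (\<exists>!k. k \<in> hom C (Dom C a) (Dom C u) \<and> u \<cdot>\<^bsub>C\<^esub> k = a \<and> g \<cdot>\<^bsub>C\<^esub> k = b))"

locale display_map_category = category B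
  for B :: "('ob, 'ab) cat" and F :: "'ab set" +
  assumes display_arr: "F \<subseteq> Arr B"
    and pullback_exists: "v \<in> F \<Longrightarrow> f \<in> Arr B \<Longrightarrow> Cod B f = Cod B v \<Longrightarrow> \<exists>u g. is_pullback B v f u g"
    and pullback_display: "v \<in> F \<Longrightarrow> is_pullback B v f u g \<Longrightarrow> u \<in> F"

definition has_units :: "('ob, 'ab) cat \<Rightarrow> 'ab set \<Rightarrow> bool" where
  "has_units B F \<longleftrightarrow> (\<forall>f. iso B f \<longrightarrow> f \<in> F)"

definition has_dependent_coproducts :: "('ob, 'ab) cat \<Rightarrow> 'ab set \<Rightarrow> bool" where
  "has_dependent_coproducts B F \<longleftrightarrow>
     (\<forall>u \<in> F. \<forall>v \<in> F. Dom B v = Cod B u \<longrightarrow> v \<cdot>\<^bsub>B\<^esub> u \<in> F)"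

text \<open>
  A choice of pullback of \<open>h : Y \<rightarrow> J\<close> along \<open>f : I \<rightarrow> J\<close>: \<open>pb_fst B f h : I \<times>\<^sub>J Y \<rightarrow> I\<close>,
  \<open>pb_snd B f h : I \<times>\<^sub>J Y \<rightarrow> Y\<close>, and the arrow into \<open>I \<times>\<^sub>J Y\<close> induced by a commuting cone.
\<close>

definition pb_choice :: "('ob, 'ab) cat \<Rightarrow> 'ab \<Rightarrow> 'ab \<Rightarrow> 'ab \<times> 'ab" where
  "pb_choice B f h = (SOME ug. is_pullback B h f (fst ug) (snd ug))"

definition pb_fst :: "('ob, 'ab) cat \<Rightarrow> 'ab \<Rightarrow> 'ab \<Rightarrow> 'ab" where
  "pb_fst B f h = fst (pb_choice B f h)"

definition pb_snd :: "('ob, 'ab) cat \<Rightarrow> 'ab \<Rightarrow> 'ab \<Rightarrow> 'ab" where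
  "pb_snd B f h = snd (pb_choice B f h)"

definition pb_obj :: "('ob, 'ab) cat \<Rightarrow> 'ab \<Rightarrow> 'ab \<Rightarrow> 'ob" where
  "pb_obj B f h = Dom B (pb_fst B f h)"

definition pb_pair :: "('ob, 'ab) cat \<Rightarrow> 'ab \<Rightarrow> 'ab \<Rightarrow> 'ab \<Rightarrow> 'ab \<Rightarrow> 'ab" where
  "pb_pair B f h a b =
     (THE k. k \<in> hom B (Dom B a) (pb_obj B f h) \<and>
             pb_fst B f h \<cdot>\<^bsub>B\<^esub> k = a \<and> pb_snd B f h \<cdot>\<^bsub>B\<^esub> k = b)"


section \<open>Cloven fibrations\<close>

text \<open>\<open>lift p u X\<close> is the chosen cartesian arrow over \<open>u\<close> with codomain \<open>X\<close>.\<close>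

record ('oe, 'ae, 'ob, 'ab) fib =
  Tot :: "('oe, 'ae) cat"
  proj :: "('oe, 'ae, 'ob, 'ab) ftr"
  lift :: "'ab \<Rightarrow> 'oe \<Rightarrow> 'ae"

abbreviation over_obj :: "('oe, 'ae, 'ob, 'ab) fib \<Rightarrow> 'oe \<Rightarrow> 'ob" where
  "over_obj p X \<equiv> fobj (proj p) X"

abbreviation over_arr :: "('oe, 'ae, 'ob, 'ab) fib \<Rightarrow> 'ae \<Rightarrow> 'ab" where
  "over_arr p x \<equiv> farr (proj p) x"

definition cartesian :: "('ob, 'ab) cat \<Rightarrow> ('oe, 'ae, 'ob, 'ab) fib \<Rightarrow> 'ae \<Rightarrow> bool" where
  "cartesian B p x \<longleftrightarrow> x \<in> Arr (Tot p) \<and>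
     (\<forall>z \<in> Arr (Tot p). \<forall>w \<in> hom B (over_obj p (Dom (Tot p) z)) (over_obj p (Dom (Tot p) x)).
        Cod (Tot p) z = Cod (Tot p) x \<and> over_arr p x \<cdot>\<^bsub>B\<^esub> w = over_arr p z \<longrightarrow>
        (\<exists>!k. k \<in> hom (Tot p) (Dom (Tot p) z) (Dom (Tot p) x) \<and>
              over_arr p k = w \<and> x \<cdot>\<^bsub>Tot p\<^esub> k = z))"

locale cloven_fibration =
  base: category B + total: category "Tot p"
  for B :: "('ob, 'ab) cat" and p :: "('oe, 'ae, 'ob, 'ab) fib" +
  assumes proj_functor: "is_functor (Tot p) B (proj p)"
    and lift_arr: "u \<in> Arr B \<Longrightarrow> X \<in> Obj (Tot p) \<Longrightarrow> over_obj p X = Cod B u \<Longrightarrow>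
           lift p u X \<in> Arr (Tot p) \<and> Cod (Tot p) (lift p u X) = X \<and> over_arr p (lift p u X) = u"
    and lift_cartesian: "u \<in> Arr B \<Longrightarrow> X \<in> Obj (Tot p) \<Longrightarrow> over_obj p X = Cod B u \<Longrightarrow>
           cartesian B p (lift p u X)"

text \<open>The arrows of the fibre over \<open>A\<close> are the vertical arrows over \<open>A\<close>.\<close>

definition fibre :: "('ob, 'ab) cat \<Rightarrow> ('oe, 'ae, 'ob, 'ab) fib \<Rightarrow> 'ob \<Rightarrow> ('oe, 'ae) cat" where
  "fibre B p A =
     \<lparr>Obj = {X \<in> Obj (Tot p). over_obj p X = A},
      Arr = {x \<in> Arr (Tot p). over_arr p x = Ident B A},
      Dom = Dom (Tot p), Cod = Cod (Tot p), Ident = Ident (Tot p), Comp = Comp (Tot p)\<rparr>"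

text \<open>
  For \<open>y\<close> cartesian and \<open>x\<close> an arrow with the same codomain over the same base arrow,
  \<open>vfactor B p x y\<close> is the unique vertical \<open>k\<close> with \<open>y k = x\<close>. When \<open>x\<close> is cartesian too, this is
  the canonical isomorphism between their domains; the isomorphisms \<open>g\<^sup>*u\<^sup>*X \<cong> (ug)\<^sup>*X\<close>, customarily
  suppressed, are all obtained in this way from composites of chosen lifts.
\<close>

definition vfactor :: "('ob, 'ab) cat \<Rightarrow> ('oe, 'ae, 'ob, 'ab) fib \<Rightarrow> 'ae \<Rightarrow> 'ae \<Rightarrow> 'ae" where
  "vfactor B p x y =
     (THE k. k \<in> hom (Tot p) (Dom (Tot p) x) (Dom (Tot p) y) \<and>
             over_arr p k = Ident B (over_obj p (Dom (Tot p) x)) \<and> y \<cdot>\<^bsub>Tot p\<^esub> k = x)"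

definition reindex ::
  "('ob, 'ab) cat \<Rightarrow> ('oe, 'ae, 'ob, 'ab) fib \<Rightarrow> 'ab \<Rightarrow> ('oe, 'ae, 'oe, 'ae) ftr" where
  "reindex B p u =
     \<lparr>fobj = (\<lambda>X. Dom (Tot p) (lift p u X)),
      farr = (\<lambda>k. vfactor B p (k \<cdot>\<^bsub>Tot p\<^esub> lift p u (Dom (Tot p) k)) (lift p u (Cod (Tot p) k)))\<rparr>"

text \<open>\<open>lift2 B p u g X : g\<^sup>*u\<^sup>*X \<rightarrow> X\<close> is the composite of chosen lifts, over \<open>u g\<close>.\<close>

definition lift2 ::
  "('ob, 'ab) cat \<Rightarrow> ('oe, 'ae, 'ob, 'ab) fib \<Rightarrow> 'ab \<Rightarrow> 'ab \<Rightarrow> 'oe \<Rightarrow> 'ae" where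
  "lift2 B p u g X = lift p u X \<cdot>\<^bsub>Tot p\<^esub> lift p g (fobj (reindex B p u) X)"


section \<open>Fibred equivalence\<close>

definition fibred_functor ::
  "('ob, 'ab) cat \<Rightarrow> ('oe, 'ae, 'ob, 'ab) fib \<Rightarrow> ('od, 'ad, 'ob, 'ab) fib \<Rightarrow>
   ('oe, 'ae, 'od, 'ad) ftr \<Rightarrow> bool" where
  "fibred_functor B p q H \<longleftrightarrow>
     is_functor (Tot p) (Tot q) H \<and>
     (\<forall>X \<in> Obj (Tot p). over_obj q (fobj H X) = over_obj p X) \<and>
     (\<forall>x \<in> Arr (Tot p). over_arr q (farr H x) = over_arr p x) \<and>
     (\<forall>x. cartesian B p x \<longrightarrow> cartesian B q (farr H x))"

definition vertical_nat_iso ::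
  "('ob, 'ab) cat \<Rightarrow> ('oe, 'ae, 'ob, 'ab) fib \<Rightarrow> ('od, 'ad, 'ob, 'ab) fib \<Rightarrow>
   ('oe, 'ae, 'od, 'ad) ftr \<Rightarrow> ('oe, 'ae, 'od, 'ad) ftr \<Rightarrow> ('oe \<Rightarrow> 'ad) \<Rightarrow> bool" where
  "vertical_nat_iso B p q H K t \<longleftrightarrow>
     nat_iso (Tot p) (Tot q) H K t \<and>
     (\<forall>X \<in> Obj (Tot p). over_arr q (t X) = Ident B (over_obj p X))"

definition fibred_equivalent ::
  "('ob, 'ab) cat \<Rightarrow> ('oe, 'ae, 'ob, 'ab) fib \<Rightarrow> ('od, 'ad, 'ob, 'ab) fib \<Rightarrow> bool" where
  "fibred_equivalent B p q \<longleftrightarrow>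
     (\<exists>H K s t. fibred_functor B p q H \<and> fibred_functor B q p K \<and>
        vertical_nat_iso B p p (comp_ftr K H) id_ftr s \<and>
        vertical_nat_iso B q q (comp_ftr H K) id_ftr t)"


section \<open>Products along display maps\<close>

record ('oe, 'ae, 'ab) products =
  Prd :: "'ab \<Rightarrow> ('oe, 'ae, 'oe, 'ae) ftr"
  prd_unit :: "'ab \<Rightarrow> 'oe \<Rightarrow> 'ae"
  prd_counit :: "'ab \<Rightarrow> 'oe \<Rightarrow> 'ae"

text \<open>
  The component at \<open>\<beta>\<close> of the canonical map \<open>f\<^sup>* \<Prod>\<^sub>v \<Rightarrow> \<Prod>\<^sub>u g\<^sup>*\<close> for a square \<open>v g = f u\<close>: the
  transpose along \<open>u\<^sup>* \<stileturn> \<Prod>\<^sub>u\<close> of \<open>u\<^sup>* f\<^sup>* \<Prod>\<^sub>v \<beta> \<cong> g\<^sup>* v\<^sup>* \<Prod>\<^sub>v \<beta> \<rightarrow> g\<^sup>* \<beta>\<close>, whose second arrow is \<open>g\<^sup>* \<epsilon>\<^sub>\<beta>\<close>.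
\<close>

definition bc_map ::
  "('ob, 'ab) cat \<Rightarrow> ('oe, 'ae, 'ob, 'ab) fib \<Rightarrow> ('oe, 'ae, 'ab) products \<Rightarrow>
   'ab \<Rightarrow> 'ab \<Rightarrow> 'ab \<Rightarrow> 'ab \<Rightarrow> 'oe \<Rightarrow> 'ae" where
  "bc_map B p P v f u g \<beta> =
     (let X = fobj (Prd P v) \<beta>;
          \<theta> = vfactor B p (lift2 B p f u X) (lift2 B p v g X)
      in farr (Prd P u) (farr (reindex B p g) (prd_counit P v \<beta>) \<cdot>\<^bsub>Tot p\<^esub> \<theta>)
           \<cdot>\<^bsub>Tot p\<^esub> prd_unit P u (fobj (reindex B p f) X))"

definition has_products ::
  "('ob, 'ab) cat \<Rightarrow> 'ab set \<Rightarrow> ('oe, 'ae, 'ob, 'ab) fib \<Rightarrow> ('oe, 'ae, 'ab) products \<Rightarrow> bool" where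
  "has_products B F p P \<longleftrightarrow>
     (\<forall>v \<in> F. adjunction (fibre B p (Cod B v)) (fibre B p (Dom B v))
                (reindex B p v) (Prd P v) (prd_unit P v) (prd_counit P v)) \<and>
     (\<forall>v \<in> F. \<forall>u \<in> F. \<forall>f g. is_pullback B v f u g \<longrightarrow>
        (\<forall>\<beta> \<in> Obj (fibre B p (Dom B v)). iso (fibre B p (Dom B f)) (bc_map B p P v f u g \<beta>)))"


section \<open>Quantifier-free objects\<close>

definition is_section :: "('ob, 'ab) cat \<Rightarrow> 'ab \<Rightarrow> 'ab \<Rightarrow> bool" where
  "is_section B u g \<longleftrightarrow> g \<in> hom B (Cod B u) (Dom B u) \<and> u \<cdot>\<^bsub>B\<^esub> g = Ident B (Cod B u)"

text \<open>
  For a section \<open>g\<close> of \<open>u\<close>, the composite \<open>\<Prod>\<^sub>u \<beta> \<cong> g\<^sup>* u\<^sup>* \<Prod>\<^sub>u \<beta> \<rightarrow> g\<^sup>* \<beta>\<close> whose second arrow is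
  \<open>g\<^sup>* \<epsilon>\<^sub>\<beta>\<close>.
\<close>

definition section_counit ::
  "('ob, 'ab) cat \<Rightarrow> ('oe, 'ae, 'ob, 'ab) fib \<Rightarrow> ('oe, 'ae, 'ab) products \<Rightarrow>
   'ab \<Rightarrow> 'ab \<Rightarrow> 'oe \<Rightarrow> 'ae" where
  "section_counit B p P u g \<beta> =
     (let X = fobj (Prd P u) \<beta>
      in farr (reindex B p g) (prd_counit P u \<beta>)
           \<cdot>\<^bsub>Tot p\<^esub> vfactor B p (Ident (Tot p) X) (lift2 B p u g X))"

text \<open>Uniqueness of \<open>g\<close> and \<open>k\<close> is uniqueness of the pair.\<close>

definition quantifier_splitting ::
  "('ob, 'ab) cat \<Rightarrow> 'ab set \<Rightarrow> ('oe, 'ae, 'ob, 'ab) fib \<Rightarrow> ('oe, 'ae, 'ab) products \<Rightarrow>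
   'oe \<Rightarrow> bool" where
  "quantifier_splitting B F p P \<alpha> \<longleftrightarrow> \<alpha> \<in> Obj (Tot p) \<and>
     (\<forall>u \<in> F. Cod B u = over_obj p \<alpha> \<longrightarrow>
        (\<forall>\<beta> \<in> Obj (fibre B p (Dom B u)).
         \<forall>h \<in> hom (fibre B p (Cod B u)) (fobj (Prd P u) \<beta>) \<alpha>.
           \<exists>!(g, k). is_section B u g \<and>
             k \<in> hom (fibre B p (Cod B u)) (fobj (reindex B p g) \<beta>) \<alpha> \<and>
             h = k \<cdot>\<^bsub>Tot p\<^esub> section_counit B p P u g \<beta>))"

definition quantifier_free ::
  "('ob, 'ab) cat \<Rightarrow> 'ab set \<Rightarrow> ('oe, 'ae, 'ob, 'ab) fib \<Rightarrow> ('oe, 'ae, 'ab) products \<Rightarrow>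
   'oe \<Rightarrow> bool" where
  "quantifier_free B F p P \<alpha> \<longleftrightarrow> \<alpha> \<in> Obj (Tot p) \<and>
     (\<forall>f \<in> Arr B. Cod B f = over_obj p \<alpha> \<longrightarrow>
        quantifier_splitting B F p P (fobj (reindex B p f) \<alpha>))"

definition enough_quantifier_free ::
  "('ob, 'ab) cat \<Rightarrow> 'ab set \<Rightarrow> ('oe, 'ae, 'ob, 'ab) fib \<Rightarrow> ('oe, 'ae, 'ab) products \<Rightarrow> bool" where
  "enough_quantifier_free B F p P \<longleftrightarrow> has_products B F p P \<and>
     (\<forall>\<alpha> \<in> Obj (Tot p). \<exists>f \<in> F. \<exists>\<beta> \<in> Obj (fibre B p (Dom B f)).
        Cod B f = over_obj p \<alpha> \<and> quantifier_free B F p P \<beta> \<and>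
        isomorphic (fibre B p (Cod B f)) \<alpha> (fobj (Prd P f) \<beta>))"


section \<open>The product completion\<close>

text \<open>
  An arrow \<open>(g : X \<rightarrow> I, \<alpha>) \<rightarrow> (h : Y \<rightarrow> J, \<beta>)\<close> of the completion is recorded by its source, its
  target, the base arrow \<open>f\<^sub>0 : I \<rightarrow> J\<close>, the arrow \<open>f\<^sub>1 : I \<times>\<^sub>J Y \<rightarrow> X\<close> over \<open>I\<close>, and the vertical
  arrow \<open>\<phi> : f\<^sub>1\<^sup>* \<alpha> \<rightarrow> f\<^sub>0'\<^sup>* \<beta>\<close> over \<open>I \<times>\<^sub>J Y\<close>, where \<open>f\<^sub>0' : I \<times>\<^sub>J Y \<rightarrow> Y\<close> is the projection.
\<close>

record ('oe, 'ae, 'ab) pi_arr =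
  pi_src :: "'ab \<times> 'oe"
  pi_tgt :: "'ab \<times> 'oe"
  pi_base :: 'ab
  pi_map :: 'ab
  pi_vert :: 'ae

definition pi_objs ::
  "('ob, 'ab) cat \<Rightarrow> 'ab set \<Rightarrow> ('oe, 'ae, 'ob, 'ab) fib \<Rightarrow> ('ab \<times> 'oe) set" where
  "pi_objs B F p = {(g, \<alpha>). g \<in> F \<and> \<alpha> \<in> Obj (fibre B p (Dom B g))}"

definition pi_arrs ::
  "('ob, 'ab) cat \<Rightarrow> 'ab set \<Rightarrow> ('oe, 'ae, 'ob, 'ab) fib \<Rightarrow> ('oe, 'ae, 'ab) pi_arr set" where
  "pi_arrs B F p =
     {\<lparr>pi_src = (g, \<alpha>), pi_tgt = (h, \<beta>), pi_base = f0, pi_map = f1, pi_vert = \<phi>\<rparr> | g \<alpha> h \<beta> f0 f1 \<phi>.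
        (g, \<alpha>) \<in> pi_objs B F p \<and> (h, \<beta>) \<in> pi_objs B F p \<and>
        f0 \<in> hom B (Cod B g) (Cod B h) \<and>
        f1 \<in> hom B (pb_obj B f0 h) (Dom B g) \<and> g \<cdot>\<^bsub>B\<^esub> f1 = pb_fst B f0 h \<and>
        \<phi> \<in> hom (fibre B p (pb_obj B f0 h))
                (fobj (reindex B p f1) \<alpha>) (fobj (reindex B p (pb_snd B f0 h)) \<beta>)}"

definition pi_ident ::
  "('ob, 'ab) cat \<Rightarrow> ('oe, 'ae, 'ob, 'ab) fib \<Rightarrow> 'ab \<times> 'oe \<Rightarrow> ('oe, 'ae, 'ab) pi_arr" where
  "pi_ident B p = (\<lambda>(g, \<alpha>).
     let i = Ident B (Cod B g); r = pb_snd B i g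
     in \<lparr>pi_src = (g, \<alpha>), pi_tgt = (g, \<alpha>), pi_base = i, pi_map = r,
         pi_vert = Ident (Tot p) (fobj (reindex B p r) \<alpha>)\<rparr>)"

text \<open>
  The composite of \<open>m = (f\<^sub>0, f\<^sub>1, \<phi>) : (g : X \<rightarrow> I, \<alpha>) \<rightarrow> (h : Y \<rightarrow> J, \<beta>)\<close> followed by
  \<open>n = (k\<^sub>0, k\<^sub>1, \<psi>) : (h, \<beta>) \<rightarrow> (l : Z \<rightarrow> K, \<gamma>)\<close>. Let \<open>a : I \<times>\<^sub>K Z \<rightarrow> I\<close> and \<open>b : I \<times>\<^sub>K Z \<rightarrow> Z\<close> be the
  projections for \<open>k\<^sub>0 f\<^sub>0\<close> and \<open>l\<close>. With \<open>t = (f\<^sub>0 a, b) : I \<times>\<^sub>K Z \<rightarrow> J \<times>\<^sub>K Z\<close> and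
  \<open>s = (a, k\<^sub>1 t) : I \<times>\<^sub>K Z \<rightarrow> I \<times>\<^sub>J Y\<close>, the composite has second component \<open>f\<^sub>1 s\<close> and vertical
  component
  \<open>(f\<^sub>1 s)\<^sup>* \<alpha> \<cong> s\<^sup>* f\<^sub>1\<^sup>* \<alpha> \<rightarrow> s\<^sup>* f\<^sub>0'\<^sup>* \<beta> \<cong> t\<^sup>* k\<^sub>1\<^sup>* \<beta> \<rightarrow> t\<^sup>* k\<^sub>0'\<^sup>* \<gamma> \<cong> b\<^sup>* \<gamma>\<close>,
  the two middle arrows being \<open>s\<^sup>* \<phi>\<close> and \<open>t\<^sup>* \<psi>\<close>; note \<open>f\<^sub>0' s = k\<^sub>1 t\<close> and \<open>k\<^sub>0' t = b\<close>.
\<close>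

definition pi_comp ::
  "('ob, 'ab) cat \<Rightarrow> ('oe, 'ae, 'ob, 'ab) fib \<Rightarrow>
   ('oe, 'ae, 'ab) pi_arr \<Rightarrow> ('oe, 'ae, 'ab) pi_arr \<Rightarrow> ('oe, 'ae, 'ab) pi_arr" where
  "pi_comp B p n m =
     (let \<alpha> = snd (pi_src m); h = fst (pi_tgt m); \<beta> = snd (pi_tgt m);
          l = fst (pi_tgt n); \<gamma> = snd (pi_tgt n);
          f0 = pi_base m; f1 = pi_map m; k0 = pi_base n; k1 = pi_map n;
          c0 = k0 \<cdot>\<^bsub>B\<^esub> f0; a = pb_fst B c0 l; b = pb_snd B c0 l;
          t = pb_pair B k0 l (f0 \<cdot>\<^bsub>B\<^esub> a) b;
          s = pb_pair B f0 h a (k1 \<cdot>\<^bsub>B\<^esub> t);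
          c1 = f1 \<cdot>\<^bsub>B\<^esub> s;
          i\<alpha> = vfactor B p (lift p c1 \<alpha>) (lift2 B p f1 s \<alpha>);
          i\<beta> = vfactor B p (lift2 B p (pb_snd B f0 h) s \<beta>) (lift2 B p k1 t \<beta>);
          i\<gamma> = vfactor B p (lift2 B p (pb_snd B k0 l) t \<gamma>) (lift p b \<gamma>)
      in \<lparr>pi_src = pi_src m, pi_tgt = pi_tgt n, pi_base = c0, pi_map = c1,
          pi_vert = i\<gamma> \<cdot>\<^bsub>Tot p\<^esub> farr (reindex B p t) (pi_vert n) \<cdot>\<^bsub>Tot p\<^esub> i\<beta>
                      \<cdot>\<^bsub>Tot p\<^esub> farr (reindex B p s) (pi_vert m) \<cdot>\<^bsub>Tot p\<^esub> i\<alpha>\<rparr>)"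

text \<open>
  The chosen lift of \<open>f : I \<rightarrow> J\<close> at \<open>(h : Y \<rightarrow> J, \<beta>)\<close> has domain \<open>(I \<times>\<^sub>J Y \<rightarrow> I, f'\<^sup>* \<beta>)\<close>; its vertical
  component is the canonical \<open>id\<^sup>* f'\<^sup>* \<beta> \<cong> f'\<^sup>* \<beta>\<close>, i.e. the chosen lift of the identity.
\<close>

definition pi_lift ::
  "('ob, 'ab) cat \<Rightarrow> ('oe, 'ae, 'ob, 'ab) fib \<Rightarrow> 'ab \<Rightarrow> 'ab \<times> 'oe \<Rightarrow> ('oe, 'ae, 'ab) pi_arr" where
  "pi_lift B p f = (\<lambda>(h, \<beta>).
     let X = fobj (reindex B p (pb_snd B f h)) \<beta>; i = Ident B (pb_obj B f h)
     in \<lparr>pi_src = (pb_fst B f h, X), pi_tgt = (h, \<beta>), pi_base = f, pi_map = i,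
         pi_vert = lift p i X\<rparr>)"

definition product_completion ::
  "('ob, 'ab) cat \<Rightarrow> 'ab set \<Rightarrow> ('oe, 'ae, 'ob, 'ab) fib \<Rightarrow>
   ('ab \<times> 'oe, ('oe, 'ae, 'ab) pi_arr, 'ob, 'ab) fib" where
  "product_completion B F p =
     \<lparr>Tot = \<lparr>Obj = pi_objs B F p, Arr = pi_arrs B F p, Dom = pi_src, Cod = pi_tgt,
             Ident = pi_ident B p, Comp = pi_comp B p\<rparr>,
      proj = \<lparr>fobj = (\<lambda>(g, \<alpha>). Cod B g), farr = pi_base\<rparr>,
      lift = pi_lift B p\<rparr>"

end

theory Submission imports Defs begin

text \<open>
  The fibrewise opposite turns products into coproducts. Under it, the section \<open>g\<close> and the vertical
  arrow \<open>g\<^sup>*\<beta> \<rightarrow> \<alpha>\<close> of the definition of quantifier splitting form a single arrow \<open>\<alpha> \<rightarrow> \<beta>\<close> over \<open>g\<close>, so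
  that \<open>\<alpha>\<close> is splitting iff every vertical \<open>\<alpha> \<rightarrow> \<Sigma>\<^sub>u\<beta>\<close> factors uniquely through the opcartesian arrow
  \<open>\<beta> \<rightarrow> \<Sigma>\<^sub>u\<beta>\<close>. An arrow \<open>(g, \<alpha>) \<rightarrow> (h, \<beta>)\<close> of the coproduct completion over \<open>f\<close> is just an arrow
  \<open>\<phi> : \<alpha> \<rightarrow> \<beta>\<close> with \<open>h (p \<phi>) =
    f g\<close>, and the product completion is the opposite of the coproduct
  completion of the opposite.

  If there are enough free objects, \<open>(g, \<alpha>) \<mapsto> \<Sigma>\<^sub>g\<alpha>\<close> on the coproduct completion of the full
  subfibration of free objects is essentially surjective, and it is fully faithful because arrows
  \<open>\<Sigma>\<^sub>g\<alpha> \<rightarrow> \<Sigma>\<^sub>h\<beta>\<close> are arrows \<open>\<alpha> \<rightarrow> \<Sigma>\<^sub>h\<beta>\<close>, which by the Beck--Chevalley condition and freeness of \<open>\<alpha>\<close> factor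
  uniquely through \<open>\<beta>\<close>. Conversely, in a coproduct completion the objects \<open>(id, \<alpha>)\<close> are free and
  \<open>(g, \<alpha>) = \<Sigma>\<^sub>g(id, \<alpha>)\<close>.
\<close>

section \<open>Categories over a base\<close>

text \<open>Composition in the product completion is full of canonical isomorphisms, so its category
  laws are not checked directly: a bijection on arrows identifies it with a double opposite, and the
  laws are pulled back along that bijection. In the usual fibrewise opposite an arrow is an
  equivalence class of spans; the cleavage supplies one representative of each class, which makes
  arrows plain triples and makes such a bijection possible. The price is that chosen lifts compose
  only up to vertical isomorphism, and the comparison arrows have to be carried through every
  composition. Freeness is expressed by all cartesian and all opcartesian arrows rather than by a
  choice of either, so that it can be tested on convenient representatives. A fibred equivalence is
  handled as a functor over the base that is full, faithful and essentially surjective up to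
  vertical isomorphism. No cleavage enters into this notion, so it applies to the completion, of
  which only the structure of a category over the base is established.\<close>

context category
begin

lemma Obj_Dom [simp]: "f \<in> Arr C \<Longrightarrow> Dom C f \<in> Obj C"
  and Obj_Cod [simp]: "f \<in> Arr C \<Longrightarrow> Cod C f \<in> Obj C"
  by (fact dom_closed cod_closed)+

lemma Ident_simps [simp]:
  assumes "a \<in> Obj C"
  shows "Ident C a \<in> Arr C" "Dom C (Ident C a) = a" "Cod C (Ident C a) = a"
  using id_closed[OF assms] by (auto simp: hom_def)

lemma Comp_simps [simp]:
  assumes "f \<in> Arr C" "g \<in> Arr C" "Dom C g = Cod C f"
  shows "g \<cdot>\<^bsub>C\<^esub> f \<in> Arr C" "Dom C (g \<cdot>\<^bsub>C\<^esub> f) = Dom C f"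
    "Cod C (g \<cdot>\<^bsub>C\<^esub> f) = Cod C g"
  using comp_closed[of f "Dom C f" "Cod C f" g "Cod C g"] assms by (auto simp: hom_def)

lemma Ident_Comp [simp]: "f \<in> Arr C \<Longrightarrow> a = Cod C f \<Longrightarrow>
  Ident C a \<cdot>\<^bsub>C\<^esub> f = f"
  using id_left[of f "Dom C f" "Cod C f"] by (auto simp: hom_def)

lemma Comp_Ident [simp]: "f \<in> Arr C \<Longrightarrow> a = Dom C f \<Longrightarrow>
  f \<cdot>\<^bsub>C\<^esub> Ident C a = f"
  using id_right[of f "Dom C f" "Cod C f"] by (auto simp: hom_def)

lemma Comp_assoc [simp]:
  "f \<in> Arr C \<Longrightarrow> g \<in> Arr C \<Longrightarrow> h \<in> Arr C \<Longrightarrow> Dom C g =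
    Cod C f \<Longrightarrow> Dom C h = Cod C g \<Longrightarrow>
    (h \<cdot>\<^bsub>C\<^esub> g) \<cdot>\<^bsub>C\<^esub> f =
      h \<cdot>\<^bsub>C\<^esub> (g \<cdot>\<^bsub>C\<^esub> f)"
  using comp_assoc[of f "Dom C f" "Cod C f" g "Cod C g" h "Cod C h"] by (auto simp: hom_def)

lemma isoI:
  "f \<in> Arr C \<Longrightarrow> g \<in> Arr C \<Longrightarrow> Dom C g = Cod C f \<Longrightarrow>
    Cod C g = Dom C f \<Longrightarrow>
    g \<cdot>\<^bsub>C\<^esub> f = Ident C (Dom C f) \<Longrightarrow> f \<cdot>\<^bsub>C\<^esub> g =
      Ident C (Cod C f) \<Longrightarrow> iso C f"
  by (auto simp: iso_def hom_def)

lemma isoE: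
  assumes "iso C f"
  obtains g where "f \<in> Arr C" "g \<in> Arr C" "Dom C g = Cod C f" "Cod C g = Dom C f"
    "g \<cdot>\<^bsub>C\<^esub> f = Ident C (Dom C f)" "f \<cdot>\<^bsub>C\<^esub> g = Ident C (Cod C f)"
  using assms by (auto simp: iso_def hom_def)

lemma iso_Ident: "a \<in> Obj C \<Longrightarrow> iso C (Ident C a)"
  by (rule isoI[where g = "Ident C a"]) auto

end

abbreviation src :: "('oe, 'ae, 'ob, 'ab) fib \<Rightarrow> 'ae \<Rightarrow> 'oe"
  where "src p \<equiv> Dom (Tot p)"
abbreviation tgt :: "('oe, 'ae, 'ob, 'ab) fib \<Rightarrow> 'ae \<Rightarrow> 'oe"
  where "tgt p \<equiv> Cod (Tot p)"
abbreviation arr :: "('oe, 'ae, 'ob, 'ab) fib \<Rightarrow> 'ae set" where "arr p \<equiv> Arr (Tot p)"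
abbreviation ob :: "('oe, 'ae, 'ob, 'ab) fib \<Rightarrow> 'oe set" where "ob p \<equiv> Obj (Tot p)"
abbreviation base_comp (\<open>(_ \<cdot>[_]/ _)\<close> [71, 0, 70] 70)
  where "g \<cdot>[C] f \<equiv> Comp C g f"
abbreviation total_comp (\<open>(_ \<odot>[_]/ _)\<close> [71, 0, 70] 70)
  where "y \<odot>[p] x \<equiv> Comp (Tot p) y x"

locale category_over =
  base: category B + total: category "Tot p"
  for B :: "('ob, 'ab) cat" and p :: "('oe, 'ae, 'ob, 'ab) fib" +
  assumes projection: "is_functor (Tot p) B (proj p)"
begin

lemma over_obj_closed [simp]: "X \<in> ob p \<Longrightarrow> over_obj p X \<in> Obj B"
  and over_Ident [simp]: "X \<in> ob p \<Longrightarrow> over_arr p (Ident (Tot p) X) = Ident B (over_obj p X)"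
  and over_arr_closed [simp]: "x \<in> arr p \<Longrightarrow> over_arr p x \<in> Arr B"
  and over_Dom [simp]: "x \<in> arr p \<Longrightarrow> over_obj p (src p x) = Dom B (over_arr p x)"
  and over_Cod [simp]: "x \<in> arr p \<Longrightarrow> over_obj p (tgt p x) = Cod B (over_arr p x)"
  and over_Comp [simp]: "x \<in> arr p \<Longrightarrow> y \<in> arr p \<Longrightarrow> src p y =
    tgt p x \<Longrightarrow>
    over_arr p (y \<odot>[p] x) = over_arr p y \<cdot>[B] over_arr p x"
  using projection by (auto simp: is_functor_def hom_def)

lemma base_composable:
  "x \<in> arr p \<Longrightarrow> y \<in> arr p \<Longrightarrow> src p y = tgt p x \<Longrightarrow>
    Dom B (over_arr p y) = Cod B (over_arr p x)"
  by (metis over_Dom over_Cod)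

end

text \<open>The inverse \<open>j\<close> is an argument rather than an existential witness, so that
  cancelling one arrow against the other becomes a rewrite rule.\<close>

definition over_iso :: "('ob, 'ab) cat \<Rightarrow> ('oe, 'ae, 'ob, 'ab) fib \<Rightarrow> 'oe \<Rightarrow> 'oe \<Rightarrow> 'ae \<Rightarrow> 'ae \<Rightarrow> bool" where
  "over_iso B p X Y i j \<longleftrightarrow> i \<in> hom (Tot p) X Y \<and> j \<in> hom (Tot p) Y X \<and>
     over_arr p i = Ident B (over_obj p X) \<and> over_arr p j = Ident B (over_obj p X) \<and>
     j \<odot>[p] i = Ident (Tot p) X \<and> i \<odot>[p] j = Ident (Tot p) Y"

text \<open>Unlike in \<open>vfactor\<close>, the base arrow \<open>w\<close> of the factorization
  is free. The comparison from the chosen lift of \<open>v u\<close> to that of \<open>v\<close>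
  lies over \<open>u\<close> and needs this generality.\<close>

definition cfactor :: "('oe, 'ae, 'ob, 'ab) fib \<Rightarrow> 'ae \<Rightarrow> 'ae \<Rightarrow> 'ab \<Rightarrow> 'ae" where
  "cfactor p x z w = (THE k. k \<in> hom (Tot p) (src p z) (src p x) \<and>
     over_arr p k = w \<and> x \<odot>[p] k = z)"

lemma vfactor_cfactor: "vfactor B p x y = cfactor p y x (Ident B (over_obj p (src p x)))"
  by (simp add: vfactor_def cfactor_def)

context category_over
begin

lemma over_isoD:
  assumes "over_iso B p X Y i j"
  shows "i \<in> arr p" "j \<in> arr p" "src p i = X" "tgt p i = Y"
    "src p j = Y" "tgt p j = X"
    "over_arr p i = Ident B (over_obj p X)" "over_arr p j = Ident B (over_obj p X)"
    "j \<odot>[p] i = Ident (Tot p) X" "i \<odot>[p] j = Ident (Tot p) Y"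
    "X \<in> ob p" "Y \<in> ob p" "over_obj p Y = over_obj p X"
proof -
  show i: "i \<in> arr p" "j \<in> arr p" "src p i = X" "tgt p i = Y"
    "src p j = Y" "tgt p j = X"
    "over_arr p i = Ident B (over_obj p X)" "over_arr p j = Ident B (over_obj p X)"
    "j \<odot>[p] i = Ident (Tot p) X" "i \<odot>[p] j = Ident (Tot p) Y"
    using assms by (auto simp: over_iso_def hom_def)
  show "X \<in> ob p" "Y \<in> ob p" using i total.Obj_Dom total.Obj_Cod by metis+
  then show "over_obj p Y = over_obj p X" using i over_Cod[of i] by simp
qed

lemma over_iso_sym: "over_iso B p X Y i j \<Longrightarrow> over_iso B p Y X j i"
  unfolding over_iso_def[of B p Y] by (frule over_isoD) (auto simp: over_isoD hom_def)

lemma over_iso_cancel: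
  assumes "over_iso B p X Y i j" "x \<in> arr p"
  shows "tgt p x = X \<Longrightarrow> j \<odot>[p] (i \<odot>[p] x) = x"
    and "tgt p x = Y \<Longrightarrow> i \<odot>[p] (j \<odot>[p] x) = x"
  using over_isoD[OF assms(1)] assms(2)
  by (simp_all only: total.Comp_assoc[symmetric] total.Ident_Comp)

lemma over_iso_cancel_right:
  assumes "over_iso B p X Y i j" "x \<in> arr p"
  shows "src p x = X \<Longrightarrow> (x \<odot>[p] j) \<odot>[p] i = x"
    and "src p x = Y \<Longrightarrow> (x \<odot>[p] i) \<odot>[p] j = x"
  using over_isoD[OF assms(1)] assms(2) by simp_all

lemma over_iso_trans:
  assumes "over_iso B p X Y i j" "over_iso B p Y Z k l"
  shows "over_iso B p X Z (k \<odot>[p] i) (j \<odot>[p] l)"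
  using over_isoD[OF assms(1)] over_isoD[OF assms(2)]
    over_iso_cancel[OF assms(1)] over_iso_cancel[OF assms(2)]
  by (auto simp: over_iso_def hom_def)

lemma cartesian_ex1:
  assumes "cartesian B p x" "z \<in> arr p" "tgt p z = tgt p x" "w \<in> Arr B"
    "Dom B w = Dom B (over_arr p z)" "Cod B w = Dom B (over_arr p x)"
    "over_arr p x \<cdot>[B] w = over_arr p z"
  shows "\<exists>!k. k \<in> hom (Tot p) (src p z) (src p x) \<and>
              over_arr p k = w \<and> x \<odot>[p] k = z"
  using assms unfolding cartesian_def by (simp add: hom_def)

lemma cartesian_Arr: "cartesian B p x \<Longrightarrow> x \<in> arr p"
  by (simp add: cartesian_def)

lemma cfactor_simps [simp]:
  assumes "cartesian B p x" "z \<in> arr p" "tgt p z = tgt p x" "w \<in> Arr B"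
    "Dom B w = Dom B (over_arr p z)" "Cod B w = Dom B (over_arr p x)"
    "over_arr p x \<cdot>[B] w = over_arr p z"
  shows "cfactor p x z w \<in> arr p" "src p (cfactor p x z w) = src p z"
    "tgt p (cfactor p x z w) = src p x" "over_arr p (cfactor p x z w) = w"
    "x \<odot>[p] cfactor p x z w = z"
  using theI'[OF cartesian_ex1[OF assms]] unfolding cfactor_def[symmetric] by (auto simp: hom_def)

lemma cfactor_Comp [simp]:
  assumes "cartesian B p x" "z \<in> arr p" "tgt p z = tgt p x" "w \<in> Arr B"
    "Dom B w = Dom B (over_arr p z)" "Cod B w = Dom B (over_arr p x)"
    "over_arr p x \<cdot>[B] w = over_arr p z" "y \<in> arr p" "tgt p y = src p z"
  shows "x \<odot>[p] (cfactor p x z w \<odot>[p] y) = z \<odot>[p] y"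
  using assms(8,9) cfactor_simps[OF assms(1-7)] cartesian_Arr[OF assms(1)]
  by (simp only: total.Comp_assoc[symmetric])

lemma cartesian_eqI:
  assumes "cartesian B p x" "k \<in> arr p" "l \<in> arr p"
    "src p k = src p l" "tgt p k = src p x" "tgt p l = src p x"
    "over_arr p k = over_arr p l" "x \<odot>[p] k = x \<odot>[p] l"
  shows "k = l"
proof -
  note x = cartesian_Arr[OF assms(1)]
  have "Cod B (over_arr p l) = Dom B (over_arr p x)"
    using base_composable[OF assms(3) x] assms(6) by simp
  then have "\<exists>!m. m \<in> hom (Tot p) (src p (x \<odot>[p] l)) (src p x) \<and>
              over_arr p m = over_arr p l \<and> x \<odot>[p] m = x \<odot>[p] l"
    using assms x by (intro cartesian_ex1) auto
  then show ?thesis using assms x by (auto simp: hom_def)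
qed

lemma cfactor_eqI:
  assumes "cartesian B p x" "k \<in> arr p" "tgt p k = src p x"
    "over_arr p k = w" "x \<odot>[p] k = z"
  shows "cfactor p x z w = k"
proof -
  note x = cartesian_Arr[OF assms(1)]
  have b: "Dom B (over_arr p x) = Cod B (over_arr p k)"
    using assms(2,3) x by (intro base_composable) auto
  have "cfactor p x (x \<odot>[p] k) (over_arr p k) = k"
    by (rule cartesian_eqI[OF assms(1)]) (use assms(1-3) x b in auto)
  with assms(4,5) show ?thesis by simp
qed

lemma cartesianI:
  assumes "x \<in> arr p"
    and ex: "\<And>z w. z \<in> arr p \<Longrightarrow> tgt p z = tgt p x \<Longrightarrow>
      w \<in> Arr B \<Longrightarrow>
      Dom B w = Dom B (over_arr p z) \<Longrightarrow> Cod B w = Dom B (over_arr p x) \<Longrightarrow>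
      over_arr p x \<cdot>[B] w = over_arr p z \<Longrightarrow>
      \<exists>k. k \<in> arr p \<and> src p k = src p z \<and> tgt p k = src p x \<and>
        over_arr p k = w \<and> x \<odot>[p] k = z"
    and eq: "\<And>k l. k \<in> arr p \<Longrightarrow> l \<in> arr p \<Longrightarrow> src p k =
      src p l \<Longrightarrow>
      tgt p k = src p x \<Longrightarrow> tgt p l = src p x \<Longrightarrow>
      over_arr p k = over_arr p l \<Longrightarrow> x \<odot>[p] k = x \<odot>[p] l \<Longrightarrow> k = l"
  shows "cartesian B p x"
  unfolding cartesian_def
proof (intro conjI ballI impI)
  fix z w
  assume z: "z \<in> arr p" and w: "w \<in> hom B (over_obj p (src p z)) (over_obj p (src p x))"
    and c: "tgt p z = tgt p x \<and> over_arr p x \<cdot>[B] w = over_arr p z"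
  have "\<exists>k. k \<in> arr p \<and> src p k = src p z \<and> tgt p k = src p x \<and>
        over_arr p k = w \<and> x \<odot>[p] k = z"
    using z w c assms(1) by (intro ex) (auto simp: hom_def)
  then show "\<exists>!k. k \<in> hom (Tot p) (src p z) (src p x) \<and> over_arr p k = w \<and>
    x \<odot>[p] k = z"
    using eq by (auto simp: hom_def)
qed (fact assms(1))

text \<open>Each of the two arrows factors through the other over an identity; the round trips are
  absorbed by a cartesian arrow and are therefore identities.\<close>

lemma cartesian_over_iso:
  assumes "cartesian B p x" "cartesian B p y" "tgt p x = tgt p y" "over_arr p x = over_arr p y"
    "A = Dom B (over_arr p y)"
  shows "over_iso B p (src p y) (src p x) (cfactor p x y (Ident B A)) (cfactor p y x (Ident B A))"
proof -
  note [simp] = cartesian_Arr[OF assms(1)] cartesian_Arr[OF assms(2)] assms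
  show ?thesis
    unfolding over_iso_def
    by (auto simp: hom_def intro: cartesian_eqI[OF assms(1)] cartesian_eqI[OF assms(2)])
qed

end

sublocale cloven_fibration \<subseteq> category_over
  by unfold_locales (rule proj_functor)

context cloven_fibration
begin

lemma lift_simps [simp]:
  assumes "u \<in> Arr B" "X \<in> ob p" "over_obj p X = Cod B u"
  shows "lift p u X \<in> arr p" "tgt p (lift p u X) = X" "over_arr p (lift p u X) = u"
    "cartesian B p (lift p u X)"
  using lift_arr[OF assms] lift_cartesian[OF assms] by auto

lemma vfactor_simps [simp]:
  assumes "cartesian B p y" "x \<in> arr p" "tgt p x = tgt p y" 
    "over_arr p x = over_arr p y"
  shows "vfactor B p x y \<in> arr p" "src p (vfactor B p x y) = src p x"
    "tgt p (vfactor B p x y) = src p y"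
    "over_arr p (vfactor B p x y) = Ident B (Dom B (over_arr p y))"
    "y \<odot>[p] vfactor B p x y = x"
  using assms cartesian_Arr[OF assms(1)] by (auto simp: vfactor_cfactor)

end

section \<open>Fibrewise equivalences\<close>

text \<open>The inverse of a vertical isomorphism is automatically vertical, since its base arrow is
  inverse to an identity.\<close>

lemma (in category_over) over_iso_if_iso:
  assumes "iso (Tot p) x" and x [simp]: "over_arr p x = Ident B A" "A \<in> Obj B"
  shows "\<exists>y. over_iso B p (src p x) (tgt p x) x y"
proof -
  obtain y where y: "x \<in> arr p" "y \<in> arr p" "src p y = tgt p x"
    "tgt p y = src p x"
    "y \<odot>[p] x = Ident (Tot p) (src p x)" "x \<odot>[p] y = Ident (Tot p) (tgt p x)"
    using assms(1) by (rule total.isoE)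
  have b: "Dom B (over_arr p y) = A" "Cod B (over_arr p y) = A"
    using y base_composable[of x y] base_composable[of y x] by simp_all
  then have "over_arr p y = over_arr p (x \<odot>[p] y)"
    using y(1-4) by simp
  also have "\<dots> = Ident B A" unfolding y(6) using y(1) by simp
  finally show ?thesis using y by (intro exI[of _ y]) (simp add: over_iso_def hom_def)
qed

lemma (in category_over) iso_if_over_iso:
  assumes "over_iso B p X Y i j"
  shows "iso (Tot p) i"
  by (rule total.isoI[of i j]) (simp_all add: over_isoD(1-10)[OF assms])

lemma (in category_over) over_iso_Ident:
  "X \<in> ob p \<Longrightarrow> over_iso B p X X (Ident (Tot p) X) (Ident (Tot p) X)"
  by (auto simp: over_iso_def hom_def)

text \<open>Fullness and faithfulness concern all arrows, not only vertical ones; this makes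
  preservation of cartesian arrows a consequence instead of an axiom. Both sides are mere categories
  over the base, since the product completion enters as nothing more.\<close>

locale fibrewise_equivalence = p: category_over B p + q: category_over B q
  for B :: "('ob, 'ab) cat" and p :: "('oe, 'ae, 'ob, 'ab) fib" and q :: "('od, 'ad, 'ob, 'ab) fib" +
  fixes G :: "('oe, 'ae, 'od, 'ad) ftr"
  assumes G_functor: "is_functor (Tot p) (Tot q) G"
    and G_over_obj [simp]: "X \<in> ob p \<Longrightarrow> over_obj q (fobj G X) = over_obj p X"
    and G_over_arr [simp]: "x \<in> arr p \<Longrightarrow> over_arr q (farr G x) = over_arr p x"
    and full: "X \<in> ob p \<Longrightarrow> Y \<in> ob p \<Longrightarrow> z \<in> arr q \<Longrightarrow>
      src q z = fobj G X \<Longrightarrow> tgt q z = fobj G Y \<Longrightarrow>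
      \<exists>x \<in> arr p. src p x = X \<and> tgt p x = Y \<and> farr G x = z"
    and faithful: "x \<in> arr p \<Longrightarrow> y \<in> arr p \<Longrightarrow> src p x =
      src p y \<Longrightarrow>
      tgt p x = tgt p y \<Longrightarrow> farr G x = farr G y \<Longrightarrow> x = y"
    and eso: "Z \<in> ob q \<Longrightarrow> \<exists>X \<in> ob p. \<exists>i j. over_iso B q (fobj G X) Z i j"
begin

lemma G_simps [simp]:
  shows "X \<in> ob p \<Longrightarrow> fobj G X \<in> ob q"
    and "X \<in> ob p \<Longrightarrow> farr G (Ident (Tot p) X) = Ident (Tot q) (fobj G X)"
    and "x \<in> arr p \<Longrightarrow> farr G x \<in> arr q"
    and "x \<in> arr p \<Longrightarrow> src q (farr G x) = fobj G (src p x)"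
    and "x \<in> arr p \<Longrightarrow> tgt q (farr G x) = fobj G (tgt p x)"
    and "x \<in> arr p \<Longrightarrow> y \<in> arr p \<Longrightarrow> src p y = tgt p x \<Longrightarrow>
      farr G (y \<odot>[p] x) = farr G y \<odot>[q] farr G x"
  using G_functor by (auto simp: is_functor_def hom_def)

text \<open>A test arrow is first precomposed with a vertical isomorphism from an object in the
  image of \<open>G\<close>. Then fullness moves the factorization problem to \<open>p\<close>, and
  faithfulness settles uniqueness.\<close>

lemma preserves_cartesian:
  assumes x: "cartesian B p x"
  shows "cartesian B q (farr G x)"
proof (rule q.cartesianI)
  note [simp] = p.cartesian_Arr[OF x]
  show "farr G x \<in> arr q" by simp
  { fix z w
    assume z [simp]: "z \<in> arr q" "tgt q z = tgt q (farr G x)" and w [simp]: "w \<in> Arr B"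
      "Dom B w = Dom B (over_arr q z)" "Cod B w = Dom B (over_arr q (farr G x))"
      "over_arr q (farr G x) \<cdot>[B] w = over_arr q z"
    obtain X i j where X [simp]: "X \<in> ob p" and ij: "over_iso B q (fobj G X) (src q z) i j"
      using eso[of "src q z"] by auto
    have oX [simp]: "over_obj p X = Dom B (over_arr q z)"
      using q.over_isoD(13)[OF ij] by simp
    note [simp] = q.over_isoD(1-10)[OF ij] q.over_iso_cancel[OF ij]
    obtain z' where z' [simp]: "z' \<in> arr p" "src p z' = X" "tgt p z' = tgt p x"
      "farr G z' = z \<odot>[q] i"
      using full[of X "tgt p x" "z \<odot>[q] i"] by auto
    have oz': "over_arr p z' = over_arr q z"
      by (subst G_over_arr[symmetric]) (simp_all del: G_over_arr)
    let ?k = "cfactor p x z' w"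
    have k [simp]: "?k \<in> arr p" "src p ?k = X" "tgt p ?k = src p x"
      "over_arr p ?k = w" "x \<odot>[p] ?k = z'"
      using w x oz' by simp_all
    have "farr G x \<odot>[q] farr G ?k = farr G (x \<odot>[p] ?k)"
      using w by (subst G_simps) (simp_all del: k(5))
    then have "farr G x \<odot>[q] (farr G ?k \<odot>[q] j) = z"
      by (subst q.total.Comp_assoc[symmetric]) simp_all
    then show "\<exists>k. k \<in> arr q \<and> src q k = src q z \<and> tgt q k = src q (farr G x) \<and>
        over_arr q k = w \<and> farr G x \<odot>[q] k = z"
      by (intro exI[of _ "farr G ?k \<odot>[q] j"]) simp }
  fix k l
  assume k [simp]: "k \<in> arr q" "l \<in> arr q" "src q k = src q l"
      "tgt q k = src q (farr G x)" "tgt q l = src q (farr G x)"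
    and eq: "over_arr q k = over_arr q l" "farr G x \<odot>[q] k = farr G x \<odot>[q] l"
  obtain X i j where X [simp]: "X \<in> ob p" and ij: "over_iso B q (fobj G X) (src q l) i j"
    using eso[of "src q l"] by auto
  note [simp] = q.over_isoD[OF ij]
  obtain k' where k' [simp]: "k' \<in> arr p" "src p k' = X" "tgt p k' = src p x"
    "farr G k' = k \<odot>[q] i"
    using full[of X "src p x" "k \<odot>[q] i"] by auto
  obtain l' where l' [simp]: "l' \<in> arr p" "src p l' = X" "tgt p l' = src p x"
    "farr G l' = l \<odot>[q] i"
    using full[of X "src p x" "l \<odot>[q] i"] by auto
  have "over_arr p k' = over_arr q (k \<odot>[q] i)" "over_arr p l' = over_arr q (l \<odot>[q] i)"
    by (metis k' l' G_over_arr)+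
  then have o: "over_arr p k' = over_arr p l'" using eq(1) by simp
  have "farr G (x \<odot>[p] k') = (farr G x \<odot>[q] k) \<odot>[q] i"
    "farr G (x \<odot>[p] l') = (farr G x \<odot>[q] l) \<odot>[q] i"
    by simp_all
  then have "farr G (x \<odot>[p] k') = farr G (x \<odot>[p] l')"
    unfolding eq(2) by simp
  then have "x \<odot>[p] k' = x \<odot>[p] l'"
    by (rule faithful[rotated -1]) simp_all
  then have "k' = l'" by (rule p.cartesian_eqI[OF x, rotated -1]) (simp_all add: o)
  then have "k \<odot>[q] i = l \<odot>[q] i" using k'(4) l'(4) by simp
  then have "(k \<odot>[q] i) \<odot>[q] j = (l \<odot>[q] i) \<odot>[q] j" by simp
  then show "k = l" by simp
qed

lemma over_iso_image:
  assumes "over_iso B p X Y i j"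
  shows "over_iso B q (fobj G X) (fobj G Y) (farr G i) (farr G j)"
proof -
  note [simp] = p.over_isoD[OF assms]
  have "farr G j \<odot>[q] farr G i = Ident (Tot q) (fobj G X)" "farr G i \<odot>[q] farr G j =
    Ident (Tot q) (fobj G Y)"
    using G_simps(6)[of i j] G_simps(6)[of j i] by simp_all
  then show ?thesis by (simp add: over_iso_def hom_def)
qed

text \<open>Preimages of \<open>i\<close> and \<open>j\<close> exist by fullness and are mutually
  inverse by faithfulness; they are vertical because \<open>G\<close> does not change base
  arrows.\<close>

lemma over_iso_reflect:
  assumes ij: "over_iso B q (fobj G X) (fobj G Y) i j" and [simp]: "X \<in> ob p" "Y \<in> ob p"
  shows "\<exists>k l. over_iso B p X Y k l \<and> farr G k = i \<and> farr G l = j"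
proof -
  note [simp] = q.over_isoD[OF ij]
  obtain k where k [simp]: "k \<in> arr p" "src p k = X" "tgt p k = Y" "farr G k = i"
    using full[of X Y i] by auto
  obtain l where l [simp]: "l \<in> arr p" "src p l = Y" "tgt p l = X" "farr G l = j"
    using full[of Y X j] by auto
  have "over_arr p k = over_arr q i" "over_arr p l = over_arr q j"
    by (metis k l G_over_arr)+
  moreover have "l \<odot>[p] k = Ident (Tot p) X" "k \<odot>[p] l = Ident (Tot p) Y"
    by (rule faithful; simp)+
  ultimately have "over_iso B p X Y k l" by (simp add: over_iso_def hom_def)
  then show ?thesis using k(4) l(4) by blast
qed

text \<open>Once a vertical isomorphism to each \<open>Z\<close> from an object in the image of
  \<open>G\<close> is chosen, \<open>K z\<close> has to be the arrow whose image is \<open>z\<close>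
  conjugated by these isomorphisms. The conjugation equation is exported along with \<open>K\<close>
  because it says that the isomorphisms are natural.\<close>

lemma inverse:
  obtains K i j where "fibrewise_equivalence B q p K"
    "\<And>Z. Z \<in> ob q \<Longrightarrow> over_iso B q (fobj G (fobj K Z)) Z (i Z) (j Z)"
    "\<And>z. z \<in> arr q \<Longrightarrow>
      farr G (farr K z) = j (tgt q z) \<odot>[q] (z \<odot>[q] i (src q z))"
proof -
  have "\<forall>Z. \<exists>X i j. Z \<in> ob q \<longrightarrow> X \<in> ob p \<and>
    over_iso B q (fobj G X) Z i j"
    using eso by meson
  then obtain S i j where S: "\<And>Z. Z \<in> ob q \<Longrightarrow> S Z \<in> ob p"
    and ij: "\<And>Z. Z \<in> ob q \<Longrightarrow> over_iso B q (fobj G (S Z)) Z (i Z) (j Z)"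
    by metis
  have oS [simp]: "over_obj p (S Z) = over_obj q Z" if "Z \<in> ob q" for Z
    using q.over_isoD(13)[OF ij[OF that]] S[OF that] by simp
  note [simp] = S q.over_isoD(1-10)[OF ij] q.over_iso_cancel[OF ij]
  have "\<forall>z. \<exists>x. z \<in> arr q \<longrightarrow> x \<in> arr p \<and> src p x =
    S (src q z) \<and>
     tgt p x = S (tgt q z) \<and>
     farr G x = j (tgt q z) \<odot>[q] (z \<odot>[q] i (src q z))"
  proof
    fix z
    show "\<exists>x. z \<in> arr q \<longrightarrow> x \<in> arr p \<and> src p x = S (src q z) \<and>
     tgt p x = S (tgt q z) \<and>
     farr G x = j (tgt q z) \<odot>[q] (z \<odot>[q] i (src q z))"
    proof (cases "z \<in> arr q")
      case True
      then show ?thesis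
        using full[of "S (src q z)" "S (tgt q z)" "j (tgt q z) \<odot>[q] (z \<odot>[q] i (src q z))"]
        by auto
    qed simp
  qed
  then obtain L where L [simp]: "\<And>z. z \<in> arr q \<Longrightarrow> L z \<in> arr p"
    "\<And>z. z \<in> arr q \<Longrightarrow> src p (L z) = S (src q z)"
    "\<And>z. z \<in> arr q \<Longrightarrow> tgt p (L z) = S (tgt q z)"
    "\<And>z. z \<in> arr q \<Longrightarrow> farr G (L z) = j (tgt q z) \<odot>[q] (z \<odot>[q] i (src q z))"
    by metis
  define K where "K = \<lparr>fobj = S, farr = L\<rparr>"
  have [simp]: "fobj K = S" "farr K = L" by (simp_all add: K_def)
  have "fibrewise_equivalence B q p K"
  proof
    show "is_functor (Tot q) (Tot p) K"
      unfolding is_functor_def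
    proof (intro conjI ballI impI)
      fix Z assume [simp]: "Z \<in> ob q"
      show "farr K (Ident (Tot q) Z) = Ident (Tot p) (fobj K Z)"
        by (rule faithful) simp_all
    next
      fix f g assume [simp]: "f \<in> arr q" "g \<in> arr q" "src q g = tgt q f"
      show "farr K (g \<odot>[q] f) = farr K g \<odot>[p] farr K f"
        by (rule faithful) simp_all
    qed (auto simp: hom_def)
    show "over_obj p (fobj K Z) = over_obj q Z" if "Z \<in> ob q" for Z
      using that by simp
    show "over_arr p (farr K z) = over_arr q z" if "z \<in> arr q" for z
    proof -
      have "over_arr p (L z) = over_arr q (farr G (L z))"
        using that by (intro G_over_arr[symmetric]) simp
      also have "\<dots> = over_arr q z" using that by (simp del: G_over_arr)
      finally show ?thesis by simp
    qed
  next
    fix X Y x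
    assume [simp]: "X \<in> ob q" "Y \<in> ob q" and x [simp]: "x \<in> arr p"
      and "src p x = fobj K X" "tgt p x = fobj K Y"
    then have [simp]: "src p x = S X" "tgt p x = S Y" by simp_all
    let ?z = "i Y \<odot>[q] (farr G x \<odot>[q] j X)"
    have "farr K ?z = x" by (rule faithful) simp_all
    then show "\<exists>z\<in>arr q. src q z = X \<and> tgt q z = Y \<and> farr K z = x"
      by (intro bexI[of _ ?z]) simp_all
  next
    fix x y
    assume [simp]: "x \<in> arr q" "y \<in> arr q" "src q x = src q y" "tgt q x = tgt q y"
      and "farr K x = farr K y"
    then have "farr G (L x) = farr G (L y)" by simp
    then have "i (tgt q y) \<odot>[q] ((j (tgt q y) \<odot>[q] (x \<odot>[q] i (src q y))) \<odot>[q] j (src q y)) =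
      i (tgt q y) \<odot>[q] ((j (tgt q y) \<odot>[q] (y \<odot>[q] i (src q y))) \<odot>[q] j (src q y))"
      by simp
    then show "x = y" by simp
  next
    fix X assume [simp]: "X \<in> ob p"
    show "\<exists>Z\<in>ob q. \<exists>k l. over_iso B p (fobj K Z) X k l"
      using over_iso_reflect[OF ij[of "fobj G X"]] by (intro bexI[of _ "fobj G X"]) auto
  qed
  then show thesis using ij by (intro that[of K i j]) auto
qed

lemma fibred_functor: "fibred_functor B p q G"
  unfolding fibred_functor_def using G_functor preserves_cartesian by auto

lemma fibred_equivalent: "fibred_equivalent B p q"
proof -
  obtain K i j where "fibrewise_equivalence B q p K"
    and ij: "\<And>Z. Z \<in> ob q \<Longrightarrow> over_iso B q (fobj G (fobj K Z)) Z (i Z) (j Z)"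
    and GK: "\<And>z. z \<in> arr q \<Longrightarrow>
      farr G (farr K z) = j (tgt q z) \<odot>[q] (z \<odot>[q] i (src q z))"
    by (rule inverse) metis
  then interpret K: fibrewise_equivalence B q p K by simp
  \<comment> \<open>The isomorphism from \<open>K G\<close> to the identity is obtained by
    reflecting the one from \<open>G K\<close> along \<open>G\<close>, at the objects
    \<open>G X\<close>. Its naturality then follows from faithfulness of \<open>G\<close>.\<close>
  have "\<forall>X. \<exists>k l. X \<in> ob p \<longrightarrow> over_iso B p (fobj K (fobj G X)) X k l \<and>
    farr G k = i (fobj G X)"
    using over_iso_reflect[OF ij] by (metis G_simps(1) K.G_simps(1))
  then obtain k l where kl: "\<And>X. X \<in> ob p \<Longrightarrow>
    over_iso B p (fobj K (fobj G X)) X (k X) (l X)"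
    and Gk [simp]: "\<And>X. X \<in> ob p \<Longrightarrow> farr G (k X) = i (fobj G X)"
    by metis
  note [simp] = GK q.over_isoD(1-10)[OF ij] q.over_iso_cancel[OF ij] p.over_isoD(1-10)[OF kl]
  have "vertical_nat_iso B p p (comp_ftr K G) id_ftr k"
    unfolding vertical_nat_iso_def nat_iso_def nat_trans_def
    by (auto simp: comp_ftr_def id_ftr_def hom_def intro: p.iso_if_over_iso[OF kl] faithful)
  moreover have "vertical_nat_iso B q q (comp_ftr G K) id_ftr i"
    unfolding vertical_nat_iso_def nat_iso_def nat_trans_def
    by (auto simp: comp_ftr_def id_ftr_def hom_def intro: q.iso_if_over_iso[OF ij])
  ultimately show ?thesis
    using fibred_functor K.fibred_functor unfolding fibred_equivalent_def by metis
qed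

end

section \<open>Recovering a full, faithful and essentially surjective functor from a fibred
  equivalence\<close>

lemma fibred_equivalent_sym: "fibred_equivalent B p q \<Longrightarrow> fibred_equivalent B q p"
  unfolding fibred_equivalent_def by blast

context category_over
begin

lemma vertical_nat_isoE:
  assumes "vertical_nat_iso B p p (comp_ftr K H) id_ftr s"
    and "\<And>X. X \<in> ob p \<Longrightarrow> over_obj p (fobj K (fobj H X)) = over_obj p X"
  obtains s' where "\<And>X. X \<in> ob p \<Longrightarrow> over_iso B p (fobj K (fobj H X)) X (s X) (s' X)"
    "\<And>x. x \<in> arr p \<Longrightarrow> s (tgt p x) \<odot>[p] farr K (farr H x) =
      x \<odot>[p] s (src p x)"
proof -
  have s: "s X \<in> hom (Tot p) (fobj K (fobj H X)) X" "over_arr p (s X) = Ident B (over_obj p X)"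
    "iso (Tot p) (s X)"
    if "X \<in> ob p" for X
    using assms(1) that unfolding vertical_nat_iso_def nat_iso_def nat_trans_def
    by (auto simp: comp_ftr_def id_ftr_def)
  have "\<exists>y. over_iso B p (fobj K (fobj H X)) X (s X) y" if "X \<in> ob p" for X
    using over_iso_if_iso[of "s X" "over_obj p X"] s[OF that] that by (auto simp: hom_def)
  then obtain s' where "\<And>X. X \<in> ob p \<Longrightarrow> over_iso B p (fobj K (fobj H X)) X (s X) (s' X)"
    by metis
  moreover have "\<And>x. x \<in> arr p \<Longrightarrow> s (tgt p x) \<odot>[p] farr K (farr H x) =
    x \<odot>[p] s (src p x)"
    using assms(1) unfolding vertical_nat_iso_def nat_iso_def nat_trans_def
    by (auto simp: comp_ftr_def id_ftr_def)
  ultimately show thesis using that by blast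
qed

text \<open>Conjugating \<open>K (H x)\<close> with the natural isomorphism recovers
  \<open>x\<close>, so one of the two isomorphisms of an equivalence already forces
  faithfulness.\<close>

lemma faithful_if_retract:
  assumes iso: "\<And>X. X \<in> ob p \<Longrightarrow> over_iso B p (fobj K (fobj H X)) X (s X) (s' X)"
    and nat: "\<And>x. x \<in> arr p \<Longrightarrow> s (tgt p x) \<odot>[p] farr K (farr H x) =
      x \<odot>[p] s (src p x)"
    and [simp]: "x \<in> arr p" "y \<in> arr p" "src p x = src p y" "tgt p x = tgt p y"
    and H: "farr H x = farr H y"
  shows "x = y"
proof -
  note [simp] = over_isoD(1-10)[OF iso]
  have "x \<odot>[p] s (src p y) = y \<odot>[p] s (src p y)"
    using nat[of x] nat[of y] H by simp
  then have "(x \<odot>[p] s (src p y)) \<odot>[p] s' (src p y) =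
    (y \<odot>[p] s (src p y)) \<odot>[p] s' (src p y)"
    by simp
  then show ?thesis by simp
qed

end

lemma fibred_equivalentE:
  assumes "category_over B p" "category_over B q" "fibred_equivalent B p q"
  obtains G where "fibrewise_equivalence B p q G"
proof -
  interpret p: category_over B p by fact
  interpret q: category_over B q by fact
  obtain H K s t where H: "fibred_functor B p q H" and K: "fibred_functor B q p K"
    and s: "vertical_nat_iso B p p (comp_ftr K H) id_ftr s"
    and t: "vertical_nat_iso B q q (comp_ftr H K) id_ftr t"
    using assms(3) unfolding fibred_equivalent_def by blast
  have [simp]:
    "X \<in> ob p \<Longrightarrow> fobj H X \<in> ob q"
    "x \<in> arr p \<Longrightarrow> farr H x \<in> arr q"
    "x \<in> arr p \<Longrightarrow> src q (farr H x) = fobj H (src p x)"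
    "x \<in> arr p \<Longrightarrow> tgt q (farr H x) = fobj H (tgt p x)"
    "X \<in> ob p \<Longrightarrow> over_obj q (fobj H X) = over_obj p X"
    "x \<in> arr p \<Longrightarrow> over_arr q (farr H x) = over_arr p x" for X x
    using H by (auto simp: fibred_functor_def is_functor_def hom_def)
  have [simp]:
    "X \<in> ob q \<Longrightarrow> fobj K X \<in> ob p"
    "x \<in> arr q \<Longrightarrow> farr K x \<in> arr p"
    "x \<in> arr q \<Longrightarrow> src p (farr K x) = fobj K (src q x)"
    "x \<in> arr q \<Longrightarrow> tgt p (farr K x) = fobj K (tgt q x)"
    "X \<in> ob q \<Longrightarrow> over_obj p (fobj K X) = over_obj q X"
    "x \<in> arr q \<Longrightarrow> over_arr p (farr K x) = over_arr q x" for X x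
    using K by (auto simp: fibred_functor_def is_functor_def hom_def)
  obtain s' where s': "\<And>X. X \<in> ob p \<Longrightarrow> over_iso B p (fobj K (fobj H X)) X (s X) (s' X)"
    and s_nat: "\<And>x. x \<in> arr p \<Longrightarrow> s (tgt p x) \<odot>[p] farr K (farr H x) =
      x \<odot>[p] s (src p x)"
    using p.vertical_nat_isoE[OF s] by auto
  obtain t' where t': "\<And>X. X \<in> ob q \<Longrightarrow> over_iso B q (fobj H (fobj K X)) X (t X) (t' X)"
    and t_nat: "\<And>x. x \<in> arr q \<Longrightarrow> t (tgt q x) \<odot>[q] farr H (farr K x) =
      x \<odot>[q] t (src q x)"
    using q.vertical_nat_isoE[OF t] by auto
  note [simp] = p.over_isoD(1-10)[OF s'] p.over_iso_cancel[OF s']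
  have "fibrewise_equivalence B p q H"
  proof
    show "is_functor (Tot p) (Tot q) H" using H by (simp add: fibred_functor_def)
    fix X Y z
    assume [simp]: "X \<in> ob p" "Y \<in> ob p" and z [simp]: "z \<in> arr q"
      "src q z = fobj H X" "tgt q z = fobj H Y"
    \<comment> \<open>Naturality of \<open>s\<close> leaves no other candidate for the preimage of
      \<open>z\<close>. It yields \<open>K (H ?x) = K z\<close>, and \<open>K\<close> is faithful by
      the other natural isomorphism \<open>t\<close>.\<close>
    let ?x = "s Y \<odot>[p] (farr K z \<odot>[p] s' X)"
    have x [simp]: "?x \<in> arr p" "src p ?x = X" "tgt p ?x = Y" by simp_all
    have "s Y \<odot>[p] farr K (farr H ?x) = s Y \<odot>[p] farr K z"
      using s_nat[of ?x] by simp
    then have "s' Y \<odot>[p] (s Y \<odot>[p] farr K (farr H ?x)) = s' Y \<odot>[p] (s Y \<odot>[p] farr K z)"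
      by (rule arg_cong)
    moreover have "s' Y \<odot>[p] (s Y \<odot>[p] farr K (farr H ?x)) = farr K (farr H ?x)"
      by (rule p.over_iso_cancel[OF s']) (simp_all del: p.total.Comp_simps add: x)
    ultimately have "farr K (farr H ?x) = farr K z" by simp
    then have "farr H ?x = z"
      by (intro q.faithful_if_retract[OF t' t_nat, of "farr H ?x" z]) (simp_all del: p.total.Comp_simps add: x)
    then show "\<exists>x\<in>arr p. src p x = X \<and> tgt p x = Y \<and> farr H x = z"
      using x by blast
  next
    fix x y
    assume "x \<in> arr p" "y \<in> arr p" "src p x = src p y"
      "tgt p x = tgt p y" "farr H x = farr H y"
    then show "x = y" by (intro p.faithful_if_retract[OF s' s_nat, of x y])
  next
    fix Z assume "Z \<in> ob q"
    then show "\<exists>X\<in>ob p. \<exists>i j. over_iso B q (fobj H X) Z i j" using t'[of Z]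
      by (intro bexI[of _ "fobj K Z"]) auto
  qed auto
  then show thesis by (rule that)
qed

lemma fibrewise_equivalence_comp:
  assumes "fibrewise_equivalence B p q G" "fibrewise_equivalence B q r H"
  shows "fibrewise_equivalence B p r (comp_ftr H G)"
proof -
  interpret G: fibrewise_equivalence B p q G by fact
  interpret H: fibrewise_equivalence B q r H by fact
  have [simp]: "fobj (comp_ftr H G) X = fobj H (fobj G X)" "farr (comp_ftr H G) x = farr H (farr G x)" for X x
    by (simp_all add: comp_ftr_def)
  show ?thesis
  proof
    show "is_functor (Tot p) (Tot r) (comp_ftr H G)"
      unfolding is_functor_def by (auto simp: hom_def)
    fix X Y z
    assume *: "X \<in> ob p" "Y \<in> ob p" "z \<in> arr r"
      "src r z = fobj (comp_ftr H G) X" "tgt r z = fobj (comp_ftr H G) Y"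
    then obtain y where "y \<in> arr q" "src q y = fobj G X" "tgt q y = fobj G Y" "farr H y = z"
      using H.full[of "fobj G X" "fobj G Y" z] by auto
    then show "\<exists>x\<in>arr p. src p x = X \<and> tgt p x = Y \<and> farr (comp_ftr H G) x = z"
      using G.full[of X Y y] * by auto
  next
    fix x y
    assume *: "x \<in> arr p" "y \<in> arr p" "src p x = src p y"
      "tgt p x = tgt p y" "farr (comp_ftr H G) x = farr (comp_ftr H G) y"
    then have "farr G x = farr G y" by (intro H.faithful) simp_all
    with * show "x = y" by (intro G.faithful)
  next
    fix Z assume "Z \<in> ob r"
    then obtain Y i j where Y: "Y \<in> ob q" "over_iso B r (fobj H Y) Z i j" using H.eso by blast
    then obtain X k l where X: "X \<in> ob p" "over_iso B q (fobj G X) Y k l" using G.eso by blast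
    then show "\<exists>X\<in>ob p. \<exists>i j. over_iso B r (fobj (comp_ftr H G) X) Z i j"
      using H.q.over_iso_trans[OF H.over_iso_image[OF X(2)] Y(2)] by auto
  qed auto
qed

lemma fibred_equivalent_trans:
  assumes "category_over B p" "category_over B q" "category_over B r"
    and "fibred_equivalent B p q" "fibred_equivalent B q r"
  shows "fibred_equivalent B p r"
proof -
  obtain G where "fibrewise_equivalence B p q G" using fibred_equivalentE[OF assms(1,2,4)] .
  moreover obtain H where "fibrewise_equivalence B q r H" using fibred_equivalentE[OF assms(2,3,5)] .
  ultimately show ?thesis
    using fibrewise_equivalence_comp fibrewise_equivalence.fibred_equivalent by blast
qed

section \<open>The fibrewise opposite\<close>

text \<open>The vertical component is \<open>(v u)\<^sup>*Z \<cong> u\<^sup>*v\<^sup>*Z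
  \<rightarrow> u\<^sup>*X \<rightarrow> \<beta>\<close> with middle arrow
  \<open>u\<^sup>*d\<close>. The inner \<open>cfactor\<close> is the comparison
  \<open>(v u)\<^sup>*Z \<rightarrow> v\<^sup>*Z\<close> over \<open>u\<close>; the outer one
  delivers the canonical isomorphism and \<open>u\<^sup>*d\<close> as a single arrow, so that
  equations reduce to uniqueness of factorizations.\<close>

definition opp_comp ::
  "('ob, 'ab) cat \<Rightarrow> ('oe, 'ae, 'ob, 'ab) fib \<Rightarrow> 'ab \<times> 'oe \<times> 'ae \<Rightarrow> 'ab \<times> 'oe \<times> 'ae \<Rightarrow> 'ab \<times> 'oe \<times> 'ae" where
  "opp_comp B p = (\<lambda>(v, Z, d) (u, X, e).
     (v \<cdot>[B] u, Z, e \<odot>[p] cfactor p (lift p u X)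
        (d \<odot>[p] cfactor p (lift p v Z) (lift p (v \<cdot>[B] u) Z) u) (Ident B (Dom B u))))"

text \<open>The arrow \<open>(u, X, e)\<close> with \<open>e : u\<^sup>*X \<rightarrow> \<beta>\<close> vertical goes from \<open>\<beta>\<close> to \<open>X\<close>, over \<open>u\<close>.\<close>

definition opp ::
  "('ob, 'ab) cat \<Rightarrow> ('oe, 'ae, 'ob, 'ab) fib \<Rightarrow> ('oe, 'ab \<times> 'oe \<times> 'ae, 'ob, 'ab) fib" where
  "opp B p =
     \<lparr>Tot = \<lparr>Obj = ob p,
        Arr = {(u, X, e). u \<in> Arr B \<and> X \<in> ob p \<and> over_obj p X = Cod B u \<and>
          e \<in> arr p \<and>
                 src p e = src p (lift p u X) \<and> over_arr p e = Ident B (Dom B u)},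
        Dom = (\<lambda>(u, X, e). tgt p e), Cod = (\<lambda>(u, X, e). X),
        Ident = (\<lambda>X. (Ident B (over_obj p X), X, lift p (Ident B (over_obj p X)) X)),
        Comp = opp_comp B p\<rparr>,
      proj = \<lparr>fobj = fobj (proj p), farr = fst\<rparr>,
      lift = (\<lambda>u X. (u, X, Ident (Tot p) (src p (lift p u X))))\<rparr>"

lemma opp_simps:
  "ob (opp B p) = ob p"
  "(u, X, e) \<in> arr (opp B p) \<longleftrightarrow> u \<in> Arr B \<and> X \<in> ob p \<and> over_obj p X =
    Cod B u \<and>
     e \<in> arr p \<and> src p e = src p (lift p u X) \<and> over_arr p e = Ident B (Dom B u)"
  "src (opp B p) (u, X, e) = tgt p e"
  "tgt (opp B p) (u, X, e) = X"
  "Ident (Tot (opp B p)) X = (Ident B (over_obj p X), X, lift p (Ident B (over_obj p X)) X)"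
  "(v, Z, d) \<odot>[opp B p] (u, X, e) = (v \<cdot>[B] u, Z, e \<odot>[p] cfactor p (lift p u X)
        (d \<odot>[p] cfactor p (lift p v Z) (lift p (v \<cdot>[B] u) Z) u) (Ident B (Dom B u)))"
  "over_obj (opp B p) X = over_obj p X"
  "over_arr (opp B p) (u, X, e) = u"
  "lift (opp B p) u X = (u, X, Ident (Tot p) (src p (lift p u X)))"
  by (simp_all add: opp_def opp_comp_def)

text \<open>A vertical \<open>k : X \<rightarrow> Y\<close> reversed to an arrow
  \<open>Y \<rightarrow> X\<close> of the opposite. The chosen lift of an identity need not be an
  identity, so \<open>k\<close> has to be precomposed with it.\<close>

definition opp_vertical :: "('ob, 'ab) cat \<Rightarrow> ('oe, 'ae, 'ob, 'ab) fib \<Rightarrow> 'ae \<Rightarrow> 'ab \<times> 'oe \<times> 'ae" where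
  "opp_vertical B p k = (let X = src p k; i = Ident B (over_obj p X) in (i, X, k \<odot>[p] lift p i X))"

context cloven_fibration
begin

lemma opp_category: "category (Tot (opp B p))"
proof
  fix f assume f: "f \<in> arr (opp B p)"
  then obtain u X e where "f = (u, X, e)" by (cases f) auto
  then show "src (opp B p) f \<in> ob (opp B p)"
    "tgt (opp B p) f \<in> ob (opp B p)"
    using f by (auto simp: opp_simps)
next
  fix a assume "a \<in> ob (opp B p)"
  then show "Ident (Tot (opp B p)) a \<in> hom (Tot (opp B p)) a a"
    by (auto simp: opp_simps hom_def)
next
  fix f a b g c assume f: "f \<in> hom (Tot (opp B p)) a b" and g: "g \<in> hom (Tot (opp B p)) b c"
  obtain u X e v Z d where fg: "f = (u, X, e)" "g = (v, Z, d)" by (cases f, cases g) auto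
  have [simp]: "over_obj p (tgt p d) = Dom B v" using g by (auto simp: fg opp_simps hom_def)
  show "g \<odot>[opp B p] f \<in> hom (Tot (opp B p)) a c"
    using f g by (auto simp: fg opp_simps hom_def)
next
  fix f a b assume f: "f \<in> hom (Tot (opp B p)) a b"
  obtain u X e where fu: "f = (u, X, e)" by (cases f) auto
  have [simp]: "u \<in> Arr B" "X \<in> ob p" "over_obj p X = Cod B u" "e \<in> arr p"
    "src p e = src p (lift p u X)" "over_arr p e = Ident B (Dom B u)"
    and [simp]: "a = tgt p e" "b = X"
    using f by (auto simp: fu opp_simps hom_def)
  let ?k = "cfactor p (lift p (Ident B (Cod B u)) X) (lift p u X) u"
  have "cfactor p (lift p u X) (lift p (Ident B (Cod B u)) X \<odot>[p] ?k) (Ident B (Dom B u)) =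
    Ident (Tot p) (src p (lift p u X))"
    by (rule cfactor_eqI) simp_all
  then show "Ident (Tot (opp B p)) b \<odot>[opp B p] f = f"
    by (simp add: fu opp_simps)
  let ?l = "cfactor p (lift p u X) (lift p u X) (Ident B (Dom B u))"
  have *: "?l = Ident (Tot p) (src p (lift p u X))"
    by (rule cfactor_eqI) simp_all
  have "cfactor p (lift p (Ident B (Dom B u)) (tgt p e)) (e \<odot>[p] ?l) (Ident B (Dom B u)) = 
      cfactor p (lift p (Ident B (Dom B u)) (tgt p e)) e (Ident B (Dom B u))"
    unfolding * by simp
  then show "f \<odot>[opp B p] Ident (Tot (opp B p)) a = f"
    by (simp add: fu opp_simps)
next
  fix f a b g c h d'
  assume f: "f \<in> hom (Tot (opp B p)) a b" and g: "g \<in> hom (Tot (opp B p)) b c"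
    and h: "h \<in> hom (Tot (opp B p)) c d'"
  obtain u X e v Z d w V s where eqs: "f = (u, X, e)" "g = (v, Z, d)" "h = (w, V, s)"
    by (cases f, cases g, cases h) auto
  have [simp]: "u \<in> Arr B" "v \<in> Arr B" "w \<in> Arr B" "tgt p d = X" "tgt p s = Z"
    "X \<in> ob p" "Z \<in> ob p" "V \<in> ob p"
    "over_obj p X = Cod B u" "over_obj p Z = Cod B v" "over_obj p V = Cod B w"
    "e \<in> arr p" "d \<in> arr p" "s \<in> arr p"
    "src p e = src p (lift p u X)" "src p d = src p (lift p v Z)"
    "src p s = src p (lift p w V)"
    "over_arr p e = Ident B (Dom B u)" "over_arr p d = Ident B (Dom B v)" "over_arr p s = Ident B (Dom B w)"
    using f g h by (auto simp: eqs opp_simps hom_def simp del: over_Cod)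
  have [simp]: "Cod B u = Dom B v" "Cod B v = Dom B w"
    using over_Cod[of d] over_Cod[of s] by simp_all
  \<comment> \<open>The primed arrows compare chosen lifts and lie over \<open>u\<close>,
    \<open>v u\<close>, \<open>v\<close> and \<open>u\<close>; the unprimed ones are the vertical
    arrows that they induce. The two bracketings have vertical components \<open>e n\<close> and
    \<open>e k m\<close>, so associativity amounts to \<open>n = k m\<close>.\<close>
  define k' where "k' = cfactor p (lift p v Z) (lift p (v \<cdot>[B] u) Z) u"
  define k where "k = cfactor p (lift p u X) (d \<odot>[p] k') (Ident B (Dom B u))"
  define m' where "m' = cfactor p (lift p w V) (lift p (w \<cdot>[B] v \<cdot>[B] u) V) (v \<cdot>[B] u)"
  define m where "m = cfactor p (lift p (v \<cdot>[B] u) Z) (s \<odot>[p] m') (Ident B (Dom B u))"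
  define l' where "l' = cfactor p (lift p w V) (lift p (w \<cdot>[B] v) V) v"
  define l where "l = cfactor p (lift p v Z) (s \<odot>[p] l') (Ident B (Dom B v))"
  define n' where "n' = cfactor p (lift p (w \<cdot>[B] v) V) (lift p (w \<cdot>[B] v \<cdot>[B] u) V) u"
  define n where "n = cfactor p (lift p u X) (d \<odot>[p] (l \<odot>[p] n')) (Ident B (Dom B u))"
  note defs [symmetric, simp] = k'_def m'_def l'_def n'_def
  have 1 [simp]: "l' \<odot>[p] n' = m'"
    unfolding k'_def m'_def l'_def n'_def by (rule cartesian_eqI[of "lift p w V"]) (simp_all del: defs)
  have ks [simp]: "k' \<in> arr p" "src p k' = src p (lift p (v \<cdot>[B] u) Z)"
    "tgt p k' = src p (lift p v Z)" "over_arr p k' = u" "lift p v Z \<odot>[p] k' = lift p (v \<cdot>[B] u) Z"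
    unfolding k'_def by (simp_all del: defs)
  have ms [simp]: "m' \<in> arr p" "src p m' = src p (lift p (w \<cdot>[B] v \<cdot>[B] u) V)"
    "tgt p m' = src p (lift p w V)" "over_arr p m' = v \<cdot>[B] u"
    unfolding m'_def by (simp_all del: defs)
  have ls [simp]: "l' \<in> arr p" "src p l' = src p (lift p (w \<cdot>[B] v) V)"
    "tgt p l' = src p (lift p w V)" "over_arr p l' = v"
    unfolding l'_def by (simp_all del: defs)
  have ns [simp]: "n' \<in> arr p" "src p n' = src p (lift p (w \<cdot>[B] v \<cdot>[B] u) V)"
    "tgt p n' = src p (lift p (w \<cdot>[B] v) V)" "over_arr p n' = u"
    unfolding n'_def by (simp_all del: defs)
  have m_s [simp]: "m \<in> arr p" "src p m = src p (lift p (w \<cdot>[B] v \<cdot>[B] u) V)"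
    "tgt p m = src p (lift p (v \<cdot>[B] u) Z)" "over_arr p m = Ident B (Dom B u)"
    "lift p (v \<cdot>[B] u) Z \<odot>[p] m = s \<odot>[p] m'"
    unfolding m_def by simp_all
  have l_s [simp]: "l \<in> arr p" "src p l = src p (lift p (w \<cdot>[B] v) V)"
    "tgt p l = src p (lift p v Z)" "over_arr p l = Ident B (Dom B v)"
    "lift p v Z \<odot>[p] l = s \<odot>[p] l'"
    "lift p v Z \<odot>[p] (l \<odot>[p] n') = (s \<odot>[p] l') \<odot>[p] n'"
    unfolding l_def by simp_all
  have [simp]: "lift p v Z \<odot>[p] (k' \<odot>[p] m) = lift p (v \<cdot>[B] u) Z \<odot>[p] m"
    unfolding k'_def by (simp del: defs)
  \<comment> \<open>Both sides are arrows from \<open>(w v u)\<^sup>*V\<close> to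
    \<open>v\<^sup>*Z\<close> over \<open>u\<close>, and they have the same composite with the
    cartesian lift of \<open>v\<close>.\<close>
  have 2 [simp]: "l \<odot>[p] n' = k' \<odot>[p] m"
    by (rule cartesian_eqI[of "lift p v Z"]) simp_all
  have k_s [simp]: "k \<in> arr p" "src p k = src p (lift p (v \<cdot>[B] u) Z)"
    "tgt p k = src p (lift p u X)" "over_arr p k = Ident B (Dom B u)"
    "lift p u X \<odot>[p] (k \<odot>[p] m) = (d \<odot>[p] k') \<odot>[p] m"
    unfolding k_def by simp_all
  have 3: "n = k \<odot>[p] m"
    unfolding n_def by (rule cfactor_eqI) simp_all
  show "(h \<odot>[opp B p] g) \<odot>[opp B p] f = h \<odot>[opp B p] g \<odot>[opp B p] f"
    using 3 unfolding eqs opp_simps n_def k_def m_def l_def k'_def m'_def l'_def n'_def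
    by (simp del: defs 1 2)
qed

lemma opp_category_over: "category_over B (opp B p)"
proof -
  interpret o: category "Tot (opp B p)" by (rule opp_category)
  show ?thesis
    by unfold_locales (auto simp: is_functor_def opp_simps hom_def)
qed

text \<open>The canonical \<open>(u w)\<^sup>*X \<cong> w\<^sup>*u\<^sup>*X\<close> in both
  directions, spelt with the very \<open>cfactor\<close> terms that appear when a composition in the
  opposite is unfolded.\<close>

lemma lift_Comp_iso:
  assumes [simp]: "w \<in> Arr B" "u \<in> Arr B" "Dom B u = Cod B w" "X \<in> ob p" "over_obj p X = Cod B u"
  shows "over_iso B p (src p (lift p (u \<cdot>[B] w) X)) (src p (lift p w (src p (lift p u X))))
    (cfactor p (lift p w (src p (lift p u X)))
       (cfactor p (lift p u X) (lift p (u \<cdot>[B] w) X) w) (Ident B (Dom B w)))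
    (cfactor p (lift p (u \<cdot>[B] w) X)
       (lift p u X \<odot>[p] lift p w (src p (lift p u X))) (Ident B (Dom B w)))"
    (is "over_iso B p ?Y ?Z ?i ?j")
proof -
  have "?j \<odot>[p] ?i = Ident (Tot p) ?Y"
    by (rule cartesian_eqI[of "lift p (u \<cdot>[B] w) X"]) simp_all
  moreover have [simp]: "lift p w (src p (lift p u X)) \<odot>[p] ?i \<odot>[p] ?j =
    lift p w (src p (lift p u X))"
    by (rule cartesian_eqI[of "lift p u X"]) simp_all
  have "?i \<odot>[p] ?j = Ident (Tot p) ?Z"
    by (rule cartesian_eqI[of "lift p w (src p (lift p u X))"]) simp_all
  ultimately show ?thesis by (simp add: over_iso_def hom_def)
qed

text \<open>Composing the chosen lift with \<open>(w, u\<^sup>*X, a)\<close> gives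
  \<open>(u w, X, a i)\<close>, where \<open>i\<close> is the canonical isomorphism
  \<open>(u w)\<^sup>*X \<cong> w\<^sup>*u\<^sup>*X\<close>. Factoring through the lift is therefore
  the same as cancelling \<open>i\<close>.\<close>

lemma opp_lift_cartesian:
  assumes [simp]: "u \<in> Arr B" "X \<in> ob p" "over_obj p X = Cod B u"
  shows "cartesian B (opp B p) (lift (opp B p) u X)"
proof -
  interpret o: category_over B "opp B p" by (rule opp_category_over)
  let ?X = "src p (lift p u X)"
  show ?thesis
  proof (rule o.cartesianI)
    show "lift (opp B p) u X \<in> arr (opp B p)"
      by (simp add: opp_simps)
  next
    fix z w
    assume z: "z \<in> arr (opp B p)"
       "tgt (opp B p) z = tgt (opp B p) (lift (opp B p) u X)"
      and w: "w \<in> Arr B" "Dom B w = Dom B (over_arr (opp B p) z)"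
      "Cod B w = Dom B (over_arr (opp B p) (lift (opp B p) u X))"
      "over_arr (opp B p) (lift (opp B p) u X) \<cdot>[B] w = over_arr (opp B p) z"
    obtain e where ze: "z = (u \<cdot>[B] w, X, e)"
      using z w(4) by (cases z) (auto simp: opp_simps)
    have wu [simp]: "w \<in> Arr B" "Dom B u = Cod B w" using w by (simp_all add: opp_simps)
    have e [simp]: "e \<in> arr p" "src p e = src p (lift p (u \<cdot>[B] w) X)"
      "over_arr p e = Ident B (Dom B w)"
      using z by (simp_all add: ze opp_simps)
    note ij = lift_Comp_iso[of w u X, simplified]
    note [simp] = over_isoD(1-10)[OF ij]
    let ?j = "cfactor p (lift p (u \<cdot>[B] w) X) (lift p u X \<odot>[p] lift p w ?X) (Ident B (Dom B w))"
    show "\<exists>k. k \<in> arr (opp B p) \<and> src (opp B p) k = src (opp B p) z \<and>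
      tgt (opp B p) k = src (opp B p) (lift (opp B p) u X) \<and>
      over_arr (opp B p) k = w \<and> lift (opp B p) u X \<odot>[opp B p] k = z"
      by (rule exI[of _ "(w, ?X, e \<odot>[p] ?j)"]) (simp add: ze opp_simps)
  next
    fix k l
    assume k: "k \<in> arr (opp B p)" and l: "l \<in> arr (opp B p)"
      and kl: "src (opp B p) k = src (opp B p) l"
      "tgt (opp B p) k = src (opp B p) (lift (opp B p) u X)"
      "tgt (opp B p) l = src (opp B p) (lift (opp B p) u X)"
      "over_arr (opp B p) k = over_arr (opp B p) l"
      "lift (opp B p) u X \<odot>[opp B p] k = lift (opp B p) u X \<odot>[opp B p] l"
    obtain w a b where eqs: "k = (w, ?X, a)" "l = (w, ?X, b)"
      using kl by (cases k, cases l) (auto simp: opp_simps)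
    have [simp]: "w \<in> Arr B" using k by (simp add: eqs opp_simps)
    have [simp]: "Dom B u = Cod B w" using k by (simp add: eqs opp_simps)
    have [simp]: "a \<in> arr p" "src p a = src p (lift p w ?X)"
       "b \<in> arr p" "src p b = src p (lift p w ?X)"
       using k l by (simp_all add: eqs opp_simps)
    note ij = lift_Comp_iso[of w u X, simplified]
    note [simp] = over_isoD(1-10)[OF ij]
    let ?i = "cfactor p (lift p w ?X) (cfactor p (lift p u X) (lift p (u \<cdot>[B] w) X) w) (Ident B (Dom B w))"
    let ?j = "cfactor p (lift p (u \<cdot>[B] w) X) (lift p u X \<odot>[p] lift p w ?X) (Ident B (Dom B w))"
    have "a \<odot>[p] ?i = b \<odot>[p] ?i" using kl by (simp add: eqs opp_simps)
    then have "(a \<odot>[p] ?i) \<odot>[p] ?j = (b \<odot>[p] ?i) \<odot>[p] ?j" by simp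
    then show "k = l" by (simp add: eqs)
  qed
qed

lemma opp_cloven: "cloven_fibration B (opp B p)"
proof -
  interpret o: category_over B "opp B p" by (rule opp_category_over)
  show ?thesis
    using o.projection opp_lift_cartesian by unfold_locales (auto simp: opp_simps)
qed

lemma lift_Ident_iso:
  assumes [simp]: "X \<in> ob p" "over_obj p X = A"
  shows "over_iso B p (src p (lift p (Ident B A) X)) X (lift p (Ident B A) X)
    (cfactor p (lift p (Ident B A) X) (Ident (Tot p) X) (Ident B A))"
    (is "over_iso B p ?Y X ?i ?j")
proof -
  have [simp]: "A \<in> Obj B" using over_obj_closed[OF assms(1)] by simp
  have "?j \<odot>[p] ?i = Ident (Tot p) ?Y"
    by (rule cartesian_eqI[of ?i]) (simp_all flip: total.Comp_assoc)
  then show ?thesis by (simp add: over_iso_def hom_def)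
qed

lemma opp_vertical_simps:
  assumes [simp]: "k \<in> arr p" "over_arr p k = Ident B A" "A \<in> Obj B"
  shows "opp_vertical B p k \<in> arr (opp B p)"
    "src (opp B p) (opp_vertical B p k) = tgt p k"
    "tgt (opp B p) (opp_vertical B p k) = src p k"
    "over_arr (opp B p) (opp_vertical B p k) = Ident B A"
    "opp_vertical B p k = (Ident B A, src p k, k \<odot>[p] lift p (Ident B A) (src p k))"
  by (simp_all add: opp_vertical_def Let_def opp_simps)

lemma opp_vertical_eqI:
  assumes [simp]: "k \<in> arr p" "over_arr p k = Ident B A" "l \<in> arr p" "over_arr p l = Ident B A"
    "A \<in> Obj B"
    "src p k = src p l"
    and eq: "opp_vertical B p k = opp_vertical B p l"
  shows "k = l"
proof -
  note [simp] = over_isoD(2,5,6,9,10)[OF lift_Ident_iso]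
  let ?X = "src p l"
  let ?i = "lift p (Ident B A) ?X" and ?j = "cfactor p (lift p (Ident B A) ?X) (Ident (Tot p) ?X) (Ident B A)"
  have "k \<odot>[p] ?i = l \<odot>[p] ?i"
    using eq by (simp add: opp_vertical_simps(5)[of _ A])
  then have "(k \<odot>[p] ?i) \<odot>[p] ?j = (l \<odot>[p] ?i) \<odot>[p] ?j" by simp
  then show ?thesis by simp
qed

text \<open>The lift of the identity in the third component is undone. Together with injectivity and
  multiplicativity of \<open>opp_vertical\<close>, this identifies each fibre of the opposite with
  the opposite of the fibre.\<close>

lemma opp_verticalE:
  assumes "x \<in> arr (opp B p)" "over_arr (opp B p) x = Ident B A" and [simp]: "A \<in> Obj B"
  obtains k where "k \<in> arr p" "over_arr p k = Ident B A" "src p k = tgt (opp B p) x"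
    "tgt p k = src (opp B p) x" "x = opp_vertical B p k"
proof -
  obtain X e where x: "x = (Ident B A, X, e)" using assms by (cases x) (auto simp: opp_simps)
  have [simp]: "X \<in> ob p" "over_obj p X = A" "e \<in> arr p"
    "src p e = src p (lift p (Ident B A) X)" "over_arr p e = Ident B A"
    using assms(1) by (simp_all add: x opp_simps)
  note [simp] = over_isoD(2,5,6,9,10)[OF lift_Ident_iso]
  let ?k = "e \<odot>[p] cfactor p (lift p (Ident B A) X) (Ident (Tot p) X) (Ident B A)"
  have "?k \<in> arr p" "over_arr p ?k = Ident B A" "src p ?k = X" "tgt p ?k = tgt p e"
    "opp_vertical B p ?k = x"
    by (simp_all add: opp_vertical_simps(5)[of _ A] x)
  then show thesis by (intro that[of ?k]) (simp_all add: x opp_simps)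
qed

text \<open>A vertical arrow on the source side acts directly on the third component; on the target
  side, as in \<open>opp_vertical_Comp\<close>, it first has to be reindexed along the base
  arrow.\<close>

lemma opp_Comp_vertical:
  assumes d: "(v, Z, d) \<in> arr (opp B p)" and [simp]: "k \<in> arr p" "over_arr p k = Ident B A"
    "A \<in> Obj B"
    "src p k = tgt p d"
  shows "(v, Z, d) \<odot>[opp B p] opp_vertical B p k = (v, Z, k \<odot>[p] d)"
proof -
  have [simp]: "v \<in> Arr B" "Z \<in> ob p" "over_obj p Z = Cod B v" "d \<in> arr p"
    "src p d = src p (lift p v Z)" "over_arr p d = Ident B (Dom B v)"
    using d by (simp_all add: opp_simps)
  have "over_obj p (tgt p d) = A" using over_Dom[of k] by simp
  then have A: "A = Dom B v" by simp
  have "cfactor p (lift p v Z) (lift p v Z) (Ident B (Dom B v)) = Ident (Tot p) (src p (lift p v Z))"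
    by (rule cfactor_eqI) simp_all
  then show ?thesis
    by (simp add: opp_vertical_simps(5)[of _ "Dom B v"] A[symmetric] opp_simps)
qed

lemma opp_vertical_Comp:
  assumes e: "(u, Y, e) \<in> arr (opp B p)" and [simp]: "k \<in> arr p" "over_arr p k = Ident B A"
    "A \<in> Obj B"
    "tgt p k = Y"
  shows "opp_vertical B p k \<odot>[opp B p] (u, Y, e) = (u, src p k,
    e \<odot>[p] cfactor p (lift p u Y) (k \<odot>[p] lift p u (src p k)) (Ident B (Dom B u)))"
proof -
  have [simp]: "u \<in> Arr B" "Y \<in> ob p" "over_obj p Y = Cod B u" "e \<in> arr p"
    "src p e = src p (lift p u Y)" "over_arr p e = Ident B (Dom B u)"
    using e by (simp_all add: opp_simps)
  have "over_obj p Y = A" using over_Cod[of k] by simp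
  then have A [simp]: "Cod B u = A" by simp
  show ?thesis
    by (simp add: opp_vertical_simps(5)[of _ A] opp_simps)
qed

lemma opp_vertical_mult:
  assumes [simp]: "k \<in> arr p" "over_arr p k = Ident B A" "l \<in> arr p" "over_arr p l = Ident B A"
    "A \<in> Obj B"
    "src p l = tgt p k"
  shows "opp_vertical B p k \<odot>[opp B p] opp_vertical B p l = opp_vertical B p (l \<odot>[p] k)"
proof -
  have "(Ident B A, src p k, k \<odot>[p] lift p (Ident B A) (src p k)) \<odot>[opp B p] opp_vertical B p l =
     (Ident B A, src p k, l \<odot>[p] k \<odot>[p] lift p (Ident B A) (src p k))"
    by (rule opp_Comp_vertical[where A = A]) (simp_all add: opp_simps)
  then show ?thesis by (simp add: opp_vertical_simps(5)[of k A] opp_vertical_simps(5)[of "l \<odot>[p] k" A])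
qed

lemma opp_vertical_Ident:
  "X \<in> ob p \<Longrightarrow> opp_vertical B p (Ident (Tot p) X) = Ident (Tot (opp B p)) X"
  by (simp add: opp_vertical_simps(5)[of _ "over_obj p X"] opp_simps)

lemma opp_over_iso:
  assumes "over_iso B p X Y i j"
  shows "over_iso B (opp B p) X Y (opp_vertical B p j) (opp_vertical B p i)"
  using over_isoD[OF assms] opp_vertical_simps(1-4)[of i "over_obj p X"]  opp_vertical_simps(1-4)[of j "over_obj p X"]
    opp_vertical_mult[of i "over_obj p X" j] opp_vertical_mult[of j "over_obj p X" i] opp_vertical_Ident
  by (simp add: over_iso_def hom_def opp_simps(7))

text \<open>The vertical-cartesian factorization in the opposite can thus be read off from the
  triple.\<close>

lemma opp_lift_Comp_vertical:
  assumes "u \<in> Arr B" "X \<in> ob p" "over_obj p X = Cod B u" "e \<in> arr p"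
    "src p e = src p (lift p u X)" "over_arr p e = Ident B (Dom B u)"
  shows "lift (opp B p) u X \<odot>[opp B p] opp_vertical B p e = (u, X, e)"
  using assms opp_Comp_vertical[of u X "Ident (Tot p) (src p (lift p u X))" e "Dom B u"]
  by (simp add: opp_simps)

end

text \<open>\<open>G\<close> preserves cartesian arrows but not the chosen ones. Hence
  \<open>G e\<close>, whose source is \<open>G (u\<^sup>*X)\<close>, is precomposed with the
  comparison from the chosen reindexing of \<open>G X\<close> along \<open>u\<close>.\<close>

definition opp_ftr :: "('ob, 'ab) cat \<Rightarrow> ('oe, 'ae, 'ob, 'ab) fib \<Rightarrow> ('od, 'ad, 'ob, 'ab) fib \<Rightarrow>
   ('oe, 'ae, 'od, 'ad) ftr \<Rightarrow> ('oe, 'ab \<times> 'oe \<times> 'ae, 'od, 'ab \<times> 'od \<times> 'ad) ftr" where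
  "opp_ftr B p q G = \<lparr>fobj = fobj G,
     farr = (\<lambda>(u, X, e). (u, fobj G X, farr G e \<odot>[q]
       cfactor q (farr G (lift p u X)) (lift q u (fobj G X)) (Ident B (Dom B u))))\<rparr>"

lemma opp_fibrewise_equivalence:
  assumes "cloven_fibration B p" "cloven_fibration B q" "fibrewise_equivalence B p q G"
  shows "fibrewise_equivalence B (opp B p) (opp B q) (opp_ftr B p q G)"
proof -
  interpret p: cloven_fibration B p by fact
  interpret q: cloven_fibration B q by fact
  interpret G: fibrewise_equivalence B p q G by fact
  interpret op: cloven_fibration B "opp B p" by (rule p.opp_cloven)
  interpret oq: cloven_fibration B "opp B q" by (rule q.opp_cloven)
  have Gs [simp]: "fobj (opp_ftr B p q G) X = fobj G X"
    "farr (opp_ftr B p q G) (u, X, e) = (u, fobj G X, farr G e \<odot>[q]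
       cfactor q (farr G (lift p u X)) (lift q u (fobj G X)) (Ident B (Dom B u)))" for u X e
    by (simp_all add: opp_ftr_def)
  have cart [simp]: "cartesian B q (farr G (lift p u X))"
    if "u \<in> Arr B" "X \<in> ob p" "over_obj p X = Cod B u" for u X
    using that by (intro G.preserves_cartesian) simp
  show ?thesis
  proof
    show "is_functor (Tot (opp B p)) (Tot (opp B q)) (opp_ftr B p q G)"
      unfolding is_functor_def
    proof (intro conjI ballI impI)
      fix a assume "a \<in> ob (opp B p)"
      then show "fobj (opp_ftr B p q G) a \<in> ob (opp B q)"
        "farr (opp_ftr B p q G) (Ident (Tot (opp B p)) a) = Ident (Tot (opp B q)) (fobj (opp_ftr B p q G) a)"
        by (simp_all add: opp_simps)
    next
      fix f assume "f \<in> arr (opp B p)"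
      then show "farr (opp_ftr B p q G) f \<in> hom (Tot (opp B q))
         (fobj (opp_ftr B p q G) (src (opp B p) f)) (fobj (opp_ftr B p q G) (tgt (opp B p) f))"
        by (cases f) (auto simp: opp_simps hom_def)
    next
      fix f g assume f: "f \<in> arr (opp B p)" and g: "g \<in> arr (opp B p)"
        and gf: "src (opp B p) g = tgt (opp B p) f"
      obtain u X e v Z d where eqs: "f = (u, X, e)" "g = (v, Z, d)" by (cases f, cases g) auto
      have [simp]: "u \<in> Arr B" "v \<in> Arr B" "tgt p d = X" "X \<in> ob p" "Z \<in> ob p"
        "over_obj p X = Cod B u" "over_obj p Z = Cod B v" "e \<in> arr p" "d \<in> arr p"
        "src p e = src p (lift p u X)" "src p d = src p (lift p v Z)"
        "over_arr p e = Ident B (Dom B u)" "over_arr p d = Ident B (Dom B v)"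
        using f g gf by (auto simp: eqs opp_simps)
      have [simp]: "Cod B u = Dom B v" using p.over_Cod[of d] by simp
      define k' where "k' = cfactor p (lift p v Z) (lift p (v \<cdot>[B] u) Z) u"
      define k where "k = cfactor p (lift p u X) (d \<odot>[p] k') (Ident B (Dom B u))"
      \<comment> \<open>\<open>\<theta> u X\<close> is the comparison from the reindexing of
        \<open>G X\<close> along \<open>u\<close> to \<open>G (u\<^sup>*X)\<close>;
        \<open>K'\<close> and \<open>K\<close> are the counterparts in \<open>q\<close> of
        \<open>k'\<close> and \<open>k\<close>.\<close>
      define \<theta> where "\<theta> =
        (\<lambda>u X. cfactor q (farr G (lift p u X)) (lift q u (fobj G X)) (Ident B (Dom B u)))"
      define K' where "K' = cfactor q (lift q v (fobj G Z)) (lift q (v \<cdot>[B] u) (fobj G Z)) u"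
      define K where "K = cfactor q (lift q u (fobj G X)) ((farr G d \<odot>[q] \<theta> v Z) \<odot>[q] K') (Ident B (Dom B u))"
      have [simp]: "k' \<in> arr p" "src p k' = src p (lift p (v \<cdot>[B] u) Z)"
        "tgt p k' = src p (lift p v Z)" "over_arr p k' = u" "lift p v Z \<odot>[p] k' =
          lift p (v \<cdot>[B] u) Z"
        unfolding k'_def by simp_all
      have [simp]: "k \<in> arr p" "src p k = src p (lift p (v \<cdot>[B] u) Z)"
        "tgt p k = src p (lift p u X)" "over_arr p k = Ident B (Dom B u)"
        "lift p u X \<odot>[p] k = d \<odot>[p] k'"
        unfolding k_def by simp_all
      have \<theta> [simp]: "\<theta> u X \<in> arr q" "src q (\<theta> u X) = src q (lift q u (fobj G X))"
        "tgt q (\<theta> u X) = fobj G (src p (lift p u X))" "over_arr q (\<theta> u X) = Ident B (Dom B u)"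
        "farr G (lift p u X) \<odot>[q] \<theta> u X = lift q u (fobj G X)"
        if "u \<in> Arr B" "X \<in> ob p" "over_obj p X = Cod B u" for u X
        using that unfolding \<theta>_def by simp_all
      have \<theta>' [simp]: "farr G (lift p u X) \<odot>[q] \<theta> u X \<odot>[q] y =
        lift q u (fobj G X) \<odot>[q] y"
        if "u \<in> Arr B" "X \<in> ob p" "over_obj p X = Cod B u" "y \<in> arr q"
          "tgt q y = src q (lift q u (fobj G X))" for u X y
        using that unfolding \<theta>_def by simp
      have [simp]: "K' \<in> arr q" "src q K' = src q (lift q (v \<cdot>[B] u) (fobj G Z))"
        "tgt q K' = src q (lift q v (fobj G Z))" "over_arr q K' = u"
        "lift q v (fobj G Z) \<odot>[q] K' = lift q (v \<cdot>[B] u) (fobj G Z)"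
        unfolding K'_def by simp_all
      have [simp]: "K \<in> arr q" "src q K = src q (lift q (v \<cdot>[B] u) (fobj G Z))"
        "tgt q K = src q (lift q u (fobj G X))" "over_arr q K = Ident B (Dom B u)"
        "lift q u (fobj G X) \<odot>[q] K = farr G d \<odot>[q] \<theta> v Z \<odot>[q] K'"
        unfolding K_def by simp_all
      have comp: "farr G (y \<odot>[p] x) \<odot>[q] z = farr G y \<odot>[q] farr G x \<odot>[q] z"
        if "x \<in> arr p" "y \<in> arr p" "z \<in> arr q" "src p y = tgt p x"
          "fobj G (src p x) = tgt q z" for x y z
        using that by simp
      \<comment> \<open>The comparisons are compatible with the two arrows from which the composite
        is built: first with \<open>k'\<close>, which relates chosen lifts, then with the induced
        vertical \<open>k\<close>. The second equation is functoriality.\<close>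
      have 1: "farr G k' \<odot>[q] \<theta> (v \<cdot>[B] u) Z = \<theta> v Z \<odot>[q] K'"
        by (rule q.cartesian_eqI[of "farr G (lift p v Z)"])
          (simp_all del: G.G_simps(6) add: comp[of k' "lift p v Z", symmetric])
      have 2: "farr G k \<odot>[q] \<theta> (v \<cdot>[B] u) Z = \<theta> u X \<odot>[q] K"
      proof (rule q.cartesian_eqI[of "farr G (lift p u X)"])
        have "farr G (lift p u X) \<odot>[q] farr G k \<odot>[q] \<theta> (v \<cdot>[B] u) Z =
          farr G (d \<odot>[p] k') \<odot>[q] \<theta> (v \<cdot>[B] u) Z"
          by (subst comp[symmetric]) (simp_all del: G.G_simps(6))
        also have "\<dots> = farr G d \<odot>[q] \<theta> v Z \<odot>[q] K'"
          by (simp add: 1)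
        finally show "farr G (lift p u X) \<odot>[q] farr G k \<odot>[q] \<theta> (v \<cdot>[B] u) Z =
          farr G (lift p u X) \<odot>[q] \<theta> u X \<odot>[q] K" by simp
      qed simp_all
      show "farr (opp_ftr B p q G) (g \<odot>[opp B p] f) =
        farr (opp_ftr B p q G) g \<odot>[opp B q] farr (opp_ftr B p q G) f"
        unfolding eqs opp_simps Gs k'_def[symmetric] k_def[symmetric]
          fun_cong[OF fun_cong[OF \<theta>_def], of u X, symmetric] fun_cong[OF fun_cong[OF \<theta>_def], of v Z, symmetric]
          fun_cong[OF fun_cong[OF \<theta>_def], of "v \<cdot>[B] u" Z, symmetric] K'_def[symmetric] K_def[symmetric]
        by (simp add: 2)
    qed
  next
    fix X Y z
    assume X: "X \<in> ob (opp B p)" and Y: "Y \<in> ob (opp B p)"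
      and z: "z \<in> arr (opp B q)" "src (opp B q) z = fobj (opp_ftr B p q G) X"
        "tgt (opp B q) z = fobj (opp_ftr B p q G) Y"
    obtain u e where ze: "z = (u, fobj G Y, e)" using z by (cases z) (auto simp: opp_simps)
    have [simp]: "X \<in> ob p" "Y \<in> ob p" using X Y by (simp_all add: opp_simps)
    have [simp]: "u \<in> Arr B" "over_obj p Y = Cod B u" "e \<in> arr q" "tgt q e = fobj G X"
      "src q e = src q (lift q u (fobj G Y))" "over_arr q e = Ident B (Dom B u)"
      using z by (simp_all add: ze opp_simps)
    have \<theta>: "over_iso B q (src q (lift q u (fobj G Y))) (fobj G (src p (lift p u Y)))
       (cfactor q (farr G (lift p u Y)) (lift q u (fobj G Y)) (Ident B (Dom B u)))
       (cfactor q (lift q u (fobj G Y)) (farr G (lift p u Y)) (Ident B (Dom B u)))"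
      using q.cartesian_over_iso[of "farr G (lift p u Y)" "lift q u (fobj G Y)" "Dom B u"] by simp
    note [simp] = q.over_isoD(1-10)[OF \<theta>]
    \<comment> \<open>Undoing the comparison turns \<open>e\<close> into an arrow between objects in
      the image of \<open>G\<close>, where fullness applies.\<close>
    obtain e' where e' [simp]: "e' \<in> arr p" "src p e' = src p (lift p u Y)" "tgt p e' = X"
      "farr G e' = e \<odot>[q] cfactor q (lift q u (fobj G Y)) (farr G (lift p u Y)) (Ident B (Dom B u))"
      using G.full[of "src p (lift p u Y)" X "e \<odot>[q] cfactor q (lift q u (fobj G Y)) (farr G (lift p u Y)) (Ident B (Dom B u))"]
      by auto
    have "over_arr p e' = over_arr q (farr G e')" by (rule G.G_over_arr[symmetric]) simp
    then have [simp]: "over_arr p e' = Ident B (Dom B u)" by (simp del: G.G_over_arr)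
    show "\<exists>x\<in>arr (opp B p). src (opp B p) x = X \<and> tgt (opp B p) x = Y \<and>
      farr (opp_ftr B p q G) x = z"
      by (rule bexI[of _ "(u, Y, e')"]) (simp_all add: ze opp_simps)
  next
    fix x y
    assume x: "x \<in> arr (opp B p)" and y: "y \<in> arr (opp B p)"
      and xy: "src (opp B p) x = src (opp B p) y" "tgt (opp B p) x = tgt (opp B p) y"
      "farr (opp_ftr B p q G) x = farr (opp_ftr B p q G) y"
    obtain u Y e d where eqs: "x = (u, Y, e)" "y = (u, Y, d)" using xy
      by (cases x, cases y) (auto simp: opp_simps)
    have [simp]: "u \<in> Arr B" "over_obj p Y = Cod B u" "Y \<in> ob p" "e \<in> arr p" "d \<in> arr p"
      "tgt p e = tgt p d"
      "src p e = src p (lift p u Y)" "src p d = src p (lift p u Y)"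
      using x y xy by (simp_all add: eqs opp_simps)
    have \<theta>: "over_iso B q (src q (lift q u (fobj G Y))) (fobj G (src p (lift p u Y)))
       (cfactor q (farr G (lift p u Y)) (lift q u (fobj G Y)) (Ident B (Dom B u)))
       (cfactor q (lift q u (fobj G Y)) (farr G (lift p u Y)) (Ident B (Dom B u)))" (is "over_iso B q _ _ ?i ?j")
      using q.cartesian_over_iso[of "farr G (lift p u Y)" "lift q u (fobj G Y)" "Dom B u"] by simp
    note [simp] = q.over_isoD(1-10)[OF \<theta>]
    have "farr G e \<odot>[q] ?i = farr G d \<odot>[q] ?i"
      using xy(3) by (simp add: eqs)
    then have "(farr G e \<odot>[q] ?i) \<odot>[q] ?j = (farr G d \<odot>[q] ?i) \<odot>[q] ?j" by simp
    then have "farr G e = farr G d" by simp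
    then have "e = d" by (rule G.faithful[rotated -1]) simp_all
    then show "x = y" by (simp add: eqs)
  next
    fix Z assume "Z \<in> ob (opp B q)"
    then have "Z \<in> ob q" by (simp add: opp_simps)
    then obtain X i j where "X \<in> ob p" "over_iso B q (fobj G X) Z i j" using G.eso by blast
    then show "\<exists>X\<in>ob (opp B p). \<exists>i j. over_iso B (opp B q) (fobj (opp_ftr B p q G) X) Z i j"
      using q.opp_over_iso unfolding opp_simps Gs by blast
  qed (auto simp: opp_simps)
qed

text \<open>An arrow is factored into a vertical one followed by the chosen lift of its base arrow.
  The vertical part, reversed in the opposite, is the third component that an arrow of the double
  opposite requires.\<close>

definition opp_opp_ftr :: "('ob, 'ab) cat \<Rightarrow> ('oe, 'ae, 'ob, 'ab) fib \<Rightarrow>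
   ('oe, 'ae, 'oe, 'ab \<times> 'oe \<times> 'ab \<times> 'oe \<times> 'ae) ftr" where
  "opp_opp_ftr B p = \<lparr>fobj = (\<lambda>X. X),
     farr = (\<lambda>x. let u = over_arr p x; Y = tgt p x in
       (u, Y, opp_vertical B p (cfactor p (lift p u Y) x (Ident B (Dom B u)))))\<rparr>"

text \<open>The functor is the identity on objects; that it is full and faithful is existence and
  uniqueness of the vertical-cartesian factorization. The work lies in functoriality, where the
  comparisons of \<open>p\<close> and of its opposite meet.\<close>

lemma opp_opp_fibrewise_equivalence:
  assumes "cloven_fibration B p"
  shows "fibrewise_equivalence B p (opp B (opp B p)) (opp_opp_ftr B p)"
proof -
  interpret p: cloven_fibration B p by fact
  interpret o: cloven_fibration B "opp B p" by (rule p.opp_cloven)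
  interpret oo: cloven_fibration B "opp B (opp B p)" by (rule o.opp_cloven)
  define k where "k = (\<lambda>x. cfactor p (lift p (over_arr p x) (tgt p x)) x (Ident B (Dom B (over_arr p x))))"
  have [simp]: "fobj (opp_opp_ftr B p) = (\<lambda>X. X)"
    "farr (opp_opp_ftr B p) x = (over_arr p x, tgt p x, opp_vertical B p (k x))" for x
    by (simp_all add: opp_opp_ftr_def Let_def k_def)
  have k [simp]: "k x \<in> arr p" "src p (k x) = src p x"
    "tgt p (k x) = src p (lift p (over_arr p x) (tgt p x))"
    "over_arr p (k x) = Ident B (Dom B (over_arr p x))" "lift p (over_arr p x) (tgt p x) \<odot>[p] k x = x"
    if "x \<in> arr p" for x
    using that unfolding k_def by simp_all
  have lk: "lift p (over_arr p x) (tgt p x) \<odot>[p] k x \<odot>[p] y = x \<odot>[p] y"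
    if "x \<in> arr p" "y \<in> arr p" "tgt p y = src p x" for x y
    using that unfolding k_def by simp
  have arr: "(over_arr p x, tgt p x, opp_vertical B p (k x)) \<in> arr (opp B (opp B p))"
    if "x \<in> arr p" for x
    using that by (simp add: opp_simps(2)[of _ _ _ B "opp B p"] p.opp_vertical_simps(1-4)[of _ "Dom B (over_arr p x)"])
       (simp add: opp_simps)
  show ?thesis
  proof
    show "is_functor (Tot p) (Tot (opp B (opp B p))) (opp_opp_ftr B p)"
      unfolding is_functor_def
    proof (intro conjI ballI impI)
      fix a assume [simp]: "a \<in> ob p"
      show "fobj (opp_opp_ftr B p) a \<in> ob (opp B (opp B p))"
        by (simp add: opp_simps)
      have [simp]: "lift p (Ident B (over_obj p a)) a \<odot>[p] (k (Ident (Tot p) a) \<odot>[p] lift p (Ident B (over_obj p a)) a) =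
         lift p (Ident B (over_obj p a)) a"
        using lk[of "Ident (Tot p) a" "lift p (Ident B (over_obj p a)) a"] by simp
      have "k (Ident (Tot p) a) \<odot>[p] lift p (Ident B (over_obj p a)) a =
        Ident (Tot p) (src p (lift p (Ident B (over_obj p a)) a))"
        using k[of "Ident (Tot p) a"]
        by (intro p.cartesian_eqI[of "lift p (Ident B (over_obj p a)) a"
          "k (Ident (Tot p) a) \<odot>[p] lift p (Ident B (over_obj p a)) a"
          "Ident (Tot p) (src p (lift p (Ident B (over_obj p a)) a))"]) simp_all
      then show "farr (opp_opp_ftr B p) (Ident (Tot p) a) =
        Ident (Tot (opp B (opp B p))) (fobj (opp_opp_ftr B p) a)"
        by (simp add: opp_simps opp_vertical_def Let_def)
    next
      fix f assume [simp]: "f \<in> arr p"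
      show "farr (opp_opp_ftr B p) f \<in> hom (Tot (opp B (opp B p))) (fobj (opp_opp_ftr B p) (src p f)) (fobj (opp_opp_ftr B p) (tgt p f))"
        using arr[of f] p.opp_vertical_simps(3)[of "k f" "Dom B (over_arr p f)"]
          by (simp add: hom_def opp_simps(3,4)[of B "opp B p"])
    next
      fix x y assume [simp]: "x \<in> arr p" "y \<in> arr p" "src p y = tgt p x"
      define u where "u = over_arr p x"
      define v where "v = over_arr p y"
      define Y where "Y = tgt p x"
      define Z where "Z = tgt p y"
      have uv [simp]: "over_arr p x = u" "over_arr p y = v" "tgt p x = Y" "tgt p y = Z" "src p y = Y"
        by (simp_all add: u_def v_def Y_def Z_def)
      have [simp]: "u \<in> Arr B" "v \<in> Arr B" "Y \<in> ob p" "Z \<in> ob p" "over_obj p Y = Cod B u"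
        "over_obj p Z = Cod B v"
        unfolding u_def v_def Y_def Z_def by (simp_all del: uv)
      have [simp]: "Dom B v = Cod B u"
        unfolding u_def v_def by (rule p.base_composable) simp_all
      \<comment> \<open>\<open>c : u\<^sup>*Y \<rightarrow> (v u)\<^sup>*Z\<close> is the vertical
        part of \<open>y\<close> composed with the lift of \<open>u\<close>. The goal becomes to
        recognize \<open>opp_vertical B p c\<close> as the vertical arrow that composition in the
        double opposite produces.\<close>
      define c where "c = cfactor p (lift p (v \<cdot>[B] u) Z) (y \<odot>[p] lift p u Y) (Ident B (Dom B u))"
      have c [simp]: "c \<in> arr p" "src p c = src p (lift p u Y)"
        "tgt p c = src p (lift p (v \<cdot>[B] u) Z)" "over_arr p c = Ident B (Dom B u)"
        "lift p (v \<cdot>[B] u) Z \<odot>[p] c = y \<odot>[p] lift p u Y"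
        "\<And>t. t \<in> arr p \<Longrightarrow> tgt p t = src p (lift p u Y) \<Longrightarrow>
          lift p (v \<cdot>[B] u) Z \<odot>[p] c \<odot>[p] t = (y \<odot>[p] lift p u Y) \<odot>[p] t"
        unfolding c_def by simp_all
      have kyx: "k (y \<odot>[p] x) = c \<odot>[p] k x"
      proof (rule p.cartesian_eqI[of "lift p (v \<cdot>[B] u) Z"])
        show "lift p (v \<cdot>[B] u) Z \<odot>[p] k (y \<odot>[p] x) =
          lift p (v \<cdot>[B] u) Z \<odot>[p] c \<odot>[p] k x"
          using k(5)[of "y \<odot>[p] x"] k(5)[of x] by simp
      qed (use k(1-4)[of "y \<odot>[p] x"] in simp_all)
      let ?Y = "src p (lift p u Y)" and ?Z = "src p (lift p v Z)"
      have c_o [simp]: "opp_vertical B p c \<in> arr (opp B p)"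
        "src (opp B p) (opp_vertical B p c) = src p (lift p (v \<cdot>[B] u) Z)"
        "tgt (opp B p) (opp_vertical B p c) = ?Y"
        "over_arr (opp B p) (opp_vertical B p c) = Ident B (Dom B u)"
        using p.opp_vertical_simps(1-4)[of c "Dom B u"] by simp_all
      let ?C' = "cfactor (opp B p) (lift (opp B p) v Z) (lift (opp B p) (v \<cdot>[B] u) Z) u"
      let ?can = "cfactor p (lift p (v \<cdot>[B] u) Z) (lift p v Z \<odot>[p] lift p u ?Z) (Ident B (Dom B u))"
      \<comment> \<open>Comparing chosen lifts in the opposite reverses the direction: its third
        component is the canonical \<open>u\<^sup>*v\<^sup>*Z \<rightarrow> (v u)\<^sup>*Z\<close>
        of \<open>p\<close>.\<close>
      have C': "?C' = (u, ?Z, ?can)"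
      proof (rule o.cfactor_eqI)
        show "lift (opp B p) v Z \<odot>[opp B p] (u, ?Z, ?can) = lift (opp B p) (v \<cdot>[B] u) Z"
          using p.over_isoD(9)[OF p.lift_Comp_iso[of u v Z]] by (simp add: opp_simps)
        show "cartesian B (opp B p) (lift (opp B p) v Z)"
          by (rule p.opp_lift_cartesian) simp_all
      qed (simp_all add: opp_simps)
      have "?can \<odot>[p] cfactor p (lift p u ?Z) (k y \<odot>[p] lift p u Y) (Ident B (Dom B u)) = c"
        (is "_ \<odot>[p] ?t = _")
        by (rule p.cartesian_eqI[of "lift p (v \<cdot>[B] u) Z"]) (use k[of y] lk[of y "lift p u Y"] in simp_all)
      then have "opp_vertical B p (k y) \<odot>[opp B p] ?C' = (u, Y, c)"
        using k[of y] unfolding C' by (subst p.opp_vertical_Comp[where A = "Cod B u"]) (simp_all add: opp_simps)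
      moreover have "lift (opp B p) u Y \<odot>[opp B p] opp_vertical B p c = (u, Y, c)"
        by (rule p.opp_lift_Comp_vertical) simp_all
      ultimately have "cfactor (opp B p) (lift (opp B p) u Y)
         (opp_vertical B p (k y) \<odot>[opp B p] ?C') (Ident B (Dom B u)) = opp_vertical B p c"
        by (intro o.cfactor_eqI p.opp_lift_cartesian) (simp_all add: opp_simps(3,9))
      moreover have "opp_vertical B p (k x) \<odot>[opp B p] opp_vertical B p c =
        opp_vertical B p (k (y \<odot>[p] x))"
        unfolding kyx using k[of x] by (intro p.opp_vertical_mult[where A = "Dom B u"]) simp_all
      ultimately show "farr (opp_opp_ftr B p) (y \<odot>[p] x) =
        farr (opp_opp_ftr B p) y \<odot>[opp B (opp B p)] farr (opp_opp_ftr B p) x"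
        by (simp add: opp_simps(6)[of B "opp B p"])
    qed
  next
    fix X Y z
    assume XY: "X \<in> ob p" "Y \<in> ob p" and z: "z \<in> arr (opp B (opp B p))"
      "src (opp B (opp B p)) z = fobj (opp_opp_ftr B p) X"
      "tgt (opp B (opp B p)) z = fobj (opp_opp_ftr B p) Y"
    obtain u E where zu: "z = (u, Y, E)" using z by (cases z) (auto simp: opp_simps(4)[of B "opp B p"])
    have u [simp]: "u \<in> Arr B" "over_obj p Y = Cod B u" and E: "E \<in> arr (opp B p)"
      "src (opp B p) E = src p (lift p u Y)" "over_arr (opp B p) E = Ident B (Dom B u)"
      "tgt (opp B p) E = X"
      using z XY by (auto simp: zu opp_simps(2)[of _ _ _ B "opp B p"] opp_simps(3)[of B "opp B p"])
        (auto simp: opp_simps)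
    obtain l where l: "l \<in> arr p" "over_arr p l = Ident B (Dom B u)" "src p l = X"
      "tgt p l = src p (lift p u Y)" "E = opp_vertical B p l"
      using p.opp_verticalE[OF E(1,3)] E by (metis p.base.Obj_Dom u(1))
    let ?x = "lift p u Y \<odot>[p] l"
    have x: "?x \<in> arr p" "src p ?x = X" "tgt p ?x = Y" "over_arr p ?x = u"
      using l XY by simp_all
    have "k ?x = l" unfolding k_def x using l XY by (intro p.cfactor_eqI) simp_all
    then show "\<exists>x\<in>arr p. src p x = X \<and> tgt p x = Y \<and> farr (opp_opp_ftr B p) x = z"
      using l(5) x by (intro bexI[of _ ?x]) (simp_all add: zu)
  next
    fix x y
    assume xy: "x \<in> arr p" "y \<in> arr p" "src p x = src p y" "tgt p x = tgt p y"
      "farr (opp_opp_ftr B p) x = farr (opp_opp_ftr B p) y"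
    then have o: "over_arr p x = over_arr p y" and v: "opp_vertical B p (k x) =
      opp_vertical B p (k y)" by simp_all
    have "k x = k y"
      using k[OF xy(1)] k[OF xy(2)] xy(2-4) o v by (intro p.opp_vertical_eqI[of "k x" "Dom B (over_arr p y)"
        "k y"]) simp_all
    then show "x = y" using k(5)[OF xy(1)] k(5)[OF xy(2)] o xy(4) by metis
  next
    fix Z assume "Z \<in> ob (opp B (opp B p))"
    then show "\<exists>X\<in>ob p. \<exists>i j. over_iso B (opp B (opp B p)) (fobj (opp_opp_ftr B p) X) Z i j"
      using oo.over_iso_Ident[of Z] unfolding opp_simps(1) \<open>fobj (opp_opp_ftr B p) =
        (\<lambda>X. X)\<close> by blast
  qed (auto simp: opp_simps)
qed

section \<open>The coproduct completion\<close>

context category_over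
begin

lemma cartesian_Comp:
  assumes x: "cartesian B p x" and y: "cartesian B p y" and xy [simp]: "src p y = tgt p x"
  shows "cartesian B p (y \<odot>[p] x)"
proof (rule cartesianI)
  note [simp] = cartesian_Arr[OF x] cartesian_Arr[OF y]
  have b [simp]: "Dom B (over_arr p y) = Cod B (over_arr p x)" by (rule base_composable) simp_all
  show "y \<odot>[p] x \<in> arr p" by simp
  { fix z w assume [simp]: "z \<in> arr p" "w \<in> Arr B" "Dom B w = Dom B (over_arr p z)"
      and z: "tgt p z = tgt p (y \<odot>[p] x)"
      and w: "Cod B w = Dom B (over_arr p (y \<odot>[p] x))" "over_arr p (y \<odot>[p] x) \<cdot>[B] w =
        over_arr p z"
    have [simp]: "tgt p z = tgt p y" "Cod B w = Dom B (over_arr p x)" using z w by simp_all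
    then have [simp]: "over_arr p y \<cdot>[B] over_arr p x \<cdot>[B] w = over_arr p z"
      using w by simp
    show "\<exists>k. k \<in> arr p \<and> src p k = src p z \<and> tgt p k = src p (y \<odot>[p] x) \<and>
      over_arr p k = w \<and> (y \<odot>[p] x) \<odot>[p] k = z"
      by (rule exI[of _ "cfactor p x (cfactor p y z (over_arr p x \<cdot>[B] w)) w"]) (simp add: x y) }
  fix k l assume [simp]: "k \<in> arr p" "l \<in> arr p" "src p k = src p l"
    and c: "tgt p k = src p (y \<odot>[p] x)" "tgt p l = src p (y \<odot>[p] x)"
    and o: "over_arr p k = over_arr p l" and eq: "(y \<odot>[p] x) \<odot>[p] k = (y \<odot>[p] x) \<odot>[p] l"
  have [simp]: "tgt p k = src p x" "tgt p l = src p x" using c by simp_all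
  have [simp]: "Dom B (over_arr p x) = Cod B (over_arr p l)" by (rule base_composable) simp_all
  have "y \<odot>[p] x \<odot>[p] k = y \<odot>[p] x \<odot>[p] l" using eq by simp
  then have "x \<odot>[p] k = x \<odot>[p] l"
    using o by (intro cartesian_eqI[OF y, of "x \<odot>[p] k" "x \<odot>[p] l"]) simp_all
  then show "k = l" using o by (intro cartesian_eqI[OF x, of k l]) simp_all
qed

end

section \<open>Calculus of canonical isomorphisms\<close>

context cloven_fibration
begin

lemma vfactor_eqI:
  assumes "cartesian B p y" "k \<in> arr p" "src p k = src p x" "tgt p k = src p y"
    "over_arr p k = Ident B (over_obj p (src p x))" "y \<odot>[p] k = x"
  shows "vfactor B p x y = k"
  unfolding vfactor_cfactor using assms by (intro cfactor_eqI) auto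

lemma vfactor_self:
  assumes x: "cartesian B p x"
  shows "vfactor B p x x = Ident (Tot p) (src p x)"
  using cartesian_Arr[OF x] by (intro vfactor_eqI[OF x]) simp_all

text \<open>Cocycle rule: a chain of canonical isomorphisms between lifts over one base arrow
  collapses to a single one.\<close>

lemma vfactor_mult:
  assumes z: "cartesian B p z" and y: "cartesian B p y" and [simp]: "x \<in> arr p"
    "tgt p x = tgt p y" "tgt p y = tgt p z" "over_arr p x = over_arr p z" "over_arr p y = over_arr p z"
  shows "vfactor B p y z \<odot>[p] vfactor B p x y = vfactor B p x z"
proof -
  note [simp] = cartesian_Arr[OF y] cartesian_Arr[OF z] y z
  have "z \<odot>[p] vfactor B p y z \<odot>[p] vfactor B p x y = x"
    by (simp flip: total.Comp_assoc)
  then show ?thesis by (intro vfactor_eqI[symmetric]) simp_all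
qed

lemma lift2_simps [simp]:
  assumes [simp]: "v \<in> Arr B" "u \<in> Arr B" "Dom B v = Cod B u" "Z \<in> ob p" "over_obj p Z = Cod B v"
  shows "cartesian B p (lift2 B p v u Z)" "lift2 B p v u Z \<in> arr p" "tgt p (lift2 B p v u Z) = Z"
    "over_arr p (lift2 B p v u Z) = v \<cdot>[B] u"
    "src p (lift2 B p v u Z) = src p (lift p u (src p (lift p v Z)))"
  using cartesian_Comp[of "lift p u (src p (lift p v Z))" "lift p v Z"]
  by (simp_all add: lift2_def reindex_def)

lemma reindex_simps [simp]:
  assumes [simp]: "k \<in> arr p" "u \<in> Arr B" "over_arr p k = Ident B (Cod B u)"
  shows "farr (reindex B p u) k \<in> arr p"
    "src p (farr (reindex B p u) k) = src p (lift p u (src p k))"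
    "tgt p (farr (reindex B p u) k) = src p (lift p u (tgt p k))"
    "over_arr p (farr (reindex B p u) k) = Ident B (Dom B u)"
    "lift p u (tgt p k) \<odot>[p] farr (reindex B p u) k = k \<odot>[p] lift p u (src p k)"
  by (simp_all add: reindex_def)

lemma reindex_Ident [simp]:
  assumes [simp]: "X \<in> ob p" "u \<in> Arr B" "over_obj p X = Cod B u"
  shows "farr (reindex B p u) (Ident (Tot p) X) = Ident (Tot p) (src p (lift p u X))"
  by (simp add: reindex_def) (rule vfactor_self, simp)

lemma reindex_obj [simp]: "fobj (reindex B p u) X = src p (lift p u X)"
  by (simp add: reindex_def)

text \<open>The single factorization in \<open>opp_comp\<close> is split into
  \<open>u\<^sup>*d\<close> and a canonical isomorphism. This is the shape of
  \<open>pi_comp\<close>, \<open>bc_map\<close> and \<open>section_counit\<close>, against which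
  compositions in the opposite are matched later.\<close>

lemma opp_Comp_eq:
  assumes [simp]: "v \<in> Arr B" "u \<in> Arr B" "Dom B v = Cod B u" "Z \<in> ob p" "over_obj p Z = Cod B v"
    "d \<in> arr p" "over_arr p d = Ident B (Dom B v)" "src p d = src p (lift p v Z)" "tgt p d = X"
  shows "(v, Z, d) \<odot>[opp B p] (u, X, e) = (v \<cdot>[B] u, Z,
    e \<odot>[p] farr (reindex B p u) d \<odot>[p] vfactor B p (lift p (v \<cdot>[B] u) Z) (lift2 B p v u Z))"
proof -
  have [simp]: "X \<in> ob p" using total.Obj_Cod[of d] by simp
  have [simp]: "over_obj p X = Cod B u" using over_Cod[of d] by simp
  let ?Y = "src p (lift p v Z)" and ?c = "vfactor B p (lift p (v \<cdot>[B] u) Z) (lift2 B p v u Z)"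
  have c [simp]: "?c \<in> arr p" "src p ?c = src p (lift p (v \<cdot>[B] u) Z)"
    "tgt p ?c = src p (lift p u ?Y)" "over_arr p ?c = Ident B (Dom B u)"
    by simp_all
  have "lift p v Z \<odot>[p] lift p u ?Y \<odot>[p] ?c = (lift p v Z \<odot>[p] lift p u ?Y) \<odot>[p] ?c"
    by (rule total.Comp_assoc[symmetric]) simp_all
  also have "\<dots> = lift2 B p v u Z \<odot>[p] ?c" by (simp only: lift2_def reindex_obj)
  also have "\<dots> = lift p (v \<cdot>[B] u) Z" by (rule vfactor_simps) simp_all
  finally have lc: "lift p v Z \<odot>[p] lift p u ?Y \<odot>[p] ?c = lift p (v \<cdot>[B] u) Z" .
  have 1: "cfactor p (lift p v Z) (lift p (v \<cdot>[B] u) Z) u = lift p u ?Y \<odot>[p] ?c"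
    by (rule cfactor_eqI) (simp_all add: lc)
  have "lift p u X \<odot>[p] farr (reindex B p u) d \<odot>[p] ?c =
    (lift p u X \<odot>[p] farr (reindex B p u) d) \<odot>[p] ?c"
    by (rule total.Comp_assoc[symmetric]) simp_all
  also have "\<dots> = d \<odot>[p] lift p u ?Y \<odot>[p] ?c"
    using reindex_simps(5)[of d u] by simp
  finally have 2: "cfactor p (lift p u X) (d \<odot>[p] lift p u ?Y \<odot>[p] ?c) (Ident B (Dom B u)) =
     farr (reindex B p u) d \<odot>[p] ?c"
    by (intro cfactor_eqI) simp_all
  show ?thesis unfolding opp_simps 1 2 ..
qed

end

text \<open>The component \<open>X \<rightarrow> Y\<close> of an arrow is not stored, being
  \<open>over_arr p \<phi>\<close>. The base arrow \<open>f\<close> has to be stored: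
  \<open>g\<close> need not be epi, so \<open>f g\<close> does not determine it. Source and target
  are stored because \<open>g\<close> and \<open>h\<close> cannot be read off from
  \<open>\<phi>\<close>.\<close>

definition sigma :: "('ob, 'ab) cat \<Rightarrow> 'ab set \<Rightarrow> ('oe, 'ae, 'ob, 'ab) fib \<Rightarrow>
   ('ab \<times> 'oe, ('ab \<times> 'oe) \<times> ('ab \<times> 'oe) \<times> 'ab \<times> 'ae, 'ob, 'ab) fib" where
  "sigma B F p =
     \<lparr>Tot = \<lparr>Obj = {(g, \<alpha>). g \<in> F \<and> \<alpha> \<in> ob p \<and>
       over_obj p \<alpha> = Dom B g},
        Arr = {((g, \<alpha>), (h, \<beta>), f, \<phi>). g \<in> F \<and> h \<in> F \<and>
          over_obj p \<alpha> = Dom B g \<and> over_obj p \<beta> = Dom B h \<and>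
           f \<in> hom B (Cod B g) (Cod B h) \<and> \<phi> \<in> hom (Tot p) \<alpha> \<beta> \<and>
             h \<cdot>[B] over_arr p \<phi> = f \<cdot>[B] g},
        Dom = (\<lambda>(s, t, f, \<phi>). s), Cod = (\<lambda>(s, t, f, \<phi>). t),
        Ident = (\<lambda>(g, \<alpha>). ((g, \<alpha>), (g, \<alpha>), Ident B (Cod B g), Ident (Tot p) \<alpha>)),
        Comp = (\<lambda>(s', t', f', \<psi>) (s, t, f, \<phi>). (s, t', f' \<cdot>[B] f, \<psi> \<odot>[p] \<phi>))\<rparr>,
      proj = \<lparr>fobj = (\<lambda>(g, \<alpha>). Cod B g), farr = (\<lambda>(s, t, f, \<phi>). f)\<rparr>,
      lift = (\<lambda>f (h, \<beta>). let x =
        lift p (pb_snd B f h) \<beta> in ((pb_fst B f h, src p x), (h, \<beta>), f, x))\<rparr>"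

lemma sigma_simps:
  "(g, \<alpha>) \<in> ob (sigma B F p) \<longleftrightarrow> g \<in> F \<and> \<alpha> \<in> ob p \<and>
    over_obj p \<alpha> = Dom B g"
  "((g, \<alpha>), (h, \<beta>), f, \<phi>) \<in> arr (sigma B F p) \<longleftrightarrow> g \<in> F \<and>
    h \<in> F \<and> over_obj p \<alpha> = Dom B g \<and>
     over_obj p \<beta> = Dom B h \<and> f \<in> Arr B \<and> Dom B f = Cod B g \<and> Cod B f = Cod B h \<and>
     \<phi> \<in> arr p \<and> src p \<phi> = \<alpha> \<and> tgt p \<phi> = \<beta> \<and>
       h \<cdot>[B] over_arr p \<phi> = f \<cdot>[B] g"
  "src (sigma B F p) (s, t, f, \<phi>) = s"
  "tgt (sigma B F p) (s, t, f, \<phi>) = t"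
  "Ident (Tot (sigma B F p)) (g, \<alpha>) =
    ((g, \<alpha>), (g, \<alpha>), Ident B (Cod B g), Ident (Tot p) \<alpha>)"
  "(s', t', f', \<psi>) \<odot>[sigma B F p] (s, t, f, \<phi>) =
    (s, t', f' \<cdot>[B] f, \<psi> \<odot>[p] \<phi>)"
  "over_obj (sigma B F p) (g, \<alpha>) = Cod B g"
  "over_arr (sigma B F p) (s, t, f, \<phi>) = f"
  "lift (sigma B F p) f (h, \<beta>) =
     ((pb_fst B f h, src p (lift p (pb_snd B f h) \<beta>)), (h, \<beta>), f, lift p (pb_snd B f h) \<beta>)"
  by (auto simp: sigma_def hom_def Let_def)

lemma is_pullback_ex1:
  assumes "is_pullback C v f u g" "a \<in> Arr C" "b \<in> Arr C" "Dom C a = Dom C b" "Cod C a = Dom C f"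
    "Cod C b = Dom C v" "v \<cdot>\<^bsub>C\<^esub> b = f \<cdot>\<^bsub>C\<^esub> a"
  shows "\<exists>!k. k \<in> hom C (Dom C a) (Dom C u) \<and> u \<cdot>\<^bsub>C\<^esub> k = a \<and>
    g \<cdot>\<^bsub>C\<^esub> k = b"
  using assms unfolding is_pullback_def by blast

section \<open>Chosen pullbacks of display maps\<close>

context display_map_category
begin

lemma display_Arr [simp]: "f \<in> F \<Longrightarrow> f \<in> Arr B"
  using display_arr by auto

lemma pb_is_pullback:
  assumes "h \<in> F" "f \<in> Arr B" "Cod B f = Cod B h"
  shows "is_pullback B h f (pb_fst B f h) (pb_snd B f h)"
proof -
  have "\<exists>ug. is_pullback B h f (fst ug) (snd ug)" using pullback_exists[OF assms] by auto
  then show ?thesis unfolding pb_fst_def pb_snd_def pb_choice_def by (rule someI_ex)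
qed

lemma pb_simps [simp]:
  assumes h: "h \<in> F" and f: "f \<in> Arr B" "Cod B f = Cod B h"
  shows "pb_fst B f h \<in> F" "Cod B (pb_fst B f h) = Dom B f"
    "pb_snd B f h \<in> Arr B" "Dom B (pb_snd B f h) = Dom B (pb_fst B f h)" "Cod B (pb_snd B f h) = Dom B h"
    "h \<cdot>[B] pb_snd B f h = f \<cdot>[B] pb_fst B f h"
  using pb_is_pullback[OF assms] pullback_display[OF h pb_is_pullback[OF assms]]
  by (auto simp: is_pullback_def hom_def)

lemma pb_pair_simps [simp]:
  assumes "h \<in> F" "f \<in> Arr B" "Cod B f = Cod B h" "a \<in> Arr B" "b \<in> Arr B" "Dom B b = Dom B a"
    "Cod B a = Dom B f" "Cod B b = Dom B h" "h \<cdot>[B] b = f \<cdot>[B] a"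
  shows "pb_pair B f h a b \<in> Arr B" "Dom B (pb_pair B f h a b) = Dom B a"
    "Cod B (pb_pair B f h a b) = Dom B (pb_fst B f h)"
    "pb_fst B f h \<cdot>[B] pb_pair B f h a b = a" "pb_snd B f h \<cdot>[B] pb_pair B f h a b = b"
proof -
  have "\<exists>!k. k \<in> hom B (Dom B a) (Dom B (pb_fst B f h)) \<and> pb_fst B f h \<cdot>[B] k = a \<and>
    pb_snd B f h \<cdot>[B] k = b"
    using assms(4-9) by (intro is_pullback_ex1[OF pb_is_pullback[OF assms(1-3)]]) simp_all
  from theI'[OF this] show "pb_pair B f h a b \<in> Arr B" "Dom B (pb_pair B f h a b) = Dom B a"
    "Cod B (pb_pair B f h a b) = Dom B (pb_fst B f h)"
    "pb_fst B f h \<cdot>[B] pb_pair B f h a b = a" "pb_snd B f h \<cdot>[B] pb_pair B f h a b = b"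
    by (auto simp: pb_pair_def pb_obj_def hom_def)
qed

lemma pb_eqI:
  assumes h: "h \<in> F" and f: "f \<in> Arr B" "Cod B f = Cod B h" and [simp]: "k \<in> Arr B" "l \<in> Arr B"
    "Dom B k = Dom B l" "Cod B k = Dom B (pb_fst B f h)" "Cod B l = Dom B (pb_fst B f h)"
    and eq: "pb_fst B f h \<cdot>[B] k = pb_fst B f h \<cdot>[B] l" "pb_snd B f h \<cdot>[B] k =
      pb_snd B f h \<cdot>[B] l"
  shows "k = l"
proof -
  note [simp] = h f
  have sq: "h \<cdot>[B] pb_snd B f h \<cdot>[B] l = f \<cdot>[B] pb_fst B f h \<cdot>[B] l"
    using Comp_assoc[of l "pb_snd B f h" h] Comp_assoc[of l "pb_fst B f h" f] by simp
  have "\<exists>!m. m \<in> hom B (Dom B (pb_fst B f h \<cdot>[B] l)) (Dom B (pb_fst B f h)) \<and>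
      pb_fst B f h \<cdot>[B] m = pb_fst B f h \<cdot>[B] l \<and> pb_snd B f h \<cdot>[B] m =
        pb_snd B f h \<cdot>[B] l"
    using sq by (intro is_pullback_ex1[OF pb_is_pullback[OF h f]]) simp_all
  moreover have "k \<in> hom B (Dom B (pb_fst B f h \<cdot>[B] l)) (Dom B (pb_fst B f h))"
    "l \<in> hom B (Dom B (pb_fst B f h \<cdot>[B] l)) (Dom B (pb_fst B f h))"
    by (simp_all add: hom_def)
  ultimately show ?thesis using eq by blast
qed

end

locale display_fibration = display_map_category B F + cloven_fibration B p
  for B :: "('ob, 'ab) cat" and F :: "'ab set" and p :: "('oe, 'ae, 'ob, 'ab) fib"
begin

lemma sigma_category_over: "category_over B (sigma B F p)"
proof -
  have "category (Tot (sigma B F p))"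
  proof
    fix f assume f: "f \<in> arr (sigma B F p)"
    then show "src (sigma B F p) f \<in> ob (sigma B F p)" "tgt (sigma B F p) f \<in> ob (sigma B F p)"
      by (cases f; auto simp: sigma_simps simp del: over_Dom over_Cod)+
  next
    fix a assume "a \<in> ob (sigma B F p)"
    then show "Ident (Tot (sigma B F p)) a \<in> hom (Tot (sigma B F p)) a a"
      by (cases a) (auto simp: sigma_simps hom_def)
  next
    fix f a b assume "f \<in> hom (Tot (sigma B F p)) a b"
    then show "Ident (Tot (sigma B F p)) b \<odot>[sigma B F p] f = f"
      "f \<odot>[sigma B F p] Ident (Tot (sigma B F p)) a = f"
      by (cases f; cases a; cases b; auto simp: sigma_simps hom_def)+
  next
    fix f a b g c assume f: "f \<in> hom (Tot (sigma B F p)) a b" and g: "g \<in> hom (Tot (sigma B F p)) b c"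
    obtain ga \<alpha> h \<beta> f0 \<phi> l \<gamma> k0 \<psi> where eqs: "f =
      ((ga, \<alpha>), (h, \<beta>), f0, \<phi>)" "g = ((h, \<beta>), (l, \<gamma>), k0, \<psi>)"
      "a = (ga, \<alpha>)" "b = (h, \<beta>)" "c = (l, \<gamma>)"
      using f g by (cases f; cases g; cases a; cases b; cases c; auto simp: sigma_simps hom_def)
    have *: "ga \<in> F" "h \<in> F" "l \<in> F" "f0 \<in> Arr B" "k0 \<in> Arr B" "\<phi> \<in> arr p"
      "\<psi> \<in> arr p"
      "Dom B f0 = Cod B ga" "Cod B f0 = Cod B h" "Dom B k0 = Cod B h" "Cod B k0 = Cod B l"
      "src p \<phi> = \<alpha>" "tgt p \<phi> = \<beta>" "src p \<psi> = \<beta>" "tgt p \<psi> = \<gamma>"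
      "over_obj p \<alpha> = Dom B ga" "over_obj p \<beta> = Dom B h" "over_obj p \<gamma> = Dom B l"
      "h \<cdot>[B] over_arr p \<phi> = f0 \<cdot>[B] ga" "l \<cdot>[B] over_arr p \<psi> = k0 \<cdot>[B] h"
      using f g by (auto simp: eqs sigma_simps hom_def)
    have b: "Dom B (over_arr p \<phi>) = Dom B ga" "Cod B (over_arr p \<phi>) = Dom B h"
      "Dom B (over_arr p \<psi>) = Dom B h" "Cod B (over_arr p \<psi>) = Dom B l"
      using * over_Dom[of \<phi>] over_Cod[of \<phi>] over_Dom[of \<psi>] over_Cod[of \<psi>] by simp_all
    have "l \<cdot>[B] over_arr p \<psi> \<cdot>[B] over_arr p \<phi> =
      (l \<cdot>[B] over_arr p \<psi>) \<cdot>[B] over_arr p \<phi>"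
      by (rule Comp_assoc[symmetric]) (use * b in simp_all)
    also have "\<dots> = k0 \<cdot>[B] h \<cdot>[B] over_arr p \<phi>" using * b by simp
    finally show "g \<odot>[sigma B F p] f \<in> hom (Tot (sigma B F p)) a c"
      using * b by (auto simp: eqs sigma_simps hom_def)
  next
    fix f a b g c h d assume "f \<in> hom (Tot (sigma B F p)) a b" "g \<in> hom (Tot (sigma B F p)) b c"
      "h \<in> hom (Tot (sigma B F p)) c d"
    then show "(h \<odot>[sigma B F p] g) \<odot>[sigma B F p] f =
      h \<odot>[sigma B F p] g \<odot>[sigma B F p] f"
      by (cases f; cases g; cases h; cases a; cases b; cases c; cases d; auto simp: sigma_simps hom_def)
  qed
  then interpret s: category "Tot (sigma B F p)" .
  show ?thesis
  proof
    show "is_functor (Tot (sigma B F p)) B (proj (sigma B F p))"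
      unfolding is_functor_def by (auto simp: sigma_simps hom_def)
  qed
qed

lemma sigma_cloven: "cloven_fibration B (sigma B F p)"
proof -
  interpret s: category_over B "sigma B F p" by (rule sigma_category_over)
  have arr: "lift (sigma B F p) u (h, \<beta>) \<in> arr (sigma B F p)"
    if "u \<in> Arr B" "h \<in> F" "\<beta> \<in> ob p" "over_obj p \<beta> = Dom B h" "Cod B u =
      Cod B h" for u h \<beta>
    using that by (simp add: sigma_simps)
  have cart: "cartesian B (sigma B F p) (lift (sigma B F p) u (h, \<beta>))"
    if [simp]: "u \<in> Arr B" "h \<in> F" "\<beta> \<in> ob p" "over_obj p \<beta> = Dom B h" "Cod B u =
      Cod B h" for u h \<beta>
  proof (rule s.cartesianI)
    show "lift (sigma B F p) u (h, \<beta>) \<in> arr (sigma B F p)" using arr that by simp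
  next
    fix z w
    assume z: "z \<in> arr (sigma B F p)" "tgt (sigma B F p) z =
      tgt (sigma B F p) (lift (sigma B F p) u (h, \<beta>))"
      and w: "w \<in> Arr B" "Dom B w = Dom B (over_arr (sigma B F p) z)"
       "Cod B w = Dom B (over_arr (sigma B F p) (lift (sigma B F p) u (h, \<beta>)))"
       "over_arr (sigma B F p) (lift (sigma B F p) u (h, \<beta>)) \<cdot>[B] w = over_arr (sigma B F p) z"
    have [simp]: "w \<in> Arr B" "Cod B w = Dom B u" using w by (simp_all add: sigma_simps)
    obtain g \<alpha> \<phi> where ze: "z = ((g, \<alpha>), (h, \<beta>), u \<cdot>[B] w, \<phi>)"
      using z w(4) by (cases z) (auto simp: sigma_simps)
    have [simp]: "g \<in> F" "over_obj p \<alpha> = Dom B g" "Dom B w = Cod B g" "\<phi> \<in> arr p"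
      "src p \<phi> = \<alpha>" "tgt p \<phi> = \<beta>"
      and sq: "h \<cdot>[B] over_arr p \<phi> = (u \<cdot>[B] w) \<cdot>[B] g"
      using z by (auto simp: ze sigma_simps)
    have sq' [simp]: "h \<cdot>[B] over_arr p \<phi> = u \<cdot>[B] w \<cdot>[B] g" using sq by simp
    have [simp]: "Dom B (over_arr p \<phi>) = Dom B g" "Cod B (over_arr p \<phi>) = Dom B h"
      using over_Dom[of \<phi>] over_Cod[of \<phi>] by simp_all
    \<comment> \<open>The square condition on \<open>\<phi>\<close> is exactly what makes
      \<open>w g\<close> and \<open>over_arr p \<phi>\<close> a cone over the cospan of
      \<open>u\<close> and \<open>h\<close>.\<close>
    let ?x = "pb_pair B u h (w \<cdot>[B] g) (over_arr p \<phi>)"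
    let ?k = "cfactor p (lift p (pb_snd B u h) \<beta>) \<phi> ?x"
    have "((g, \<alpha>), (pb_fst B u h, src p (lift p (pb_snd B u h) \<beta>)), w, ?k) \<in> arr (sigma B F p)"
      unfolding sigma_simps by (intro conjI) simp_all
    then show "\<exists>k. k \<in> arr (sigma B F p) \<and> src (sigma B F p) k = src (sigma B F p) z \<and>
       tgt (sigma B F p) k = src (sigma B F p) (lift (sigma B F p) u (h, \<beta>)) \<and>
       over_arr (sigma B F p) k = w \<and> lift (sigma B F p) u (h, \<beta>) \<odot>[sigma B F p] k = z"
      by (intro exI conjI, assumption) (simp_all add: sigma_simps(3-9) ze)
  next
    fix k l
    assume k: "k \<in> arr (sigma B F p)" and l: "l \<in> arr (sigma B F p)"
      and kl: "src (sigma B F p) k = src (sigma B F p) l"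
       "tgt (sigma B F p) k = src (sigma B F p) (lift (sigma B F p) u (h, \<beta>))"
       "tgt (sigma B F p) l = src (sigma B F p) (lift (sigma B F p) u (h, \<beta>))"
       "over_arr (sigma B F p) k = over_arr (sigma B F p) l"
       "lift (sigma B F p) u (h, \<beta>) \<odot>[sigma B F p] k =
         lift (sigma B F p) u (h, \<beta>) \<odot>[sigma B F p] l"
    obtain g \<alpha> f \<phi> \<psi> where eqs: "k =
      ((g, \<alpha>), (pb_fst B u h, src p (lift p (pb_snd B u h) \<beta>)), f, \<phi>)"
      "l = ((g, \<alpha>), (pb_fst B u h, src p (lift p (pb_snd B u h) \<beta>)), f, \<psi>)"
      using kl by (cases k; cases l) (auto simp: sigma_simps)
    have [simp]: "\<phi> \<in> arr p" "src p \<phi> = \<alpha>" "tgt p \<phi> =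
      src p (lift p (pb_snd B u h) \<beta>)"
      "\<psi> \<in> arr p" "src p \<psi> = \<alpha>" "tgt p \<psi> = src p (lift p (pb_snd B u h) \<beta>)"
      and sq: "pb_fst B u h \<cdot>[B] over_arr p \<phi> = f \<cdot>[B] g"
        "pb_fst B u h \<cdot>[B] over_arr p \<psi> = f \<cdot>[B] g"
      using k l by (auto simp: eqs sigma_simps)
    have [simp]: "Cod B (over_arr p \<phi>) = Dom B (pb_fst B u h)" "Cod B (over_arr p \<psi>) =
      Dom B (pb_fst B u h)"
      "Dom B (over_arr p \<phi>) = Dom B (over_arr p \<psi>)"
      using over_Cod[of \<phi>] over_Cod[of \<psi>] over_Dom[of \<phi>] over_Dom[of \<psi>] by simp_all
    have eq: "lift p (pb_snd B u h) \<beta> \<odot>[p] \<phi> = lift p (pb_snd B u h) \<beta> \<odot>[p] \<psi>"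
      using kl(5) by (simp add: eqs sigma_simps)
    \<comment> \<open>The base arrows have to agree before cartesianness applies. Their composites
      with the second projection agree because the composites with the lift do, those with the first
      by the square conditions.\<close>
    then have "over_arr p (lift p (pb_snd B u h) \<beta> \<odot>[p] \<phi>) =
      over_arr p (lift p (pb_snd B u h) \<beta> \<odot>[p] \<psi>)"
      by simp
    then have "pb_snd B u h \<cdot>[B] over_arr p \<phi> = pb_snd B u h \<cdot>[B] over_arr p \<psi>" by simp
    then have "over_arr p \<phi> = over_arr p \<psi>"
      using sq by (intro pb_eqI[of h u "over_arr p \<phi>" "over_arr p \<psi>"]) simp_all
    then have "\<phi> = \<psi>" using eq
      by (intro cartesian_eqI[of "lift p (pb_snd B u h) \<beta>" \<phi> \<psi>]) simp_all
    then show "k = l" by (simp add: eqs)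
  qed
  show ?thesis
  proof
    show "is_functor (Tot (sigma B F p)) B (proj (sigma B F p))" by (rule s.projection)
    fix u X assume "u \<in> Arr B" "X \<in> ob (sigma B F p)" "over_obj (sigma B F p) X = Cod B u"
    then show "cartesian B (sigma B F p) (lift (sigma B F p) u X)"
      "lift (sigma B F p) u X \<in> arr (sigma B F p) \<and> tgt (sigma B F p) (lift (sigma B F p) u X) =
        X \<and>
       over_arr (sigma B F p) (lift (sigma B F p) u X) = u"
      by (cases X; use arr cart in \<open>auto simp: sigma_simps(1,3-9)\<close>)+
  qed
qed

end

section \<open>The product completion as a double opposite\<close>

text \<open>Transport of structure: \<open>p\<close> is a bare record, and its category laws are
  read back from \<open>q\<close> along the injective \<open>\<phi>\<close>. For the product
  completion this replaces a direct proof of associativity of \<open>pi_comp\<close>.\<close>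

lemma fibrewise_equivalence_if_bij:
  assumes "category_over B q" and Obj: "ob p = ob q" and bij: "bij_betw \<phi> (arr p) (arr q)"
    and dc: "\<And>x. x \<in> arr p \<Longrightarrow> src q (\<phi> x) = src p x"
      "\<And>x. x \<in> arr p \<Longrightarrow> tgt q (\<phi> x) = tgt p x"
    and over: "\<And>x. x \<in> arr p \<Longrightarrow> over_arr q (\<phi> x) = over_arr p x"
      "\<And>X. X \<in> ob p \<Longrightarrow> over_obj q X = over_obj p X"
    and ident: "\<And>X. X \<in> ob p \<Longrightarrow> Ident (Tot p) X \<in> arr p \<and>
      \<phi> (Ident (Tot p) X) = Ident (Tot q) X"
    and comp: "\<And>x y. x \<in> arr p \<Longrightarrow> y \<in> arr p \<Longrightarrow> src p y =
      tgt p x \<Longrightarrow>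
      y \<odot>[p] x \<in> arr p \<and> \<phi> (y \<odot>[p] x) = \<phi> y \<odot>[q] \<phi> x"
  shows "fibrewise_equivalence B p q \<lparr>fobj = (\<lambda>X. X), farr = \<phi>\<rparr>"
proof -
  interpret q: category_over B q by fact
  have \<phi> [simp]: "\<phi> x \<in> arr q" if "x \<in> arr p" for x
    using bij that by (auto simp: bij_betw_def)
  have inj: "x = y" if "\<phi> x = \<phi> y" "x \<in> arr p" "y \<in> arr p" for x y
    using bij that by (auto simp: bij_betw_def inj_on_def)
  have surj: "\<exists>x \<in> arr p. \<phi> x = z" if "z \<in> arr q" for z
    using bij that unfolding bij_betw_def by (metis imageE)
  have dcI: "src p (Ident (Tot p) X) = X" "tgt p (Ident (Tot p) X) = X" if "X \<in> ob p" for X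
    using dc(1)[of "Ident (Tot p) X"] dc(2)[of "Ident (Tot p) X"] ident[OF that] that Obj by auto
  have dcC: "src p (y \<odot>[p] x) = src p x" "tgt p (y \<odot>[p] x) = tgt p y"
    if "x \<in> arr p" "y \<in> arr p" "src p y = tgt p x" for x y
    using dc(1)[of "y \<odot>[p] x"] dc(2)[of "y \<odot>[p] x"] comp[OF that] that dc[of x] dc[of y] by auto
  have objs: "src p x \<in> ob p" "tgt p x \<in> ob p" if "x \<in> arr p" for x
    using q.total.Obj_Dom[OF \<phi>[OF that]] q.total.Obj_Cod[OF \<phi>[OF that]] dc[OF that] Obj by auto
  have cat: "category (Tot p)"
  proof
    fix f assume "f \<in> arr p"
    then show "src p f \<in> ob p" "tgt p f \<in> ob p" using objs by auto
  next
    fix a assume "a \<in> ob p"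
    then show "Ident (Tot p) a \<in> hom (Tot p) a a" using dcI ident by (auto simp: hom_def)
  next
    fix f a b g c assume "f \<in> hom (Tot p) a b" "g \<in> hom (Tot p) b c"
    then show "g \<odot>[p] f \<in> hom (Tot p) a c" using dcC[of f g] comp[of f g] by (auto simp: hom_def)
  next
    fix f a b assume f: "f \<in> hom (Tot p) a b"
    then have o: "a \<in> ob p" "b \<in> ob p" using objs by (auto simp: hom_def)
    show "Ident (Tot p) b \<odot>[p] f = f"
      using f o comp[of f "Ident (Tot p) b"] ident[OF o(2)] dcI[OF o(2)] dc[of f]
      by (intro inj) (auto simp: hom_def)
    show "f \<odot>[p] Ident (Tot p) a = f"
      using f o comp[of "Ident (Tot p) a" f] ident[OF o(1)] dcI[OF o(1)] dc[of f]
      by (intro inj) (auto simp: hom_def)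
  next
    fix f a b g c h d assume fgh: "f \<in> hom (Tot p) a b" "g \<in> hom (Tot p) b c" "h \<in> hom (Tot p) c d"
    show "(h \<odot>[p] g) \<odot>[p] f = h \<odot>[p] g \<odot>[p] f"
    proof (rule inj)
      show "\<phi> ((h \<odot>[p] g) \<odot>[p] f) = \<phi> (h \<odot>[p] g \<odot>[p] f)"
        "(h \<odot>[p] g) \<odot>[p] f \<in> arr p" "h \<odot>[p] g \<odot>[p] f \<in> arr p"
        using fgh comp[of f g] comp[of g h] comp[of f "h \<odot>[p] g"] comp[of "g \<odot>[p] f" h] dcC[of f g] dcC[of g h]
          dc[of f] dc[of g] dc[of h]
        by (auto simp: hom_def)
    qed
  qed
  have "category_over B p"
  proof (intro category_over.intro category_over_axioms.intro)
    show "category B" by (rule q.base.category_axioms)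
    show "is_functor (Tot p) B (proj p)"
      unfolding is_functor_def
    proof (intro conjI ballI impI)
      fix a assume a: "a \<in> ob p"
      then show "over_obj p a \<in> Obj B" using over(2)[of a] q.over_obj_closed[of a] Obj by simp
      show "over_arr p (Ident (Tot p) a) = Ident B (over_obj p a)"
        using a over(1)[of "Ident (Tot p) a"] over(2)[of a] ident[OF a] q.over_Ident[of a] Obj by simp
    next
      fix f assume f: "f \<in> arr p"
      then show "over_arr p f \<in> hom B (over_obj p (src p f)) (over_obj p (tgt p f))"
        using over(1)[OF f] over(2)[OF objs(1)[OF f]] over(2)[OF objs(2)[OF f]] q.over_Dom[of "\<phi> f"]  q.over_Cod[of "\<phi> f"]
          q.over_arr_closed[of "\<phi> f"] dc[OF f] \<phi>[OF f]
            by (simp add: hom_def del: q.over_Dom q.over_Cod q.over_arr_closed)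
    next
      fix f g assume f: "f \<in> arr p" "g \<in> arr p" "src p g = tgt p f"
      then show "over_arr p (g \<odot>[p] f) = over_arr p g \<cdot>[B] over_arr p f"
        using comp[OF f] over(1)[of f] over(1)[of g] over(1)[of "g \<odot>[p] f"] dc[of f] dc[of g] by simp
    qed
  qed (rule cat)
  then interpret p: category_over B p .
  show ?thesis
  proof
    show "is_functor (Tot p) (Tot q) \<lparr>fobj = (\<lambda>X. X), farr = \<phi>\<rparr>"
      unfolding is_functor_def using ident comp dc Obj by (auto simp: hom_def)
    fix X Y z assume "X \<in> ob p" "Y \<in> ob p" and z: "z \<in> arr q"
      "src q z = fobj \<lparr>fobj = (\<lambda>X. X), farr = \<phi>\<rparr> X" "tgt q z = fobj \<lparr>fobj =
        (\<lambda>X. X), farr = \<phi>\<rparr> Y"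
    then show "\<exists>x\<in>arr p. src p x = X \<and> tgt p x = Y \<and> farr \<lparr>fobj =
      (\<lambda>X. X), farr = \<phi>\<rparr> x = z"
      using surj[OF z(1)] dc by fastforce
  next
    fix x y assume "x \<in> arr p" "y \<in> arr p"
      "farr \<lparr>fobj = (\<lambda>X. X), farr = \<phi>\<rparr> x = farr \<lparr>fobj =
        (\<lambda>X. X), farr = \<phi>\<rparr> y"
    then show "x = y" by (intro inj) simp_all
  next
    fix Z assume "Z \<in> ob q"
    then show "\<exists>X\<in>ob p. \<exists>i j. over_iso B q (fobj \<lparr>fobj = (\<lambda>X. X), farr =
      \<phi>\<rparr> X) Z i j"
      using q.over_iso_Ident Obj unfolding ftr.simps by blast
  qed (auto simp: over)
qed

text \<open>An arrow from \<open>(g, \<alpha>)\<close> to \<open>(h, \<beta>)\<close> over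
  \<open>f0\<close> in the double opposite is a vertical arrow of the coproduct completion from the
  chosen reindexing of \<open>(h, \<beta>)\<close> along \<open>f0\<close> to
  \<open>(g, \<alpha>)\<close>; its component in \<open>opp B p\<close> is the triple
  \<open>(f1, \<alpha>, \<phi>)\<close>. The remaining entries are determined by
  \<open>m\<close>.\<close>

definition pi_opp :: "('ob, 'ab) cat \<Rightarrow> ('oe, 'ae, 'ob, 'ab) fib \<Rightarrow> ('oe, 'ae, 'ab) pi_arr \<Rightarrow>
   'ab \<times> ('ab \<times> 'oe) \<times> ('ab \<times> 'oe) \<times> ('ab \<times> 'oe) \<times> 'ab \<times> 'ab \<times> 'oe \<times> 'ae" where
  "pi_opp B p m = (pi_base m, pi_tgt m,
     (pb_fst B (pi_base m) (fst (pi_tgt m)), src p (lift p (pb_snd B (pi_base m) (fst (pi_tgt m))) (snd (pi_tgt m)))),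
     pi_src m, Ident B (Cod B (fst (pi_src m))), pi_map m, snd (pi_src m), pi_vert m)"

lemma product_completion_simps:
  "ob (product_completion B F p) = pi_objs B F p"
  "arr (product_completion B F p) = pi_arrs B F p"
  "src (product_completion B F p) = pi_src"
  "tgt (product_completion B F p) = pi_tgt"
  "Ident (Tot (product_completion B F p)) = pi_ident B p"
  "Comp (Tot (product_completion B F p)) = pi_comp B p"
  "over_obj (product_completion B F p) (g, \<alpha>) = Cod B g"
  "over_arr (product_completion B F p) = pi_base"
  by (simp_all add: product_completion_def)

context display_fibration
begin

lemma pi_objs_iff [simp]:
  "(g, \<alpha>) \<in> pi_objs B F p \<longleftrightarrow> g \<in> F \<and> \<alpha> \<in> ob p \<and>
    over_obj p \<alpha> = Dom B g"
  by (auto simp: pi_objs_def fibre_def)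

lemma pi_arrs_iff:
  "\<lparr>pi_src = (g, \<alpha>), pi_tgt = (h, \<beta>), pi_base = f0, pi_map = f1, pi_vert =
    \<phi>\<rparr> \<in> pi_arrs B F p \<longleftrightarrow>
     g \<in> F \<and> \<alpha> \<in> ob p \<and> over_obj p \<alpha> = Dom B g \<and> h \<in> F \<and>
       \<beta> \<in> ob p \<and> over_obj p \<beta> = Dom B h \<and>
     f0 \<in> Arr B \<and> Dom B f0 = Cod B g \<and> Cod B f0 = Cod B h \<and>
     f1 \<in> Arr B \<and> Dom B f1 = Dom B (pb_fst B f0 h) \<and> Cod B f1 = Dom B g \<and> g \<cdot>[B] f1 =
       pb_fst B f0 h \<and>
     \<phi> \<in> arr p \<and> over_arr p \<phi> = Ident B (Dom B (pb_fst B f0 h)) \<and>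
     src p \<phi> = src p (lift p f1 \<alpha>) \<and> tgt p \<phi> = src p (lift p (pb_snd B f0 h) \<beta>)"
  unfolding pi_arrs_def by (auto simp: hom_def fibre_def pb_obj_def)

abbreviation "\<Sigma> \<equiv> sigma B F (opp B p)"

lemma opp_display_fibration: "display_fibration B F (opp B p)"
  by (intro display_fibration.intro opp_cloven display_map_category_axioms)

text \<open>Over an identity, the square condition of the coproduct completion reads
  \<open>g f1 = pb_fst B f0 h\<close>, which is the requirement that \<open>f1\<close> is an arrow
  over the base object of the source. The other conditions are typing, or fix redundant
  entries.\<close>

lemma opp_sigma_arrs:
  "(f0, (h, \<beta>), s, (g, \<alpha>), i, f1, \<alpha>', \<phi>) \<in> arr (opp B \<Sigma>) \<longleftrightarrow>
     \<lparr>pi_src = (g, \<alpha>), pi_tgt = (h, \<beta>), pi_base = f0, pi_map = f1, pi_vert =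
       \<phi>\<rparr> \<in> pi_arrs B F p \<and>
     s = (pb_fst B f0 h, src p (lift p (pb_snd B f0 h) \<beta>)) \<and> i = Ident B (Cod B g) \<and>
       \<alpha>' = \<alpha>"
proof (cases s)
  case (Pair a \<gamma>)
  show ?thesis
  proof
    assume L: "(f0, (h, \<beta>), s, (g, \<alpha>), i, f1, \<alpha>', \<phi>) \<in> arr (opp B \<Sigma>)"
    then have o [simp]: "f0 \<in> Arr B" "h \<in> F" "\<beta> \<in> ob p" "over_obj p \<beta> = Dom B h"
      "Cod B f0 = Cod B h"
      and e: "(s, (g, \<alpha>), i, f1, \<alpha>', \<phi>) \<in> arr \<Sigma>"
      "s = src \<Sigma> (lift \<Sigma> f0 (h, \<beta>))" "i = Ident B (Dom B f0)"
      by (auto simp: opp_simps(2)[of _ _ _ B \<Sigma>] sigma_simps(3,7,8) sigma_simps(1) opp_simps(1)[of B p] opp_simps(7)[of B p])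
    have s: "s = (pb_fst B f0 h, src p (lift p (pb_snd B f0 h) \<beta>))"
      using e(2) by (simp add: sigma_simps opp_simps)
    show "\<lparr>pi_src = (g, \<alpha>), pi_tgt = (h, \<beta>), pi_base = f0, pi_map = f1, pi_vert =
      \<phi>\<rparr> \<in> pi_arrs B F p \<and>
     s = (pb_fst B f0 h, src p (lift p (pb_snd B f0 h) \<beta>)) \<and> i = Ident B (Cod B g) \<and>
       \<alpha>' = \<alpha>"
      using e(1,3) unfolding s sigma_simps pi_arrs_iff opp_simps
      by (auto dest: arg_cong[of "g \<cdot>[B] f1" _ "Dom B"])
  next
    assume R: "\<lparr>pi_src = (g, \<alpha>), pi_tgt = (h, \<beta>), pi_base = f0, pi_map = f1, pi_vert =
      \<phi>\<rparr> \<in> pi_arrs B F p \<and>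
     s = (pb_fst B f0 h, src p (lift p (pb_snd B f0 h) \<beta>)) \<and> i = Ident B (Cod B g) \<and>
       \<alpha>' = \<alpha>"
    then show "(f0, (h, \<beta>), s, (g, \<alpha>), i, f1, \<alpha>', \<phi>) \<in> arr (opp B \<Sigma>)"
      unfolding pi_arrs_iff by (auto simp: opp_simps sigma_simps)
  qed
qed

lemma pi_opp_mem: "pi_opp B p m \<in> arr (opp B \<Sigma>) \<longleftrightarrow> m \<in> pi_arrs B F p"
proof -
  obtain g \<alpha> h \<beta> f0 f1 \<phi> where "m = \<lparr>pi_src = (g, \<alpha>), pi_tgt =
    (h, \<beta>), pi_base = f0, pi_map = f1, pi_vert = \<phi>\<rparr>"
    by (metis pi_arr.surjective old.unit.exhaust surj_pair)
  then show ?thesis by (simp add: pi_opp_def opp_sigma_arrs)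
qed

lemma pi_opp_bij: "bij_betw (pi_opp B p) (pi_arrs B F p) (arr (opp B \<Sigma>))"
proof (rule bij_betwI')
  fix m n assume "m \<in> pi_arrs B F p" "n \<in> pi_arrs B F p"
  then show "(pi_opp B p m = pi_opp B p n) = (m = n)"
    by (cases m; cases n) (auto simp: pi_opp_def prod_eq_iff)
next
  fix m assume "m \<in> pi_arrs B F p"
  then show "pi_opp B p m \<in> arr (opp B \<Sigma>)" by (simp add: pi_opp_mem)
next
  fix z assume z: "z \<in> arr (opp B \<Sigma>)"
  moreover obtain f0 h \<beta> s g \<alpha> i f1 \<alpha>' \<phi> where zz: "z =
    (f0, (h, \<beta>), s, (g, \<alpha>), i, f1, \<alpha>', \<phi>)"
    by (metis surj_pair)
  ultimately show "\<exists>m\<in>pi_arrs B F p. z = pi_opp B p m"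
    by (intro bexI[of _ "\<lparr>pi_src = (g, \<alpha>), pi_tgt = (h, \<beta>), pi_base = f0, pi_map =
      f1, pi_vert = \<phi>\<rparr>"])
      (auto simp: pi_opp_def opp_sigma_arrs)
qed

text \<open>Composition in the outer opposite consists of a comparison of lifts, a reindexing of
  \<open>n\<close> along \<open>f0\<close> and a composition with \<open>m\<close>, all inside the
  coproduct completion. These produce in turn the arrows \<open>t\<close>, \<open>s\<close> and
  \<open>f1 s\<close> of \<open>pi_comp\<close>, with the canonical isomorphisms at the
  corresponding places.\<close>

lemma pi_opp_comp:
  assumes m: "m \<in> pi_arrs B F p" and n: "n \<in> pi_arrs B F p" and mn: "pi_src n = pi_tgt m"
  shows "pi_opp B p (pi_comp B p n m) = pi_opp B p n \<odot>[opp B \<Sigma>] pi_opp B p m"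
proof -
  interpret r: display_fibration B F "opp B p" by (rule opp_display_fibration)
  interpret s: cloven_fibration B \<Sigma> by (rule r.sigma_cloven)
  obtain g \<alpha> h \<beta> f0 f1 \<phi> where m_eq: "m = \<lparr>pi_src = (g, \<alpha>), pi_tgt =
    (h, \<beta>), pi_base = f0, pi_map = f1, pi_vert = \<phi>\<rparr>"
    by (metis pi_arr.surjective old.unit.exhaust surj_pair)
  obtain l \<gamma> k0 k1 \<psi> where n_eq: "n = \<lparr>pi_src = (h, \<beta>), pi_tgt =
    (l, \<gamma>), pi_base = k0, pi_map = k1, pi_vert = \<psi>\<rparr>"
    using mn m_eq by (metis pi_arr.surjective pi_arr.select_convs(1,2) old.unit.exhaust surj_pair)
  have [simp]: "g \<in> F" "\<alpha> \<in> ob p" "over_obj p \<alpha> = Dom B g" "h \<in> F"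
    "\<beta> \<in> ob p" "over_obj p \<beta> = Dom B h"
     "f0 \<in> Arr B" "Dom B f0 = Cod B g" "Cod B f0 = Cod B h"
     "f1 \<in> Arr B" "Dom B f1 = Dom B (pb_fst B f0 h)" "Cod B f1 = Dom B g" "g \<cdot>[B] f1 = pb_fst B f0 h"
     "\<phi> \<in> arr p" "over_arr p \<phi> = Ident B (Dom B (pb_fst B f0 h))"
     "src p \<phi> = src p (lift p f1 \<alpha>)" "tgt p \<phi> = src p (lift p (pb_snd B f0 h) \<beta>)"
    using m unfolding m_eq pi_arrs_iff by auto
  have [simp]: "l \<in> F" "\<gamma> \<in> ob p" "over_obj p \<gamma> = Dom B l"
     "k0 \<in> Arr B" "Dom B k0 = Cod B h" "Cod B k0 = Cod B l"
     "k1 \<in> Arr B" "Dom B k1 = Dom B (pb_fst B k0 l)" "Cod B k1 = Dom B h" "h \<cdot>[B] k1 = pb_fst B k0 l"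
     "\<psi> \<in> arr p" "over_arr p \<psi> = Ident B (Dom B (pb_fst B k0 l))"
     "src p \<psi> = src p (lift p k1 \<beta>)" "tgt p \<psi> = src p (lift p (pb_snd B k0 l) \<gamma>)"
    using n unfolding n_eq pi_arrs_iff by auto
  define c0 where "c0 = k0 \<cdot>[B] f0"
  define a where "a = pb_fst B c0 l"
  define b where "b = pb_snd B c0 l"
  define t where "t = pb_pair B k0 l (f0 \<cdot>[B] a) b"
  define s where "s = pb_pair B f0 h a (k1 \<cdot>[B] t)"
  have c0 [simp]: "c0 \<in> Arr B" "Dom B c0 = Cod B g" "Cod B c0 = Cod B l" by (simp_all add: c0_def)
  have ab: "a \<in> F" "a \<in> Arr B" "Cod B a = Cod B g" "b \<in> Arr B" "Dom B b = Dom B a" "Cod B b =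
    Dom B l"
    "l \<cdot>[B] b = c0 \<cdot>[B] a"
    unfolding a_def b_def by simp_all
  then have ab': "l \<cdot>[B] b = k0 \<cdot>[B] f0 \<cdot>[B] a" by (simp add: c0_def)
  note [simp] = ab(1-6) ab'
  have t [simp]: "t \<in> Arr B" "Dom B t = Dom B a" "Cod B t = Dom B (pb_fst B k0 l)"
    "pb_fst B k0 l \<cdot>[B] t = f0 \<cdot>[B] a" "pb_snd B k0 l \<cdot>[B] t = b"
    unfolding t_def by simp_all
  have "h \<cdot>[B] k1 \<cdot>[B] t = (h \<cdot>[B] k1) \<cdot>[B] t" by (rule Comp_assoc[symmetric]) simp_all
  then have [simp]: "h \<cdot>[B] k1 \<cdot>[B] t = f0 \<cdot>[B] a" by simp
  have s [simp]: "s \<in> Arr B" "Dom B s = Dom B a" "Cod B s = Dom B (pb_fst B f0 h)"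
    "pb_fst B f0 h \<cdot>[B] s = a" "pb_snd B f0 h \<cdot>[B] s = k1 \<cdot>[B] t"
    unfolding s_def by simp_all
  define i\<alpha> where "i\<alpha> = vfactor B p (lift p (f1 \<cdot>[B] s) \<alpha>) (lift2 B p f1 s \<alpha>)"
  define i\<beta> where "i\<beta> = vfactor B p (lift2 B p (pb_snd B f0 h) s \<beta>) (lift2 B p k1 t \<beta>)"
  define i\<gamma> where "i\<gamma> = vfactor B p (lift2 B p (pb_snd B k0 l) t \<gamma>) (lift p b \<gamma>)"
  define \<beta>' where "\<beta>' = src p (lift p (pb_snd B f0 h) \<beta>)"
  define \<gamma>' where "\<gamma>' = src p (lift p (pb_snd B k0 l) \<gamma>)"
  define b\<gamma> where "b\<gamma> = src p (lift p b \<gamma>)"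
  define e where "e = i\<gamma> \<odot>[p] farr (reindex B p t) \<psi> \<odot>[p] i\<beta>"
  have mem: "\<beta>' \<in> ob p" "over_obj p \<beta>' = Dom B (pb_fst B f0 h)" "\<gamma>' \<in> ob p"
    "over_obj p \<gamma>' = Dom B (pb_fst B k0 l)"
    "b\<gamma> \<in> ob p" "over_obj p b\<gamma> = Dom B a"
    by (simp_all add: \<beta>'_def \<gamma>'_def b\<gamma>_def)
  have i\<gamma>: "i\<gamma> \<in> arr p" "src p i\<gamma> = src p (lift p t \<gamma>')" "tgt p i\<gamma> =
    b\<gamma>"
    "over_arr p i\<gamma> = Ident B (Dom B a)"
    unfolding i\<gamma>_def \<gamma>'_def b\<gamma>_def by simp_all
  have i\<beta>: "i\<beta> \<in> arr p" "src p i\<beta> = src p (lift p s \<beta>')"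
    "tgt p i\<beta> = src p (lift p t (src p (lift p k1 \<beta>)))"
    "over_arr p i\<beta> = Ident B (Dom B a)"
    unfolding i\<beta>_def \<beta>'_def by simp_all
  have e: "e \<in> arr p" "src p e = src p (lift p s \<beta>')" "tgt p e = b\<gamma>"
    "over_arr p e = Ident B (Dom B a)"
    using i\<gamma> i\<beta> by (simp_all add: e_def \<gamma>'_def)
  \<comment> \<open>The candidate over \<open>t\<close> for comparing the chosen lift along
    \<open>k0 f0\<close> with the one along \<open>k0\<close>.\<close>
  have 1: "(pb_snd B k0 l, \<gamma>, Ident (Tot p) \<gamma>') \<odot>[opp B p] (t, \<gamma>', i\<gamma>) =
    (b, \<gamma>, Ident (Tot p) b\<gamma>)"
  proof -
    have "i\<gamma> \<odot>[p] vfactor B p (lift p b \<gamma>) (lift2 B p (pb_snd B k0 l) t \<gamma>) =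
      Ident (Tot p) b\<gamma>"
      unfolding i\<gamma>_def b\<gamma>_def by (subst vfactor_mult) (simp_all add: vfactor_self)
    then show ?thesis
      by (subst opp_Comp_eq) (simp_all add: \<gamma>'_def)
  qed
  \<comment> \<open>The candidate over \<open>s\<close> for the reindexing of \<open>n\<close> along
    \<open>f0\<close>. In the defining equation, \<open>i\<beta>\<close> cancels against the
    comparison on the left by the cocycle rule.\<close>
  have 2: "(pb_snd B f0 h, \<beta>, Ident (Tot p) \<beta>') \<odot>[opp B p] (s, \<beta>', e) =
     (k1, \<beta>, \<psi>) \<odot>[opp B p] (t, \<gamma>', i\<gamma>)"
  proof -
    have c: "vfactor B p (lift p (k1 \<cdot>[B] t) \<beta>) (lift2 B p (pb_snd B f0 h) s \<beta>) \<in> arr p"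
      "src p (vfactor B p (lift p (k1 \<cdot>[B] t) \<beta>) (lift2 B p (pb_snd B f0 h) s \<beta>)) =
        src p (lift p (k1 \<cdot>[B] t) \<beta>)"
      "tgt p (vfactor B p (lift p (k1 \<cdot>[B] t) \<beta>) (lift2 B p (pb_snd B f0 h) s \<beta>)) =
        src p (lift p s \<beta>')"
      by (simp_all add: \<beta>'_def)
    have *: "i\<beta> \<odot>[p] vfactor B p (lift p (k1 \<cdot>[B] t) \<beta>) (lift2 B p (pb_snd B f0 h) s \<beta>) =
      vfactor B p (lift p (k1 \<cdot>[B] t) \<beta>) (lift2 B p k1 t \<beta>)"
      unfolding i\<beta>_def by (rule vfactor_mult) simp_all
    have "e \<odot>[p] vfactor B p (lift p (k1 \<cdot>[B] t) \<beta>) (lift2 B p (pb_snd B f0 h) s \<beta>) =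
       i\<gamma> \<odot>[p] farr (reindex B p t) \<psi> \<odot>[p] vfactor B p (lift p (k1 \<cdot>[B] t) \<beta>) (lift2 B p k1 t \<beta>)"
      unfolding e_def using i\<gamma> i\<beta> c by (simp add: * \<gamma>'_def)
    moreover have "e \<odot>[p] farr (reindex B p s) (Ident (Tot p) \<beta>') \<odot>[p]
       vfactor B p (lift p (k1 \<cdot>[B] t) \<beta>) (lift2 B p (pb_snd B f0 h) s \<beta>) =
       e \<odot>[p] vfactor B p (lift p (k1 \<cdot>[B] t) \<beta>) (lift2 B p (pb_snd B f0 h) s \<beta>)"
      using mem c by simp
    ultimately show ?thesis
      by (subst opp_Comp_eq; (subst opp_Comp_eq)?; simp add: mem \<beta>'_def[symmetric] \<gamma>'_def[symmetric])
  qed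
  \<comment> \<open>Composing with the component of \<open>m\<close> yields the five-fold composite
    of \<open>pi_comp\<close>.\<close>
  have 3: "(f1, \<alpha>, \<phi>) \<odot>[opp B p] (s, \<beta>', e) =
    (f1 \<cdot>[B] s, \<alpha>, i\<gamma> \<odot>[p] farr (reindex B p t) \<psi> \<odot>[p] i\<beta>
       \<odot>[p] farr (reindex B p s) \<phi> \<odot>[p] i\<alpha>)"
  proof -
    have "i\<alpha> \<in> arr p" "tgt p i\<alpha> = src p (lift p s (src p (lift p f1 \<alpha>)))"
      unfolding i\<alpha>_def by simp_all
    then show ?thesis
      using i\<gamma> i\<beta>
        by (subst opp_Comp_eq) (simp_all add: \<beta>'_def \<gamma>'_def e_def i\<alpha>_def[symmetric])
  qed
  have lifts: "lift \<Sigma> f0 (h, \<beta>) =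
    ((pb_fst B f0 h, \<beta>'), (h, \<beta>), f0, (pb_snd B f0 h, \<beta>, Ident (Tot p) \<beta>'))"
    "lift \<Sigma> k0 (l, \<gamma>) =
      ((pb_fst B k0 l, \<gamma>'), (l, \<gamma>), k0, (pb_snd B k0 l, \<gamma>, Ident (Tot p) \<gamma>'))"
    "lift \<Sigma> c0 (l, \<gamma>) =
      ((a, b\<gamma>), (l, \<gamma>), c0, (b, \<gamma>, Ident (Tot p) b\<gamma>))"
    by (simp_all add: sigma_simps opp_simps \<beta>'_def \<gamma>'_def b\<gamma>_def a_def b_def)
  have 4: "cfactor \<Sigma> (lift \<Sigma> k0 (l, \<gamma>)) (lift \<Sigma> c0 (l, \<gamma>)) f0 =
    ((a, b\<gamma>), (pb_fst B k0 l, \<gamma>'), f0, (t, \<gamma>', i\<gamma>))"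
  proof (rule s.cfactor_eqI)
    show "cartesian B \<Sigma> (lift \<Sigma> k0 (l, \<gamma>))"
      by (rule s.lift_simps) (simp_all add: sigma_simps opp_simps)
    show "lift \<Sigma> k0 (l, \<gamma>) \<odot>[\<Sigma>] ((a, b\<gamma>), (pb_fst B k0 l, \<gamma>'), f0, (t, \<gamma>', i\<gamma>)) = lift \<Sigma> c0 (l, \<gamma>)"
      unfolding lifts unfolding sigma_simps 1 c0_def ..
    show "((a, b\<gamma>), (pb_fst B k0 l, \<gamma>'), f0, (t, \<gamma>', i\<gamma>)) \<in> arr \<Sigma>"
      unfolding sigma_simps opp_simps using mem i\<gamma> by simp
  qed (simp_all add: lifts sigma_simps(3,4,8))
  have 5: "cfactor \<Sigma> (lift \<Sigma> f0 (h, \<beta>)) (((pb_fst B k0 l, \<gamma>'), (h, \<beta>), Ident B (Cod B h), (k1, \<beta>, \<psi>)) \<odot>[\<Sigma>]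
     ((a, b\<gamma>), (pb_fst B k0 l, \<gamma>'), f0, (t, \<gamma>', i\<gamma>))) (Ident B (Dom B f0)) =
     ((a, b\<gamma>), (pb_fst B f0 h, \<beta>'), Ident B (Dom B f0), (s, \<beta>', e))"
  proof (rule s.cfactor_eqI)
    show "cartesian B \<Sigma> (lift \<Sigma> f0 (h, \<beta>))"
      by (rule s.lift_simps) (simp_all add: sigma_simps opp_simps)
    show "lift \<Sigma> f0 (h, \<beta>) \<odot>[\<Sigma>] ((a, b\<gamma>), (pb_fst B f0 h, \<beta>'), Ident B (Dom B f0), (s, \<beta>', e)) =
      ((pb_fst B k0 l, \<gamma>'), (h, \<beta>), Ident B (Cod B h), (k1, \<beta>, \<psi>)) \<odot>[\<Sigma>] ((a, b\<gamma>), (pb_fst B k0 l, \<gamma>'), f0, (t, \<gamma>', i\<gamma>))"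
      unfolding lifts unfolding sigma_simps 2 by simp
    show "((a, b\<gamma>), (pb_fst B f0 h, \<beta>'), Ident B (Dom B f0), (s, \<beta>', e)) \<in> arr \<Sigma>"
      unfolding sigma_simps opp_simps using mem e by simp
  qed (simp_all add: lifts sigma_simps(3,4,8))
  have pm: "pi_opp B p m =
    (f0, (h, \<beta>), (pb_fst B f0 h, \<beta>'), (g, \<alpha>), Ident B (Cod B g), f1, \<alpha>, \<phi>)"
    and pn: "pi_opp B p n =
      (k0, (l, \<gamma>), (pb_fst B k0 l, \<gamma>'), (h, \<beta>), Ident B (Cod B h), k1, \<beta>, \<psi>)"
    by (simp_all add: pi_opp_def m_eq n_eq \<beta>'_def \<gamma>'_def)
  have pc: "pi_comp B p n m = \<lparr>pi_src = (g, \<alpha>), pi_tgt = (l, \<gamma>), pi_base = c0, pi_map =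
    f1 \<cdot>[B] s,
     pi_vert = i\<gamma> \<odot>[p] farr (reindex B p t) \<psi> \<odot>[p] i\<beta> \<odot>[p] farr (reindex B p s) \<phi> \<odot>[p] i\<alpha>\<rparr>"
    unfolding pi_comp_def m_eq n_eq Let_def pi_arr.select_convs fst_conv snd_conv
      c0_def[symmetric] a_def[symmetric] b_def[symmetric] t_def[symmetric] s_def[symmetric]
      i\<alpha>_def[symmetric] i\<beta>_def[symmetric] i\<gamma>_def[symmetric] ..
  show ?thesis
    unfolding pm pn opp_simps(6)[of B \<Sigma>] c0_def[symmetric] 4 5 pc
    unfolding sigma_simps 3 pi_opp_def pi_arr.select_convs fst_conv snd_conv a_def[symmetric] b_def[symmetric] b\<gamma>_def[symmetric]
    by simp
qed

lemma pi_opp_ident: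
  assumes "(g, \<alpha>) \<in> pi_objs B F p"
  shows "pi_ident B p (g, \<alpha>) \<in> pi_arrs B F p"
    "pi_opp B p (pi_ident B p (g, \<alpha>)) = Ident (Tot (opp B \<Sigma>)) (g, \<alpha>)"
proof -
  have [simp]: "g \<in> F" "\<alpha> \<in> ob p" "over_obj p \<alpha> = Dom B g" using assms by auto
  show "pi_ident B p (g, \<alpha>) \<in> pi_arrs B F p"
    unfolding pi_ident_def Let_def prod.case pi_arrs_iff by simp
  show "pi_opp B p (pi_ident B p (g, \<alpha>)) = Ident (Tot (opp B \<Sigma>)) (g, \<alpha>)"
    by (simp add: pi_ident_def Let_def pi_opp_def sigma_simps opp_simps)
qed

lemma product_completion_equivalence:
  "fibrewise_equivalence B (product_completion B F p) (opp B \<Sigma>) \<lparr>fobj = (\<lambda>X. X), farr =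
    pi_opp B p\<rparr>"
proof (rule fibrewise_equivalence_if_bij; (unfold product_completion_simps)?)
  interpret r: display_fibration B F "opp B p" by (rule opp_display_fibration)
  interpret s: cloven_fibration B \<Sigma> by (rule r.sigma_cloven)
  interpret os: cloven_fibration B "opp B \<Sigma>" by (rule s.opp_cloven)
  show "category_over B (opp B \<Sigma>)" by (rule os.category_over_axioms)
  show "pi_objs B F p = ob (opp B \<Sigma>)"
    by (auto simp: opp_simps(1)[of B \<Sigma>] sigma_simps opp_simps(1,7)[of B p])
  show bij: "bij_betw (pi_opp B p) (pi_arrs B F p) (arr (opp B \<Sigma>))" by (rule pi_opp_bij)
  have dc: "src (opp B \<Sigma>) (pi_opp B p x) = pi_src x" "tgt (opp B \<Sigma>) (pi_opp B p x) = pi_tgt x"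
    "over_arr (opp B \<Sigma>) (pi_opp B p x) = pi_base x" for x
    by (simp_all add: pi_opp_def opp_simps sigma_simps)
  fix x assume x: "x \<in> pi_arrs B F p"
  show "src (opp B \<Sigma>) (pi_opp B p x) = pi_src x" "tgt (opp B \<Sigma>) (pi_opp B p x) = pi_tgt x"
    "over_arr (opp B \<Sigma>) (pi_opp B p x) = pi_base x"
    by (rule dc)+
  fix y assume y: "y \<in> pi_arrs B F p" and xy: "pi_src y = pi_tgt x"
  \<comment> \<open>That the composite is an arrow of the completion at all is read off from the
    double opposite, through \<open>pi_opp_mem\<close>.\<close>
  have "pi_opp B p y \<odot>[opp B \<Sigma>] pi_opp B p x \<in> arr (opp B \<Sigma>)"
    using x y xy by (intro os.total.Comp_simps) (simp_all add: pi_opp_mem dc)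
  then show "pi_comp B p y x \<in> pi_arrs B F p \<and>
    pi_opp B p (pi_comp B p y x) = pi_opp B p y \<odot>[opp B \<Sigma>] pi_opp B p x"
    using pi_opp_comp[OF x y xy] by (simp flip: pi_opp_mem)
next
  fix X assume "X \<in> pi_objs B F p"
  then show "over_obj (opp B \<Sigma>) X = over_obj (product_completion B F p) X"
    "pi_ident B p X \<in> pi_arrs B F p \<and> pi_opp B p (pi_ident B p X) = Ident (Tot (opp B \<Sigma>)) X"
    using pi_opp_ident by (cases X; auto simp: opp_simps(7)[of B \<Sigma>] sigma_simps(7) product_completion_simps(7))+
qed

end

section \<open>Opcartesian arrows and splitting objects\<close>

definition opcartesian :: "('ob, 'ab) cat \<Rightarrow> ('oe, 'ae, 'ob, 'ab) fib \<Rightarrow> 'ae \<Rightarrow> bool" where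
  "opcartesian B p x \<longleftrightarrow> x \<in> arr p \<and>
     (\<forall>z \<in> arr p. \<forall>w \<in> Arr B. src p z = src p x \<and> Dom B w =
       Cod B (over_arr p x) \<and>
        w \<cdot>[B] over_arr p x = over_arr p z \<longrightarrow>
        (\<exists>!k. k \<in> hom (Tot p) (tgt p x) (tgt p z) \<and> over_arr p k = w \<and> k \<odot>[p] x =
          z))"

definition ofactor :: "('oe, 'ae, 'ob, 'ab) fib \<Rightarrow> 'ae \<Rightarrow> 'ae \<Rightarrow> 'ab \<Rightarrow> 'ae" where
  "ofactor p x z w = (THE k. k \<in> hom (Tot p) (tgt p x) (tgt p z) \<and> over_arr p k = w \<and>
    k \<odot>[p] x = z)"

text \<open>No section is mentioned: projecting \<open>x k = h\<close> with \<open>h\<close>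
  vertical forces the base arrow of \<open>k\<close> to be a section of that of \<open>x\<close>.
  Ranging over all opcartesian arrows keeps the notion independent of a choice of
  coproducts.\<close>

definition splits :: "('ob, 'ab) cat \<Rightarrow> 'ab set \<Rightarrow> ('oe, 'ae, 'ob, 'ab) fib \<Rightarrow> 'oe \<Rightarrow> bool" where
  "splits B F p \<alpha> \<longleftrightarrow> \<alpha> \<in> ob p \<and>
     (\<forall>x. opcartesian B p x \<longrightarrow> over_arr p x \<in> F \<longrightarrow>
       (\<forall>h \<in> hom (Tot p) \<alpha> (tgt p x). over_arr p h =
         Ident B (over_obj p \<alpha>) \<longrightarrow>
         (\<exists>!k. k \<in> hom (Tot p) \<alpha> (src p x) \<and> x \<odot>[p] k = h)))"

text \<open>Ranging over all cartesian arrows into \<open>\<alpha>\<close> makes stability under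
  reindexing immediate, because cartesian arrows compose.\<close>

definition coproduct_free :: "('ob, 'ab) cat \<Rightarrow> 'ab set \<Rightarrow> ('oe, 'ae, 'ob, 'ab) fib \<Rightarrow> 'oe \<Rightarrow> bool" where
  "coproduct_free B F p \<alpha> \<longleftrightarrow> \<alpha> \<in> ob p \<and>
     (\<forall>c. cartesian B p c \<longrightarrow> tgt p c =
       \<alpha> \<longrightarrow> splits B F p (src p c))"

lemma ex_ex1_cong: "(\<And>k. P k \<longleftrightarrow> Q k) \<Longrightarrow>
  (\<exists>!k. P k) \<longleftrightarrow> (\<exists>!k. Q k)"
  by simp

context category_over
begin

lemma opcartesian_Arr: "opcartesian B p x \<Longrightarrow> x \<in> arr p"
  by (simp add: opcartesian_def)

lemma opcartesian_ex1:
  assumes "opcartesian B p x" "z \<in> arr p" "w \<in> Arr B" "src p z = src p x"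
    "Dom B w = Cod B (over_arr p x)" "w \<cdot>[B] over_arr p x = over_arr p z"
  shows "\<exists>!k. k \<in> hom (Tot p) (tgt p x) (tgt p z) \<and> over_arr p k = w \<and> k \<odot>[p] x = z"
  using assms unfolding opcartesian_def by blast

lemma ofactor_simps [simp]:
  assumes "opcartesian B p x" "z \<in> arr p" "w \<in> Arr B" "src p z = src p x"
    "Dom B w = Cod B (over_arr p x)" "w \<cdot>[B] over_arr p x = over_arr p z"
  shows "ofactor p x z w \<in> arr p" "src p (ofactor p x z w) = tgt p x"
    "tgt p (ofactor p x z w) = tgt p z" "over_arr p (ofactor p x z w) = w"
    "ofactor p x z w \<odot>[p] x = z"
  using theI'[OF opcartesian_ex1[OF assms]] unfolding ofactor_def[symmetric] by (auto simp: hom_def)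

lemma opcartesian_eqI:
  assumes "opcartesian B p x" "k \<in> arr p" "l \<in> arr p" "src p k = tgt p x"
    "src p l = tgt p x" "tgt p k = tgt p l" "over_arr p k = over_arr p l"
    "k \<odot>[p] x = l \<odot>[p] x"
  shows "k = l"
proof -
  note x = opcartesian_Arr[OF assms(1)]
  have "Dom B (over_arr p l) = Cod B (over_arr p x)"
    using assms x by (intro base_composable) simp_all
  then have "\<exists>!m. m \<in> hom (Tot p) (tgt p x) (tgt p (l \<odot>[p] x)) \<and> over_arr p m =
    over_arr p l \<and>
      m \<odot>[p] x = l \<odot>[p] x"
    using assms x by (intro opcartesian_ex1) simp_all
  moreover have "k \<in> hom (Tot p) (tgt p x) (tgt p (l \<odot>[p] x))"
    "l \<in> hom (Tot p) (tgt p x) (tgt p (l \<odot>[p] x))"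
    using assms x by (simp_all add: hom_def)
  ultimately show ?thesis using assms(7,8) by blast
qed

lemma ofactor_eqI:
  assumes "opcartesian B p x" "k \<in> arr p" "src p k = tgt p x"
    "over_arr p k = w" "k \<odot>[p] x = z"
  shows "ofactor p x z w = k"
proof -
  note x = opcartesian_Arr[OF assms(1)]
  have b: "Dom B (over_arr p k) = Cod B (over_arr p x)"
    using assms(2,3) x by (intro base_composable) simp_all
  have "ofactor p x (k \<odot>[p] x) (over_arr p k) = k"
    by (rule opcartesian_eqI[OF assms(1)]) (use assms(1-3) x b in simp_all)
  with assms(4,5) show ?thesis by simp
qed

lemma opcartesianI:
  assumes "x \<in> arr p"
    and ex: "\<And>z w. z \<in> arr p \<Longrightarrow> w \<in> Arr B \<Longrightarrow> src p z =
      src p x \<Longrightarrow>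
      Dom B w = Cod B (over_arr p x) \<Longrightarrow> w \<cdot>[B] over_arr p x =
        over_arr p z \<Longrightarrow>
      \<exists>k. k \<in> arr p \<and> src p k = tgt p x \<and> tgt p k = tgt p z \<and>
        over_arr p k = w \<and> k \<odot>[p] x = z"
    and eq: "\<And>k l. k \<in> arr p \<Longrightarrow> l \<in> arr p \<Longrightarrow> src p k =
      tgt p x \<Longrightarrow>
      src p l = tgt p x \<Longrightarrow> tgt p k = tgt p l \<Longrightarrow>
      over_arr p k = over_arr p l \<Longrightarrow> k \<odot>[p] x = l \<odot>[p] x \<Longrightarrow> k = l"
  shows "opcartesian B p x"
  unfolding opcartesian_def
proof (intro conjI ballI impI)
  fix z w
  assume z: "z \<in> arr p" and w: "w \<in> Arr B"
    and c: "src p z = src p x \<and> Dom B w = Cod B (over_arr p x) \<and> w \<cdot>[B] over_arr p x =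
      over_arr p z"
  have "\<exists>k. k \<in> arr p \<and> src p k = tgt p x \<and> tgt p k = tgt p z \<and>
        over_arr p k = w \<and> k \<odot>[p] x = z"
    using z w c by (intro ex) auto
  then show "\<exists>!k. k \<in> hom (Tot p) (tgt p x) (tgt p z) \<and> over_arr p k = w \<and>
    k \<odot>[p] x = z"
    using eq by (auto simp: hom_def)
qed (fact assms(1))

text \<open>Each of the two arrows factors through the other over an identity. The equation
  \<open>i x = y\<close> is kept because factorizations are transported along it.\<close>

lemma opcartesian_over_iso:
  assumes "opcartesian B p x" "opcartesian B p y" "src p x = src p y" "over_arr p x = over_arr p y"
  obtains i j where "over_iso B p (tgt p x) (tgt p y) i j" "i \<odot>[p] x = y"
proof -
  note [simp] = opcartesian_Arr[OF assms(1)] opcartesian_Arr[OF assms(2)] assms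
  let ?A = "Cod B (over_arr p y)"
  let ?i = "ofactor p x y (Ident B ?A)" and ?j = "ofactor p y x (Ident B ?A)"
  have s: "?i \<in> arr p" "src p ?i = tgt p x" "tgt p ?i = tgt p y"
    "over_arr p ?i = Ident B ?A" "?i \<odot>[p] x = y"
    "?j \<in> arr p" "src p ?j = tgt p y" "tgt p ?j = tgt p x"
    "over_arr p ?j = Ident B ?A" "?j \<odot>[p] y = x"
    by simp_all
  have "?j \<odot>[p] ?i = Ident (Tot p) (tgt p x)"
    by (rule opcartesian_eqI[OF assms(1)]) (use s in simp_all)
  moreover have "?i \<odot>[p] ?j = Ident (Tot p) (tgt p y)"
    by (rule opcartesian_eqI[OF assms(2)]) (use s in simp_all)
  ultimately have "over_iso B p (tgt p x) (tgt p y) ?i ?j"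
    using s by (simp add: over_iso_def hom_def)
  then show thesis using s(5) by (rule that)
qed

lemma opcartesian_Comp_iso:
  assumes x: "opcartesian B p x" and ij: "over_iso B p (tgt p x) Y i j"
  shows "opcartesian B p (i \<odot>[p] x)"
proof (rule opcartesianI)
  note [simp] = opcartesian_Arr[OF x]
  have oi [simp]: "over_arr p i = Ident B (Cod B (over_arr p x))" "over_arr p j =
    Ident B (Cod B (over_arr p x))"
    using over_isoD(7,8)[OF ij] by simp_all
  note [simp] = over_isoD(1-6,9,10)[OF ij]
  show "i \<odot>[p] x \<in> arr p" by simp
  { fix z w assume [simp]: "z \<in> arr p" "w \<in> Arr B" and z: "src p z = src p (i \<odot>[p] x)"
      "Dom B w = Cod B (over_arr p (i \<odot>[p] x))" "w \<cdot>[B] over_arr p (i \<odot>[p] x) = over_arr p z"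
    have [simp]: "src p z = src p x" "Dom B w = Cod B (over_arr p x)" "w \<cdot>[B] over_arr p x = over_arr p z"
      using z by simp_all
    have "j \<odot>[p] i \<odot>[p] x = x" by (rule over_iso_cancel[OF ij]) simp_all
    then show "\<exists>k. k \<in> arr p \<and> src p k = tgt p (i \<odot>[p] x) \<and> tgt p k = tgt p z \<and>
        over_arr p k = w \<and> k \<odot>[p] i \<odot>[p] x = z"
      by (intro exI[of _ "ofactor p x z w \<odot>[p] j"]) (simp add: x) }
  fix k l assume [simp]: "k \<in> arr p" "l \<in> arr p" and d: "src p k = tgt p (i \<odot>[p] x)"
     "src p l = tgt p (i \<odot>[p] x)" and c [simp]: "tgt p k = tgt p l"
     and o: "over_arr p k = over_arr p l" and eq: "k \<odot>[p] i \<odot>[p] x = l \<odot>[p] i \<odot>[p] x"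
  have [simp]: "src p k = Y" "src p l = Y" using d by simp_all
  have [simp]: "Dom B (over_arr p l) = Cod B (over_arr p x)"
    using base_composable[of i l] by simp
  have "k \<odot>[p] i = l \<odot>[p] i"
    by (rule opcartesian_eqI[OF x]) (simp_all add: o eq)
  then have "(k \<odot>[p] i) \<odot>[p] j = (l \<odot>[p] i) \<odot>[p] j" by simp
  then show "k = l" by simp
qed

lemma splitsD:
  assumes "splits B F p \<alpha>" "opcartesian B p x" "over_arr p x \<in> F" "h \<in> arr p" "src p h =
    \<alpha>"
    "tgt p h = tgt p x" "over_arr p h = Ident B (over_obj p \<alpha>)"
  shows "\<exists>!k. k \<in> hom (Tot p) \<alpha> (src p x) \<and> x \<odot>[p] k = h"
  using assms unfolding splits_def hom_def by blast

text \<open>Any opcartesian arrow over \<open>u\<close> out of \<open>\<beta>\<close> differs from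
  the tested one by a vertical isomorphism at its target, along which the factorization problem can
  be moved.\<close>

lemma splitsI:
  assumes \<alpha>: "\<alpha> \<in> ob p"
    and ex: "\<And>u \<beta>. u \<in> F \<Longrightarrow> \<beta> \<in> ob p \<Longrightarrow>
      over_obj p \<beta> = Dom B u \<Longrightarrow> Cod B u = over_obj p \<alpha> \<Longrightarrow>
      \<exists>x. opcartesian B p x \<and> over_arr p x = u \<and> src p x = \<beta> \<and>
        (\<forall>h \<in> hom (Tot p) \<alpha> (tgt p x). over_arr p h =
          Ident B (over_obj p \<alpha>) \<longrightarrow>
         (\<exists>!k. k \<in> hom (Tot p) \<alpha> \<beta> \<and> x \<odot>[p] k = h))"
  shows "splits B F p \<alpha>"
  unfolding splits_def
proof (intro conjI allI ballI impI)
  fix y h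
  assume y: "opcartesian B p y" and F: "over_arr p y \<in> F" and h: "h \<in> hom (Tot p) \<alpha> (tgt p y)"
    and oh: "over_arr p h = Ident B (over_obj p \<alpha>)"
  note [simp] = opcartesian_Arr[OF y] \<alpha>
  have hs [simp]: "h \<in> arr p" "src p h = \<alpha>" "tgt p h = tgt p y" using h by (auto simp: hom_def)
  have c: "Cod B (over_arr p y) = over_obj p \<alpha>"
    using over_Cod[of h] oh by simp
  obtain x where x: "opcartesian B p x" "over_arr p x = over_arr p y" "src p x = src p y"
    and sp: "\<And>h. h \<in> hom (Tot p) \<alpha> (tgt p x) \<Longrightarrow> over_arr p h =
      Ident B (over_obj p \<alpha>) \<Longrightarrow>
         \<exists>!k. k \<in> hom (Tot p) \<alpha> (src p y) \<and> x \<odot>[p] k = h"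
    using ex[OF F, of "src p y"] c by auto
  obtain i j where ij: "over_iso B p (tgt p x) (tgt p y) i j" and ix: "i \<odot>[p] x = y"
    using opcartesian_over_iso[OF x(1) y x(3,2)] .
  note [simp] = opcartesian_Arr[OF x(1)] x(2,3)
  have oi: "over_arr p j = Ident B (over_obj p \<alpha>)"
    using over_isoD(7,8)[OF ij] c by simp
  note [simp] = over_isoD(1-6)[OF ij]
  have "j \<odot>[p] h \<in> hom (Tot p) \<alpha> (tgt p x)" "over_arr p (j \<odot>[p] h) =
    Ident B (over_obj p \<alpha>)"
    using oi oh by (simp_all add: hom_def)
  then have e: "\<exists>!k. k \<in> hom (Tot p) \<alpha> (src p y) \<and> x \<odot>[p] k = j \<odot>[p] h"
    by (rule sp)
  have iff: "y \<odot>[p] k = h \<longleftrightarrow> x \<odot>[p] k =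
    j \<odot>[p] h" if "k \<in> hom (Tot p) \<alpha> (src p y)" for k
  proof -
    have k [simp]: "k \<in> arr p" "tgt p k = src p y" using that by (auto simp: hom_def)
    have "(i \<odot>[p] x) \<odot>[p] k = i \<odot>[p] x \<odot>[p] k"
      by (rule total.Comp_assoc) simp_all
    then have "y \<odot>[p] k = i \<odot>[p] x \<odot>[p] k" by (simp only: ix)
    moreover have "j \<odot>[p] i \<odot>[p] x \<odot>[p] k = x \<odot>[p] k" "i \<odot>[p] j \<odot>[p] h = h"
      by (rule over_iso_cancel[OF ij]; simp)+
    ultimately show ?thesis by metis
  qed
  show "\<exists>!k. k \<in> hom (Tot p) \<alpha> (src p y) \<and> y \<odot>[p] k = h"
    using e by (rule iffD1[OF ex_ex1_cong, rotated]) (use iff in blast)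
qed (fact \<alpha>)

lemma splits_over_iso:
  assumes s: "splits B F p \<alpha>" and ij: "over_iso B p \<alpha> \<alpha>' i j"
  shows "splits B F p \<alpha>'"
  unfolding splits_def
proof (intro conjI allI ballI impI)
  have a' [simp]: "over_obj p \<alpha>' = over_obj p \<alpha>" by (rule over_isoD(13)[OF ij])
  note [simp] = over_isoD(1-12)[OF ij]
  show "\<alpha>' \<in> ob p" by simp
  fix x h assume x: "opcartesian B p x" and F: "over_arr p x \<in> F" and h: "h \<in> hom (Tot p) \<alpha>' (tgt p x)"
    and oh: "over_arr p h = Ident B (over_obj p \<alpha>')"
  note [simp] = opcartesian_Arr[OF x]
  have hs [simp]: "h \<in> arr p" "src p h = \<alpha>'" "tgt p h = tgt p x" using h by (auto simp: hom_def)
  have "\<exists>!k. k \<in> hom (Tot p) \<alpha> (src p x) \<and> x \<odot>[p] k = h \<odot>[p] i"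
    using oh by (intro splitsD[OF s x F]) simp_all
  then obtain k where k: "k \<in> hom (Tot p) \<alpha> (src p x)" "x \<odot>[p] k = h \<odot>[p] i"
    and uniq: "\<And>l. l \<in> hom (Tot p) \<alpha> (src p x) \<Longrightarrow> x \<odot>[p] l =
      h \<odot>[p] i \<Longrightarrow> l = k"
    by metis
  have ks [simp]: "k \<in> arr p" "src p k = \<alpha>" "tgt p k = src p x" using k by (auto simp: hom_def)
  show "\<exists>!k. k \<in> hom (Tot p) \<alpha>' (src p x) \<and> x \<odot>[p] k = h"
  proof (rule ex1I[of _ "k \<odot>[p] j"])
    have "x \<odot>[p] k \<odot>[p] j = (x \<odot>[p] k) \<odot>[p] j"
      by (rule total.Comp_assoc[symmetric]) simp_all
    then show "k \<odot>[p] j \<in> hom (Tot p) \<alpha>' (src p x) \<and> x \<odot>[p] k \<odot>[p] j = h"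
      by (simp add: hom_def k(2))
  next
    fix l assume l: "l \<in> hom (Tot p) \<alpha>' (src p x) \<and> x \<odot>[p] l = h"
    then have ls [simp]: "l \<in> arr p" "src p l = \<alpha>'" "tgt p l = src p x" by (auto simp: hom_def)
    have "x \<odot>[p] l \<odot>[p] i = (x \<odot>[p] l) \<odot>[p] i"
      by (rule total.Comp_assoc[symmetric]) simp_all
    then have "l \<odot>[p] i = k" using l by (intro uniq) (simp_all add: hom_def)
    then have "(l \<odot>[p] i) \<odot>[p] j = k \<odot>[p] j" by simp
    then show "l = k \<odot>[p] j" by simp
  qed
qed

lemma cartesian_over_iso_arrow:
  assumes "over_iso B p X Y i j"
  shows "cartesian B p i"
proof (rule cartesianI)
  note [simp] = over_isoD(1-12)[OF assms]
  show "i \<in> arr p" by simp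
  { fix z w assume [simp]: "z \<in> arr p" and z: "tgt p z = tgt p i" and w [simp]: "w \<in> Arr B"
     "Dom B w = Dom B (over_arr p z)" "Cod B w = Dom B (over_arr p i)" "over_arr p i \<cdot>[B] w =
       over_arr p z"
    have [simp]: "over_obj p X = Cod B (over_arr p z)"
      using over_Cod[of z] z over_isoD(13)[OF assms] by simp
    have "w = over_arr p z" using w by simp
    then show "\<exists>k. k \<in> arr p \<and> src p k = src p z \<and> tgt p k = src p i \<and>
        over_arr p k = w \<and> i \<odot>[p] k = z"
      using z over_iso_cancel(2)[OF assms, of z] by (intro exI[of _ "j \<odot>[p] z"]) simp }
  fix k l assume [simp]: "k \<in> arr p" "l \<in> arr p" and c: "tgt p k = src p i" "tgt p l = src p i"
    and eq: "i \<odot>[p] k = i \<odot>[p] l"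
  have "j \<odot>[p] i \<odot>[p] k = k" "j \<odot>[p] i \<odot>[p] l = l"
    using c by (simp_all add: over_iso_cancel(1)[OF assms])
  then show "k = l" using eq by metis
qed

text \<open>\<open>\<alpha>\<close> is the source of its own identity, which is cartesian.\<close>

lemma coproduct_free_splits:
  assumes "coproduct_free B F p \<alpha>"
  shows "splits B F p \<alpha>"
proof -
  have "\<alpha> \<in> ob p" using assms by (simp add: coproduct_free_def)
  then show ?thesis
    using assms cartesian_over_iso_arrow[OF over_iso_Ident[of \<alpha>]] unfolding coproduct_free_def
    by (metis total.Ident_simps(2,3))
qed

end

context cloven_fibration
begin

text \<open>Any other cartesian arrow over \<open>f\<close> into \<open>\<alpha>\<close> has a
  vertically isomorphic source, and splitting is invariant under such isomorphisms.\<close>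

lemma coproduct_freeI:
  assumes "\<alpha> \<in> ob p"
    and "\<And>f. f \<in> Arr B \<Longrightarrow> Cod B f = over_obj p \<alpha> \<Longrightarrow>
      \<exists>c. cartesian B p c \<and> tgt p c = \<alpha> \<and> over_arr p c = f \<and>
        splits B F p (src p c)"
  shows "coproduct_free B F p \<alpha>"
  unfolding coproduct_free_def
proof (intro conjI allI impI)
  fix d assume d: "cartesian B p d" "tgt p d = \<alpha>"
  note [simp] = cartesian_Arr[OF d(1)]
  obtain c where c: "cartesian B p c" "tgt p c = \<alpha>" "over_arr p c = over_arr p d"
    "splits B F p (src p c)"
    using assms(2)[of "over_arr p d"] d over_Cod[of d] by auto
  show "splits B F p (src p d)"
    using cartesian_over_iso[OF d(1) c(1) _ _ refl] c d by (intro splits_over_iso[OF c(4)]) auto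
qed (fact assms(1))

text \<open>In a fibration, a test arrow over \<open>w\<close> after the base arrow of
  \<open>x\<close> factors through the cartesian lift of \<open>w\<close>, and what remains has the
  same base arrow as \<open>x\<close>. So it is enough to extend arrows of the latter kind by
  vertical ones, which is the form that an adjunction provides.\<close>

lemma opcartesian_if_vertical:
  assumes x [simp]: "x \<in> arr p"
    and ex: "\<And>z. z \<in> arr p \<Longrightarrow> src p z = src p x \<Longrightarrow> over_arr p z =
      over_arr p x \<Longrightarrow>
      \<exists>k. k \<in> arr p \<and> src p k = tgt p x \<and> tgt p k = tgt p z \<and>
        over_arr p k = Ident B (Cod B (over_arr p x)) \<and> k \<odot>[p] x = z"
    and eq: "\<And>k l. k \<in> arr p \<Longrightarrow> l \<in> arr p \<Longrightarrow> src p k =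
      tgt p x \<Longrightarrow>
      src p l = tgt p x \<Longrightarrow> tgt p k = tgt p l \<Longrightarrow>
      over_arr p k = Ident B (Cod B (over_arr p x)) \<Longrightarrow> over_arr p l =
        Ident B (Cod B (over_arr p x)) \<Longrightarrow>
      k \<odot>[p] x = l \<odot>[p] x \<Longrightarrow> k = l"
  shows "opcartesian B p x"
proof (rule opcartesianI)
  fix z w assume [simp]: "z \<in> arr p" "w \<in> Arr B" "src p z = src p x"
      "Dom B w = Cod B (over_arr p x)" "w \<cdot>[B] over_arr p x = over_arr p z"
  have "Cod B (w \<cdot>[B] over_arr p x) = Cod B w" by (rule base.Comp_simps) simp_all
  then have [simp]: "Cod B (over_arr p z) = Cod B w" by simp
  let ?c = "lift p w (tgt p z)"
  let ?z = "cfactor p ?c z (over_arr p x)"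
  have "Dom B (over_arr p x) = Dom B (over_arr p z)" using over_Dom[of x] over_Dom[of z] by simp
  then have z: "?z \<in> arr p" "src p ?z = src p x" "over_arr p ?z = over_arr p x"
    "tgt p ?z = src p ?c" "?c \<odot>[p] ?z = z"
    by simp_all
  obtain k where [simp]: "k \<in> arr p" "src p k = tgt p x" "tgt p k = src p ?c"
     "over_arr p k = Ident B (Cod B (over_arr p x))" and k: "k \<odot>[p] x = ?z"
    using ex[of ?z] z by auto
  show "\<exists>k. k \<in> arr p \<and> src p k = tgt p x \<and> tgt p k = tgt p z \<and>
        over_arr p k = w \<and> k \<odot>[p] x = z"
    by (rule exI[of _ "?c \<odot>[p] k"]) (simp add: k z(5) del: cfactor_simps)
next
  fix k l assume [simp]: "k \<in> arr p" "l \<in> arr p" "src p k = tgt p x" "src p l = tgt p x"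
    "tgt p k = tgt p l" and o [simp]: "over_arr p k = over_arr p l" and kl: "k \<odot>[p] x = l \<odot>[p] x"
  have [simp]: "Dom B (over_arr p l) = Cod B (over_arr p x)" by (rule base_composable) simp_all
  let ?c = "lift p (over_arr p l) (tgt p l)" and ?i = "Ident B (Cod B (over_arr p x))"
  have s: "cfactor p ?c k ?i \<in> arr p" "src p (cfactor p ?c k ?i) = tgt p x"
    "tgt p (cfactor p ?c k ?i) = src p ?c" "over_arr p (cfactor p ?c k ?i) = ?i"
    "?c \<odot>[p] cfactor p ?c k ?i = k"
    "cfactor p ?c l ?i \<in> arr p" "src p (cfactor p ?c l ?i) = tgt p x"
    "tgt p (cfactor p ?c l ?i) = src p ?c" "over_arr p (cfactor p ?c l ?i) = ?i"
    "?c \<odot>[p] cfactor p ?c l ?i = l"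
    by simp_all
  have "cfactor p ?c k ?i \<odot>[p] x = cfactor p ?c l ?i \<odot>[p] x"
    by (rule cartesian_eqI[of ?c]) (simp_all add: kl)
  then have "cfactor p ?c k ?i = cfactor p ?c l ?i" by (rule eq[rotated -1]) (use s in simp_all)
  then show "k = l" using s(5,10) by metis
qed (fact x)

end

text \<open>As for cartesian arrows, except that the test arrow is moved into the image of
  \<open>G\<close> at its target instead of its source.\<close>

lemma (in fibrewise_equivalence) preserves_opcartesian:
  assumes x: "opcartesian B p x"
  shows "opcartesian B q (farr G x)"
proof (rule q.opcartesianI)
  note [simp] = p.opcartesian_Arr[OF x]
  show "farr G x \<in> arr q" by simp
  { fix z w
    assume z [simp]: "z \<in> arr q" and w [simp]: "w \<in> Arr B" and dz [simp]: "src q z = src q (farr G x)"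
      and "Dom B w = Cod B (over_arr q (farr G x))" "w \<cdot>[B] over_arr q (farr G x) = over_arr q z"
    then have [simp]: "Dom B w = Cod B (over_arr p x)" and wx: "w \<cdot>[B] over_arr p x =
      over_arr q z" by simp_all
    obtain X i j where X [simp]: "X \<in> ob p" and ij: "over_iso B q (fobj G X) (tgt q z) i j"
      using eso[of "tgt q z"] by auto
    have "over_obj p X = Cod B (over_arr q z)"
      using q.over_isoD(13)[OF ij] by simp
    also have "\<dots> = Cod B w" unfolding wx[symmetric] by simp
    finally have oX [simp]: "over_obj p X = Cod B w" .
    note [simp] = q.over_isoD(1-10)[OF ij] q.over_iso_cancel[OF ij]
    have [simp]: "Cod B (over_arr q z) = Cod B w" unfolding wx[symmetric] by simp
    obtain z' where z' [simp]: "z' \<in> arr p" "src p z' = src p x" "tgt p z' = X"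
      "farr G z' = j \<odot>[q] z"
      using full[of "src p x" X "j \<odot>[q] z"] by auto
    have "over_arr p z' = over_arr q (farr G z')" by (rule G_over_arr[symmetric]) simp
    then have oz': "over_arr p z' = over_arr q z" by (simp del: G_over_arr)
    let ?k = "ofactor p x z' w"
    have k [simp]: "?k \<in> arr p" "src p ?k = tgt p x" "tgt p ?k = X"
      "over_arr p ?k = w" "?k \<odot>[p] x = z'"
      using x oz' wx by simp_all
    have "farr G ?k \<odot>[q] farr G x = farr G (?k \<odot>[p] x)"
      by (subst G_simps) (simp_all del: k(5))
    then have "farr G ?k \<odot>[q] farr G x = j \<odot>[q] z" by simp
    then show "\<exists>k. k \<in> arr q \<and> src q k = tgt q (farr G x) \<and> tgt q k = tgt q z \<and>
        over_arr q k = w \<and> k \<odot>[q] farr G x = z"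
      by (intro exI[of _ "i \<odot>[q] farr G ?k"]) simp }
  fix k l
  assume k [simp]: "k \<in> arr q" "l \<in> arr q" "src q k = tgt q (farr G x)"
      "src q l = tgt q (farr G x)" "tgt q k = tgt q l"
    and eq: "over_arr q k = over_arr q l" "k \<odot>[q] farr G x = l \<odot>[q] farr G x"
  obtain X i j where X [simp]: "X \<in> ob p" and ij: "over_iso B q (fobj G X) (tgt q l) i j"
    using eso[of "tgt q l"] by auto
  note [simp] = q.over_isoD[OF ij]
  obtain k' where k' [simp]: "k' \<in> arr p" "src p k' = tgt p x" "tgt p k' = X"
    "farr G k' = j \<odot>[q] k"
    using full[of "tgt p x" X "j \<odot>[q] k"] by auto
  obtain l' where l' [simp]: "l' \<in> arr p" "src p l' = tgt p x" "tgt p l' = X"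
    "farr G l' = j \<odot>[q] l"
    using full[of "tgt p x" X "j \<odot>[q] l"] by auto
  have "over_arr p k' = over_arr q (j \<odot>[q] k)" "over_arr p l' = over_arr q (j \<odot>[q] l)"
    by (metis k' l' G_over_arr)+
  then have o: "over_arr p k' = over_arr p l'" using eq(1) by simp
  have "farr G (k' \<odot>[p] x) = farr G (l' \<odot>[p] x)"
    by (simp add: eq(2))
  then have "k' \<odot>[p] x = l' \<odot>[p] x"
    by (rule faithful[rotated -1]) simp_all
  then have "k' = l'" by (rule p.opcartesian_eqI[OF x, rotated -1]) (simp_all add: o)
  then have "j \<odot>[q] k = j \<odot>[q] l" using k'(4) l'(4) by simp
  then have "i \<odot>[q] j \<odot>[q] k = i \<odot>[q] j \<odot>[q] l" by simp
  then show "k = l" using q.over_iso_cancel(2)[OF ij, of k] q.over_iso_cancel(2)[OF ij, of l] by simp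
qed

text \<open>A relation comparing operations on the carriers of \<open>q\<close> only. The opposite
  of a restriction forms composites by factorizations in the smaller category, and agreement with
  the larger opposite is claimed just for composable arrows of the carrier.\<close>

definition full_subfibration :: "('oe, 'ae, 'ob, 'ab) fib \<Rightarrow> ('oe, 'ae, 'ob, 'ab) fib \<Rightarrow> ('oe \<Rightarrow> bool) \<Rightarrow> bool" where
  "full_subfibration q p S \<longleftrightarrow>
     ob q = {X \<in> ob p. S X} \<and>
     arr q = {x \<in> arr p. S (src p x) \<and> S (tgt p x)} \<and>
     (\<forall>X \<in> ob q. over_obj q X = over_obj p X \<and> Ident (Tot q) X = Ident (Tot p) X) \<and>
     (\<forall>x \<in> arr q. src q x = src p x \<and> tgt q x = tgt p x \<and> over_arr q x =
       over_arr p x) \<and>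
     (\<forall>x \<in> arr q. \<forall>y \<in> arr q. src q y = tgt q x \<longrightarrow> y \<odot>[q] x =
       y \<odot>[p] x)"

text \<open>\<open>\<iota> u \<beta> : \<beta> \<rightarrow> \<Sigma>\<^sub>u\<beta>\<close> is the
  opcartesian arrow into a chosen coproduct. Beck-Chevalley is imposed on the chosen pullback
  squares: the arrow into \<open>j\<^sup>*\<Sigma>\<^sub>h\<beta>\<close> that
  \<open>\<iota> h \<beta>\<close> induces on the reindexing of \<open>\<beta>\<close> is again
  opcartesian.\<close>

locale coproduct_fibration = display_fibration B F p
  for B :: "('ob, 'ab) cat" and F :: "'ab set" and p :: "('oe, 'ae, 'ob, 'ab) fib" +
  fixes \<iota> :: "'ab \<Rightarrow> 'oe \<Rightarrow> 'ae"
  assumes \<iota>_opcartesian [simp]: "u \<in> F \<Longrightarrow> \<beta> \<in> ob p \<Longrightarrow>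
    over_obj p \<beta> = Dom B u \<Longrightarrow> opcartesian B p (\<iota> u \<beta>)"
    and \<iota>_Dom [simp]: "u \<in> F \<Longrightarrow> \<beta> \<in> ob p \<Longrightarrow>
      over_obj p \<beta> = Dom B u \<Longrightarrow> src p (\<iota> u \<beta>) = \<beta>"
    and \<iota>_over [simp]: "u \<in> F \<Longrightarrow> \<beta> \<in> ob p \<Longrightarrow>
      over_obj p \<beta> = Dom B u \<Longrightarrow> over_arr p (\<iota> u \<beta>) = u"
    and beck_chevalley: "h \<in> F \<Longrightarrow> \<beta> \<in> ob p \<Longrightarrow> over_obj p \<beta> =
      Dom B h \<Longrightarrow> j \<in> Arr B \<Longrightarrow> Cod B j = Cod B h \<Longrightarrow>
      opcartesian B p (cfactor p (lift p j (tgt p (\<iota> h \<beta>))) (\<iota> h \<beta> \<odot>[p] lift p (pb_snd B j h) \<beta>) (pb_fst B j h))"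
begin

lemma \<iota>_Arr [simp]: "u \<in> F \<Longrightarrow> \<beta> \<in> ob p \<Longrightarrow>
  over_obj p \<beta> = Dom B u \<Longrightarrow> \<iota> u \<beta> \<in> arr p"
  by (rule opcartesian_Arr) simp

lemma splits_iff:
  "splits B F p \<alpha> \<longleftrightarrow> \<alpha> \<in> ob p \<and>
     (\<forall>u \<in> F. Cod B u =
       over_obj p \<alpha> \<longrightarrow> (\<forall>\<beta> \<in> ob p. over_obj p \<beta> =
       Dom B u \<longrightarrow>
       (\<forall>h \<in> hom (Tot p) \<alpha> (tgt p (\<iota> u \<beta>)). over_arr p h =
         Ident B (Cod B u) \<longrightarrow>
         (\<exists>!k. k \<in> hom (Tot p) \<alpha> \<beta> \<and> \<iota> u \<beta> \<odot>[p] k =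
           h))))" (is "?L \<longleftrightarrow> ?R")
proof
  assume ?L
  then show ?R unfolding splits_def by (metis \<iota>_opcartesian \<iota>_Dom \<iota>_over)
next
  assume R: ?R
  then show ?L
    by (intro splitsI) (metis \<iota>_opcartesian \<iota>_Dom \<iota>_over)+
qed

text \<open>Splitting speaks of vertical arrows, whereas \<open>y\<close> may lie over any
  \<open>j\<close>. Factoring \<open>y\<close> through the cartesian
  \<open>j\<^sup>*\<Sigma>\<^sub>h\<beta> \<rightarrow> \<Sigma>\<^sub>h\<beta>\<close> makes it
  vertical, and by Beck-Chevalley its new target is the target of an opcartesian arrow over a
  display map.\<close>

lemma coproduct_free_factor:
  assumes free: "coproduct_free B F p \<alpha>" and h [simp]: "h \<in> F" and \<beta> [simp]: "\<beta> \<in> ob p" "over_obj p \<beta> = Dom B h"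
  shows "y \<in> arr p \<Longrightarrow> src p y = \<alpha> \<Longrightarrow> tgt p y =
    tgt p (\<iota> h \<beta>) \<Longrightarrow>
      \<exists>\<phi>. \<phi> \<in> arr p \<and> src p \<phi> = \<alpha> \<and> tgt p \<phi> = \<beta> \<and>
        \<iota> h \<beta> \<odot>[p] \<phi> = y"
    and "\<phi> \<in> arr p \<Longrightarrow> src p \<phi> = \<alpha> \<Longrightarrow> tgt p \<phi> =
      \<beta> \<Longrightarrow>
      \<psi> \<in> arr p \<Longrightarrow> src p \<psi> = \<alpha> \<Longrightarrow> tgt p \<psi> =
        \<beta> \<Longrightarrow>
      \<iota> h \<beta> \<odot>[p] \<phi> = \<iota> h \<beta> \<odot>[p] \<psi> \<Longrightarrow> \<phi> =
        \<psi>"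
proof -
  have \<alpha> [simp]: "\<alpha> \<in> ob p" using free by (simp add: coproduct_free_def)
  let ?Z = "tgt p (\<iota> h \<beta>)" and ?A = "over_obj p \<alpha>"
  \<comment> \<open>For each base arrow \<open>j\<close>, \<open>c j\<close> and \<open>d j\<close>
    are the cartesian lifts on the two sides of the pullback square, and \<open>i j\<close> is the
    opcartesian comparison between their sources.\<close>
  define c where "c = (\<lambda>j. lift p j ?Z)"
  define d where "d = (\<lambda>j. lift p (pb_snd B j h) \<beta>)"
  define i where "i = (\<lambda>j. cfactor p (c j) (\<iota> h \<beta> \<odot>[p] d j) (pb_fst B j h))"
  have [simp]: "cartesian B p (c j)" "c j \<in> arr p" "tgt p (c j) = ?Z" "over_arr p (c j) = j"
    "cartesian B p (d j)" "d j \<in> arr p" "tgt p (d j) = \<beta>" "over_arr p (d j) = pb_snd B j h"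
    if "j \<in> Arr B" "Cod B j = Cod B h" for j
    using that by (simp_all add: c_def d_def)
  have i [simp]: "opcartesian B p (i j)" "i j \<in> arr p" "src p (i j) = src p (d j)"
    "tgt p (i j) = src p (c j)" "over_arr p (i j) = pb_fst B j h" "c j \<odot>[p] i j =
      \<iota> h \<beta> \<odot>[p] d j"
    if "j \<in> Arr B" "Cod B j = Cod B h" for j
    using that beck_chevalley[OF h \<beta> that] by (simp_all add: i_def) (simp_all add: c_def d_def)
  have ci: "c j \<odot>[p] i j \<odot>[p] k = \<iota> h \<beta> \<odot>[p] d j \<odot>[p] k"
    if "j \<in> Arr B" "Cod B j = Cod B h" "k \<in> arr p" "tgt p k = src p (d j)" for j k
  proof -
    have "c j \<odot>[p] i j \<odot>[p] k = (c j \<odot>[p] i j) \<odot>[p] k"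
      using that by (intro total.Comp_assoc[symmetric]) simp_all
    then show ?thesis using that by simp
  qed
  have sp: "\<exists>!k. k \<in> hom (Tot p) \<alpha> (src p (d (over_arr p y))) \<and>
    i (over_arr p y) \<odot>[p] k =
      cfactor p (c (over_arr p y)) y (Ident B ?A)"
    if y: "y \<in> arr p" "src p y = \<alpha>" "tgt p y = ?Z" for y
  proof -
    have [simp]: "Cod B (over_arr p y) = Cod B h" using over_Cod[of y] y by simp
    have [simp]: "Dom B (over_arr p y) = ?A" using over_Dom[of y] y by simp
    show ?thesis
      using splitsD[OF coproduct_free_splits[OF free], of "i (over_arr p y)"
        "cfactor p (c (over_arr p y)) y (Ident B ?A)"] y
      by simp
  qed
  show "\<exists>\<phi>. \<phi> \<in> arr p \<and> src p \<phi> = \<alpha> \<and> tgt p \<phi> = \<beta> \<and>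
    \<iota> h \<beta> \<odot>[p] \<phi> = y"
    if y: "y \<in> arr p" "src p y = \<alpha>" "tgt p y = ?Z"
  proof -
    have [simp]: "Cod B (over_arr p y) = Cod B h" using over_Cod[of y] y by simp
    have [simp]: "Dom B (over_arr p y) = ?A" using over_Dom[of y] y by simp
    obtain k where k: "k \<in> arr p" "src p k = \<alpha>" "tgt p k = src p (d (over_arr p y))"
      "i (over_arr p y) \<odot>[p] k = cfactor p (c (over_arr p y)) y (Ident B ?A)"
      using sp[OF y] by (auto simp: hom_def)
    have "\<iota> h \<beta> \<odot>[p] d (over_arr p y) \<odot>[p] k =
      c (over_arr p y) \<odot>[p] i (over_arr p y) \<odot>[p] k"
      using k y by (intro ci[symmetric]) simp_all
    also have "\<dots> = y" unfolding k(4) using y by simp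
    finally show ?thesis
      using k y by (intro exI[of _ "d (over_arr p y) \<odot>[p] k"]) simp
  qed
  show "\<phi> = \<psi>"
    if \<phi>: "\<phi> \<in> arr p" "src p \<phi> = \<alpha>" "tgt p \<phi> = \<beta>"
      and \<psi>: "\<psi> \<in> arr p" "src p \<psi> = \<alpha>" "tgt p \<psi> = \<beta>"
      and eq: "\<iota> h \<beta> \<odot>[p] \<phi> = \<iota> h \<beta> \<odot>[p] \<psi>"
  proof -
    define y where "y = \<iota> h \<beta> \<odot>[p] \<psi>"
    have y: "y \<in> arr p" "src p y = \<alpha>" "tgt p y = ?Z" using \<psi> by (simp_all add: y_def)
    let ?j = "over_arr p y"
    have [simp]: "Cod B ?j = Cod B h" using over_Cod[of y] y by simp
    have [simp]: "Dom B ?j = ?A" using over_Dom[of y] y by simp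
    \<comment> \<open>Uniqueness is reduced to that of \<open>k\<close>: every factorization
      \<open>\<chi>\<close> of \<open>y\<close> arises from some \<open>k\<close>, which lies over
      the arrow into the pullback with components the identity and
      \<open>over_arr p \<chi>\<close>.\<close>
    have ex: "\<exists>k. k \<in> hom (Tot p) \<alpha> (src p (d ?j)) \<and> i ?j \<odot>[p] k =
      cfactor p (c ?j) y (Ident B ?A) \<and>
       d ?j \<odot>[p] k = \<chi>"
      if \<chi> [simp]: "\<chi> \<in> arr p" "src p \<chi> = \<alpha>" "tgt p \<chi> =
        \<beta>" and y\<chi>: "\<iota> h \<beta> \<odot>[p] \<chi> = y" for \<chi>
    proof -
      let ?x = "over_arr p \<chi>"
      have [simp]: "Cod B ?x = Dom B h" using over_Cod[of \<chi>] by simp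
      have [simp]: "Dom B ?x = ?A" using over_Dom[of \<chi>] by simp
      have [simp]: "h \<cdot>[B] ?x = ?j" unfolding y\<chi>[symmetric] by simp
      let ?s = "pb_pair B ?j h (Ident B ?A) ?x"
      have s: "?s \<in> Arr B" "Dom B ?s = ?A" "Cod B ?s = Dom B (pb_fst B ?j h)"
        "pb_fst B ?j h \<cdot>[B] ?s = Ident B ?A"
        "pb_snd B ?j h \<cdot>[B] ?s = ?x"
        using y by simp_all
      let ?k = "cfactor p (d ?j) \<chi> ?s"
      have k: "?k \<in> arr p" "src p ?k = \<alpha>" "tgt p ?k = src p (d ?j)" "over_arr p ?k = ?s"
        "d ?j \<odot>[p] ?k = \<chi>"
        using y s by simp_all
      have "cfactor p (c ?j) y (Ident B ?A) = i ?j \<odot>[p] ?k"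
      proof (rule cfactor_eqI)
        show "c ?j \<odot>[p] i ?j \<odot>[p] ?k = y"
          using ci[of ?j ?k] k y y\<chi> by simp
      qed (use k(1-4) s y in simp_all)
      then show ?thesis using k by (intro exI[of _ ?k]) (simp add: hom_def)
    qed
    obtain k where k: "k \<in> hom (Tot p) \<alpha> (src p (d ?j))" "i ?j \<odot>[p] k =
      cfactor p (c ?j) y (Ident B ?A)" "d ?j \<odot>[p] k = \<phi>"
      using ex[OF \<phi>] eq by (auto simp: y_def)
    obtain l where l: "l \<in> hom (Tot p) \<alpha> (src p (d ?j))" "i ?j \<odot>[p] l =
      cfactor p (c ?j) y (Ident B ?A)" "d ?j \<odot>[p] l = \<psi>"
      using ex[OF \<psi>] by (auto simp: y_def)
    have "k = l" using sp[OF y] k(1,2) l(1,2) by blast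
    then show "\<phi> = \<psi>" using k(3) l(3) by simp
  qed
qed

lemma sigma_equivalence_if_enough:
  assumes q: "cloven_fibration B q" and sub: "full_subfibration q p (coproduct_free B F p)"
    and enough: "\<And>\<alpha>. \<alpha> \<in> ob p \<Longrightarrow>
      \<exists>u \<in> F. \<exists>\<beta> \<in> ob p. over_obj p \<beta> = Dom B u \<and>
      coproduct_free B F p \<beta> \<and>
      (\<exists>i j. over_iso B p (tgt p (\<iota> u \<beta>)) \<alpha> i j)"
  shows "\<exists>G. fibrewise_equivalence B (sigma B F q) p G"
proof -
  interpret q: display_fibration B F q
    by (intro display_fibration.intro q display_map_category_axioms)
  interpret s: category_over B "sigma B F q" by (rule q.sigma_category_over)
  have qO: "X \<in> ob q \<longleftrightarrow> X \<in> ob p \<and> coproduct_free B F p X" for X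
    using sub by (auto simp: full_subfibration_def)
  have qA: "x \<in> arr q \<longleftrightarrow> x \<in> arr p \<and> coproduct_free B F p (src p x) \<and>
    coproduct_free B F p (tgt p x)" for x
    using sub by (auto simp: full_subfibration_def)
  have qs: "x \<in> arr q \<Longrightarrow> src q x = src p x" "x \<in> arr q \<Longrightarrow> tgt q x =
    tgt p x"
    "x \<in> arr q \<Longrightarrow> over_arr q x = over_arr p x" 
    "X \<in> ob q \<Longrightarrow> over_obj q X = over_obj p X" "X \<in> ob q \<Longrightarrow>
      Ident (Tot q) X = Ident (Tot p) X" 
    "x \<in> arr q \<Longrightarrow> y \<in> arr q \<Longrightarrow> src q y = tgt q x \<Longrightarrow>
      y \<odot>[q] x = y \<odot>[p] x" for x y X
    using sub unfolding full_subfibration_def by blast+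
  have obj: "(g, \<alpha>) \<in> ob (sigma B F q) \<longleftrightarrow> g \<in> F \<and>
    \<alpha> \<in> ob p \<and> coproduct_free B F p \<alpha> \<and> over_obj p \<alpha> =
    Dom B g" for g \<alpha>
    by (auto simp: sigma_simps qO qs)
  have arr: "((g, \<alpha>), (h, \<beta>), f, \<phi>) \<in> arr (sigma B F q) \<longleftrightarrow>
    g \<in> F \<and> h \<in> F \<and> \<alpha> \<in> ob p \<and> \<beta> \<in> ob p \<and>
     coproduct_free B F p \<alpha> \<and> coproduct_free B F p \<beta> \<and> over_obj p \<alpha> =
       Dom B g \<and>
     over_obj p \<beta> = Dom B h \<and> f \<in> Arr B \<and> Dom B f = Cod B g \<and> Cod B f = Cod B h \<and>
     \<phi> \<in> arr p \<and> src p \<phi> = \<alpha> \<and> tgt p \<phi> = \<beta> \<and>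
       h \<cdot>[B] over_arr p \<phi> = f \<cdot>[B] g" (is "?L \<longleftrightarrow>
       ?R") for g \<alpha> h \<beta> f \<phi>
  proof
    assume ?L
    then have L: "g \<in> F \<and> h \<in> F \<and> over_obj q \<alpha> = Dom B g \<and> over_obj q \<beta> =
      Dom B h \<and> f \<in> Arr B \<and> Dom B f = Cod B g \<and> Cod B f = Cod B h \<and>
       \<phi> \<in> arr q \<and> src q \<phi> = \<alpha> \<and> tgt q \<phi> = \<beta> \<and>
         h \<cdot>[B] over_arr q \<phi> = f \<cdot>[B] g"
      unfolding sigma_simps .
    then have "\<alpha> \<in> ob q" "\<beta> \<in> ob q" by auto
    then show ?R using L qs(1-3)[of \<phi>] qs(4)[of \<alpha>] qs(4)[of \<beta>] qO qA[of \<phi>] by simp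
  next
    assume R: ?R
    then have "\<phi> \<in> arr q" "\<alpha> \<in> ob q" "\<beta> \<in> ob q" using qA qO by auto
    then show ?L using R qs(1-3)[of \<phi>] qs(4)[of \<alpha>] qs(4)[of \<beta>] unfolding sigma_simps by simp
  qed
  \<comment> \<open>On arrows, \<open>G\<close> extends \<open>\<iota> h \<beta>\<close> after
    \<open>\<phi>\<close> along the opcartesian \<open>\<iota> g \<alpha>\<close>. The square
    condition on \<open>\<phi>\<close> is the compatibility of base arrows that this extension
    requires.\<close>
  define G where "G = \<lparr>fobj = (\<lambda>(g, \<alpha>). tgt p (\<iota> g \<alpha>)),
    farr = (\<lambda>((g, \<alpha>), (h, \<beta>), f, \<phi>). ofactor p (\<iota> g \<alpha>) (\<iota> h \<beta> \<odot>[p] \<phi>) f)\<rparr>"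
  have Go: "fobj G (g, \<alpha>) = tgt p (\<iota> g \<alpha>)" for g \<alpha> by (simp add: G_def)
  have Ga: "farr G ((g, \<alpha>), (h, \<beta>), f, \<phi>) =
    ofactor p (\<iota> g \<alpha>) (\<iota> h \<beta> \<odot>[p] \<phi>) f" for g \<alpha> h \<beta> f \<phi>
    by (simp add: G_def)
  have GA: "farr G ((g, \<alpha>), (h, \<beta>), f, \<phi>) \<in> arr p"
    "src p (farr G ((g, \<alpha>), (h, \<beta>), f, \<phi>)) = tgt p (\<iota> g \<alpha>)"
     "tgt p (farr G ((g, \<alpha>), (h, \<beta>), f, \<phi>)) = tgt p (\<iota> h \<beta>)"
     "over_arr p (farr G ((g, \<alpha>), (h, \<beta>), f, \<phi>)) = f"
     "farr G ((g, \<alpha>), (h, \<beta>), f, \<phi>) \<odot>[p] \<iota> g \<alpha> =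
       \<iota> h \<beta> \<odot>[p] \<phi>"
    if "((g, \<alpha>), (h, \<beta>), f, \<phi>) \<in> arr (sigma B F q)" for g \<alpha> h \<beta> f \<phi>
    using that unfolding arr Ga by simp_all
  have "fibrewise_equivalence B (sigma B F q) p G"
  proof
    show "is_functor (Tot (sigma B F q)) (Tot p) G"
      unfolding is_functor_def
    proof (intro conjI ballI impI)
      fix a assume a: "a \<in> ob (sigma B F q)"
      obtain g \<alpha> where ga: "a = (g, \<alpha>)" by (cases a)
      have [simp]: "g \<in> F" "\<alpha> \<in> ob p" "over_obj p \<alpha> = Dom B g" and "\<alpha> \<in> ob q"
        using a unfolding ga obj qO by auto
      then have [simp]: "Ident (Tot q) \<alpha> = Ident (Tot p) \<alpha>" by (simp add: qs)
      show "fobj G a \<in> ob p" by (simp add: ga Go)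
      show "farr G (Ident (Tot (sigma B F q)) a) = Ident (Tot p) (fobj G a)"
        unfolding ga sigma_simps Go Ga by (rule ofactor_eqI) simp_all
    next
      fix f assume f: "f \<in> arr (sigma B F q)"
      obtain g \<alpha> h \<beta> f0 \<phi> where fe: "f = ((g, \<alpha>), (h, \<beta>), f0, \<phi>)"
        by (metis surj_pair)
      show "farr G f \<in> hom (Tot p) (fobj G (src (sigma B F q) f)) (fobj G (tgt (sigma B F q) f))"
        using GA f unfolding fe sigma_simps(3,4) Go hom_def by simp
    next
      fix f k assume f: "f \<in> arr (sigma B F q)" and k: "k \<in> arr (sigma B F q)"
        and kf: "src (sigma B F q) k = tgt (sigma B F q) f"
      obtain g \<alpha> h \<beta> f0 \<phi> where fe: "f = ((g, \<alpha>), (h, \<beta>), f0, \<phi>)"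
        by (metis surj_pair)
      obtain l \<gamma> k0 \<psi> where ke: "k = ((h, \<beta>), (l, \<gamma>), k0, \<psi>)" using kf
        unfolding fe by (cases k) (auto simp: sigma_simps)
      note f' = f[unfolded fe arr] and k' = k[unfolded ke arr]
      note [simp] = GA[OF f[unfolded fe]] GA[OF k[unfolded ke]]
      have "\<psi> \<in> arr q" "\<phi> \<in> arr q" using f' k' qA by auto
      then have [simp]: "\<psi> \<odot>[q] \<phi> = \<psi> \<odot>[p] \<phi>" using f' k' by (simp add: qs)
      let ?f = "farr G ((g, \<alpha>), (h, \<beta>), f0, \<phi>)" and ?k =
        "farr G ((h, \<beta>), (l, \<gamma>), k0, \<psi>)"
      have "?k \<odot>[p] \<iota> h \<beta> \<odot>[p] \<phi> =
        (?k \<odot>[p] \<iota> h \<beta>) \<odot>[p] \<phi>"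
        using f' k' by (intro total.Comp_assoc[symmetric]) simp_all
      also have "\<dots> = \<iota> l \<gamma> \<odot>[p] \<psi> \<odot>[p] \<phi>" using f' k' by simp
      finally have *: "?k \<odot>[p] \<iota> h \<beta> \<odot>[p] \<phi> =
        \<iota> l \<gamma> \<odot>[p] \<psi> \<odot>[p] \<phi>" .
      show "farr G (k \<odot>[sigma B F q] f) = farr G k \<odot>[p] farr G f"
        unfolding fe ke sigma_simps Ga[of g \<alpha> l \<gamma>]
        by (rule ofactor_eqI) (use f' k' * in simp_all)
    qed
    fix X assume X: "X \<in> ob (sigma B F q)"
    then show "over_obj p (fobj G X) = over_obj (sigma B F q) X"
      by (cases X) (simp add: obj Go sigma_simps(7))
  next
    fix x assume x: "x \<in> arr (sigma B F q)"
    obtain g \<alpha> h \<beta> f0 \<phi> where xe: "x = ((g, \<alpha>), (h, \<beta>), f0, \<phi>)"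
      by (metis surj_pair)
    show "over_arr p (farr G x) = over_arr (sigma B F q) x"
      using GA(4) x unfolding xe sigma_simps(8) by blast
  next
    fix X Y z assume X: "X \<in> ob (sigma B F q)" and Y: "Y \<in> ob (sigma B F q)"
      and z: "z \<in> arr p" "src p z = fobj G X" "tgt p z = fobj G Y"
    obtain g \<alpha> h \<beta> where e: "X = (g, \<alpha>)" "Y = (h, \<beta>)" by (cases X; cases Y)
    have [simp]: "g \<in> F" "\<alpha> \<in> ob p" "over_obj p \<alpha> = Dom B g"
      "h \<in> F" "\<beta> \<in> ob p" "over_obj p \<beta> =
        Dom B h" and free: "coproduct_free B F p \<alpha>" "coproduct_free B F p \<beta>"
      using X Y unfolding e obj by auto
    have zs [simp]: "z \<in> arr p" "src p z = tgt p (\<iota> g \<alpha>)" "tgt p z = tgt p (\<iota> h \<beta>)"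
      using z by (simp_all add: e Go)
    have oz [simp]: "Dom B (over_arr p z) = Cod B g" "Cod B (over_arr p z) = Cod B h"
      using over_Dom[of z] over_Cod[of z] by simp_all
    obtain \<phi> where \<phi> [simp]: "\<phi> \<in> arr p" "src p \<phi> = \<alpha>" "tgt p \<phi> =
      \<beta>" and z\<phi>: "\<iota> h \<beta> \<odot>[p] \<phi> = z \<odot>[p] \<iota> g \<alpha>"
      using coproduct_free_factor(1)[OF free(1), of h \<beta> "z \<odot>[p] \<iota> g \<alpha>"] by auto
    \<comment> \<open>The factorization says nothing about base arrows; projecting its equation to
      the base yields the square condition.\<close>
    have "over_arr p (\<iota> h \<beta> \<odot>[p] \<phi>) = over_arr p (z \<odot>[p] \<iota> g \<alpha>)"
      by (simp add: z\<phi>)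
    then have sq: "h \<cdot>[B] over_arr p \<phi> = over_arr p z \<cdot>[B] g" by simp
    have x: "((g, \<alpha>), (h, \<beta>), over_arr p z, \<phi>) \<in> arr (sigma B F q)"
      unfolding arr using sq free by simp
    moreover have "farr G ((g, \<alpha>), (h, \<beta>), over_arr p z, \<phi>) = z"
      unfolding Ga by (rule ofactor_eqI) (simp_all add: z\<phi>)
    ultimately show "\<exists>x\<in>arr (sigma B F q). src (sigma B F q) x = X \<and> tgt (sigma B F q) x =
      Y \<and> farr G x = z"
      unfolding e by (intro bexI[of _ "((g, \<alpha>), (h, \<beta>), over_arr p z, \<phi>)"]) (simp_all add: sigma_simps(3,4))
  next
    fix x y assume x: "x \<in> arr (sigma B F q)" and y: "y \<in> arr (sigma B F q)"
      and xy: "src (sigma B F q) x = src (sigma B F q) y" "tgt (sigma B F q) x = tgt (sigma B F q) y"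
      "farr G x = farr G y"
    obtain g \<alpha> h \<beta> f \<phi> where xe: "x = ((g, \<alpha>), (h, \<beta>), f, \<phi>)"
      by (metis surj_pair)
    obtain f' \<psi> where ye: "y = ((g, \<alpha>), (h, \<beta>), f', \<psi>)" using xy unfolding xe
      by (cases y) (auto simp: sigma_simps)
    note x' = x[unfolded xe] and y' = y[unfolded ye]
    have "f = f'" using GA(4)[OF x'] GA(4)[OF y'] xy(3) unfolding xe ye by simp
    moreover have "\<iota> h \<beta> \<odot>[p] \<phi> = \<iota> h \<beta> \<odot>[p] \<psi>"
      using GA(5)[OF x'] GA(5)[OF y'] xy(3) unfolding xe ye by simp
    then have "\<phi> = \<psi>"
      by (rule coproduct_free_factor(2)[of \<alpha>, rotated -1]) (use x' y' in \<open>simp_all add: arr\<close>)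
    ultimately show "x = y" by (simp add: xe ye)
  next
    fix Z assume "Z \<in> ob p"
    then obtain u \<beta> i j where "u \<in> F" "\<beta> \<in> ob p" "over_obj p \<beta> = Dom B u"
      "coproduct_free B F p \<beta>"
      "over_iso B p (tgt p (\<iota> u \<beta>)) Z i j"
      using enough by metis
    then show "\<exists>X\<in>ob (sigma B F q). \<exists>i j. over_iso B p (fobj G X) Z i j"
      by (intro bexI[of _ "(u, \<beta>)"] exI) (simp_all add: obj Go)
  qed
  then show ?thesis by blast
qed

text \<open>Everything is computed in the coproduct completion: closure of display maps under
  composition provides its coproducts, and identities in \<open>F\<close> provide the objects
  \<open>(id, a)\<close>. \<open>G\<close> preserves cartesian and opcartesian arrows and thereby
  carries the results to \<open>p\<close>.\<close>

lemma enough_if_sigma_equivalence: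
  assumes q: "cloven_fibration B q" and G: "fibrewise_equivalence B (sigma B F q) p G"
    and units: "has_units B F" and coproducts: "has_dependent_coproducts B F"
    and \<alpha>: "\<alpha> \<in> ob p"
  shows "\<exists>u \<in> F. \<exists>\<beta> \<in> ob p. over_obj p \<beta> = Dom B u \<and>
    coproduct_free B F p \<beta> \<and>
      (\<exists>i j. over_iso B p (tgt p (\<iota> u \<beta>)) \<alpha> i j)"
proof -
  let ?S = "sigma B F q"
  interpret q: display_fibration B F q
    by (intro display_fibration.intro q display_map_category_axioms)
  interpret s: cloven_fibration B ?S by (rule q.sigma_cloven)
  interpret G: fibrewise_equivalence B ?S p G by (rule G)
  have Ident_F [simp]: "Ident B A \<in> F" if "A \<in> Obj B" for A
    using units that iso_Ident unfolding has_units_def by blast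
  have Comp_F: "v \<cdot>[B] u \<in> F" if "u \<in> F" "v \<in> F" "Dom B v = Cod B u" for u v
    using coproducts that unfolding has_dependent_coproducts_def by blast
  \<comment> \<open>Coproducts in the completion: compose the display map with \<open>u\<close> and
    keep the object.\<close>
  have inj: "opcartesian B ?S ((g, a), (u \<cdot>[B] g, a), u, Ident (Tot q) a)" (is "opcartesian B ?S ?x")
    if [simp]: "g \<in> F" "u \<in> F" "Dom B u = Cod B g" "a \<in> ob q" "over_obj q a = Dom B g" for g u a
  proof (rule s.opcartesianI)
    show "?x \<in> arr ?S" unfolding sigma_simps using Comp_F by simp
  next
    fix z w assume z: "z \<in> arr ?S" and w [simp]: "w \<in> Arr B" and zd: "src ?S z = src ?S ?x"
      and wc: "Dom B w = Cod B (over_arr ?S ?x)" "w \<cdot>[B] over_arr ?S ?x = over_arr ?S z"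
    obtain h \<beta> \<phi> where ze: "z = ((g, a), (h, \<beta>), w \<cdot>[B] u, \<phi>)"
      using zd wc(2) by (cases z) (auto simp: sigma_simps)
    have [simp]: "Dom B w = Cod B u" using wc(1) by (simp add: sigma_simps)
    have z': "h \<in> F" "over_obj q \<beta> = Dom B h" "Cod B w = Cod B h" "\<phi> \<in> arr q"
      "src q \<phi> = a" "tgt q \<phi> = \<beta>"
      "h \<cdot>[B] over_arr q \<phi> = w \<cdot>[B] u \<cdot>[B] g"
      using z unfolding ze sigma_simps by auto
    show "\<exists>k. k \<in> arr ?S \<and> src ?S k = tgt ?S ?x \<and> tgt ?S k = tgt ?S z \<and>
        over_arr ?S k = w \<and> k \<odot>[?S] ?x = z"
      by (rule exI[of _ "((u \<cdot>[B] g, a), (h, \<beta>), w, \<phi>)"]) (unfold ze sigma_simps, use z' Comp_F in simp)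
  next
    fix k l assume kl: "k \<in> arr ?S" "l \<in> arr ?S" "src ?S k = tgt ?S ?x" "src ?S l = tgt ?S ?x"
      "tgt ?S k = tgt ?S l" "over_arr ?S k = over_arr ?S l" "k \<odot>[?S] ?x = l \<odot>[?S] ?x"
    obtain t f \<phi> where ke: "k = ((u \<cdot>[B] g, a), t, f, \<phi>)" using kl(3)
      by (cases k) (auto simp: sigma_simps)
    obtain \<psi> where le: "l = ((u \<cdot>[B] g, a), t, f, \<psi>)" using kl(4-6) unfolding ke
      by (cases l) (auto simp: sigma_simps)
    have "\<phi> \<in> arr q" "src q \<phi> = a" "\<psi> \<in> arr q" "src q \<psi> = a"
      using kl(1,2) unfolding ke le by (cases t; simp add: sigma_simps)+
    then show "k = l" using kl(7) unfolding ke le sigma_simps by simp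
  qed
  \<comment> \<open>The chosen lift would have a pullback of an identity as its display map. This
    cartesian arrow has an identity there, so that objects \<open>(id, a)\<close> reindex to objects
    of the same form.\<close>
  have cart: "cartesian B ?S ((Ident B (Dom B f), src q (lift q f a)), (Ident B (Cod B f), a), f, lift q f a)" (is "cartesian B ?S ?x")
    if [simp]: "f \<in> Arr B" "a \<in> ob q" "over_obj q a = Cod B f" for f a
  proof (rule s.cartesianI)
    show "?x \<in> arr ?S" unfolding sigma_simps by simp
  next
    fix z w assume z: "z \<in> arr ?S" "tgt ?S z = tgt ?S ?x" and w [simp]: "w \<in> Arr B"
      and wc: "Dom B w = Dom B (over_arr ?S z)" "Cod B w = Dom B (over_arr ?S ?x)"
        "over_arr ?S ?x \<cdot>[B] w = over_arr ?S z"
    obtain g \<beta> \<phi> where ze: "z = ((g, \<beta>), (Ident B (Cod B f), a), f \<cdot>[B] w, \<phi>)"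
      using z(2) wc(3) by (cases z) (auto simp: sigma_simps)
    have [simp]: "Cod B w = Dom B f" using wc(2) by (simp add: sigma_simps)
    have z': "g \<in> F" "over_obj q \<beta> = Dom B g" "Dom B w = Cod B g" "\<phi> \<in> arr q"
      "src q \<phi> = \<beta>" "tgt q \<phi> = a"
      and "Ident B (Cod B f) \<cdot>[B] over_arr q \<phi> = f \<cdot>[B] w \<cdot>[B] g"
      using z(1) unfolding ze sigma_simps by auto
    then have o: "over_arr q \<phi> = f \<cdot>[B] w \<cdot>[B] g" using q.over_Cod[of \<phi>] by simp
    let ?k = "cfactor q (lift q f a) \<phi> (w \<cdot>[B] g)"
    have k: "?k \<in> arr q" "src q ?k = \<beta>" "tgt q ?k = src q (lift q f a)" "over_arr q ?k =
      w \<cdot>[B] g"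
      "lift q f a \<odot>[q] ?k = \<phi>"
      using z' o by simp_all
    show "\<exists>k. k \<in> arr ?S \<and> src ?S k = src ?S z \<and> tgt ?S k = src ?S ?x \<and>
        over_arr ?S k = w \<and> ?x \<odot>[?S] k = z"
      by (rule exI[of _ "((g, \<beta>), (Ident B (Dom B f), src q (lift q f a)), w, ?k)"]) (unfold ze sigma_simps, use z' k in simp)
  next
    fix k l assume kl: "k \<in> arr ?S" "l \<in> arr ?S" "src ?S k = src ?S l" "tgt ?S k = src ?S ?x"
      "tgt ?S l = src ?S ?x"
      "over_arr ?S k = over_arr ?S l" "?x \<odot>[?S] k = ?x \<odot>[?S] l"
    obtain g \<beta> v \<phi> where ke: "k =
      ((g, \<beta>), (Ident B (Dom B f), src q (lift q f a)), v, \<phi>)" using kl(4) by (cases k) (auto simp: sigma_simps)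
    obtain \<psi> where le: "l = ((g, \<beta>), (Ident B (Dom B f), src q (lift q f a)), v, \<psi>)"
      using kl(3,5,6) unfolding ke by (cases l) (auto simp: sigma_simps)
    have *: "\<phi> \<in> arr q" "src q \<phi> = \<beta>" "tgt q \<phi> = src q (lift q f a)"
      "\<psi> \<in> arr q" "src q \<psi> = \<beta>" "tgt q \<psi> = src q (lift q f a)"
      "Ident B (Dom B f) \<cdot>[B] over_arr q \<phi> = v \<cdot>[B] g"
        "Ident B (Dom B f) \<cdot>[B] over_arr q \<psi> = v \<cdot>[B] g"
      using kl(1,2) unfolding ke le by (simp_all add: sigma_simps)
    have "Cod B (over_arr q \<phi>) = Dom B f" "Cod B (over_arr q \<psi>) = Dom B f"
      using q.over_Cod[OF *(1)] q.over_Cod[OF *(4)] unfolding *(3,6) by simp_all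
    then have "over_arr q \<phi> = over_arr q \<psi>" using *(1,4,7,8) by simp
    moreover have "lift q f a \<odot>[q] \<phi> = lift q f a \<odot>[q] \<psi>" using kl(7)
      unfolding ke le sigma_simps by simp
    ultimately have "\<phi> = \<psi>"
      by (intro q.cartesian_eqI[of "lift q f a" \<phi> \<psi>]) (use * in simp_all)
    then show "k = l" by (simp add: ke le)
  qed
  have splits: "splits B F p (fobj G (Ident B T, a))"
    if [simp]: "T \<in> Obj B" "a \<in> ob q" "over_obj q a = T" for T a
  proof (rule splitsI)
    have aS [simp]: "(Ident B T, a) \<in> ob ?S" by (simp add: sigma_simps)
    have oGa: "over_obj p (fobj G (Ident B T, a)) = T" by (simp add: sigma_simps)
    show "fobj G (Ident B T, a) \<in> ob p" by simp
    fix u Z assume u [simp]: "u \<in> F" and Z [simp]: "Z \<in> ob p" "over_obj p Z = Dom B u"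
      and c: "Cod B u = over_obj p (fobj G (Ident B T, a))"
    have uT [simp]: "Cod B u = T" using c oGa by simp
    \<comment> \<open>\<open>Z\<close> is only isomorphic to the image of some
      \<open>(k, w)\<close>. Its coproduct along \<open>u\<close> can then be taken to be the image
      of \<open>(u k, w)\<close>, with the isomorphism put in front of the opcartesian
      arrow.\<close>
    obtain k w i j where kw: "(k, w) \<in> ob ?S" and ij: "over_iso B p (fobj G (k, w)) Z i j"
      using G.eso[OF Z(1)] by auto
    have [simp]: "k \<in> F" "w \<in> ob q" "over_obj q w = Dom B k" using kw by (simp_all add: sigma_simps)
    have "Cod B k = over_obj p (fobj G (k, w))" using kw by (simp add: sigma_simps(7))
    then have [simp]: "Cod B k = Dom B u" using over_isoD(13)[OF ij] by simp
    have [simp]: "over_obj p (fobj G (k, w)) = Dom B u" using kw by (simp add: sigma_simps(7))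
    note [simp] = over_isoD(1-10)[OF ij] kw
    let ?x = "((k, w), (u \<cdot>[B] k, w), u, Ident (Tot q) w)"
    have ox: "opcartesian B ?S ?x" by (rule inj) simp_all
    note [simp] = s.opcartesian_Arr[OF ox] and oGx = G.preserves_opcartesian[OF ox]
    let ?y = "farr G ?x \<odot>[p] j"
    have y [simp]: "?y \<in> arr p" "src p ?y = Z" "tgt p ?y = fobj G (u \<cdot>[B] k, w)" "over_arr p ?y = u"
      by (simp_all add: sigma_simps(3,4,8))
    have oy: "opcartesian B p ?y"
    proof (rule opcartesianI)
      fix z v assume [simp]: "z \<in> arr p" "v \<in> Arr B" "src p z = src p ?y" "Dom B v =
        Cod B (over_arr p ?y)"
        and v: "v \<cdot>[B] over_arr p ?y = over_arr p z"
      have [simp]: "Dom B (over_arr p z) = Dom B u" using over_Dom[of z] by simp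
      have v' [simp]: "v \<cdot>[B] u = over_arr p z" using v by simp
      let ?m = "ofactor p (farr G ?x) (z \<odot>[p] i) v"
      have m: "?m \<in> arr p" "src p ?m = fobj G (u \<cdot>[B] k, w)" "tgt p ?m = tgt p z" "over_arr p ?m = v"
        "?m \<odot>[p] farr G ?x = z \<odot>[p] i"
        using oGx by (simp_all add: sigma_simps(3,4,8))
      have "?m \<odot>[p] farr G ?x \<odot>[p] j = (?m \<odot>[p] farr G ?x) \<odot>[p] j"
        using m(1-4) by (intro total.Comp_assoc[symmetric]) (simp_all add: sigma_simps(3,4))
      also have "\<dots> = z" unfolding m(5) by simp
      finally show "\<exists>k. k \<in> arr p \<and> src p k = tgt p ?y \<and> tgt p k = tgt p z \<and>
        over_arr p k = v \<and> k \<odot>[p] ?y = z"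
        using m(1-4) y(3) by (intro exI[of _ ?m]) simp
    next
      fix m n assume mn: "m \<in> arr p" "n \<in> arr p" "src p m = tgt p ?y" "src p n = tgt p ?y"
        "tgt p m = tgt p n" "over_arr p m = over_arr p n" and eq: "m \<odot>[p] ?y = n \<odot>[p] ?y"
      have "?y \<odot>[p] i = farr G ?x" by (simp add: sigma_simps(3,4))
      moreover have "(m \<odot>[p] ?y) \<odot>[p] i = m \<odot>[p] (?y \<odot>[p] i)"
        "(n \<odot>[p] ?y) \<odot>[p] i = n \<odot>[p] (?y \<odot>[p] i)"
        by (rule total.Comp_assoc; use mn(1-4) y in simp)+
      ultimately have "m \<odot>[p] farr G ?x = n \<odot>[p] farr G ?x" using eq by simp
      then show "m = n" by (rule opcartesian_eqI[OF oGx, rotated -1]) (use mn y(3) in \<open>simp_all add: sigma_simps(3,4)\<close>)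
    qed simp
    have "\<exists>!k'. k' \<in> hom (Tot p) (fobj G (Ident B T, a)) Z \<and> ?y \<odot>[p] k' = h"
      if h: "h \<in> hom (Tot p) (fobj G (Ident B T, a)) (tgt p ?y)" and oh: "over_arr p h = Ident B T" for h
    proof -
      have [simp]: "h \<in> arr p" "src p h = fobj G (Ident B T, a)" "tgt p h = fobj G (u \<cdot>[B] k, w)"
        using h y(3) by (auto simp: hom_def)
      have ukw: "(u \<cdot>[B] k, w) \<in> ob ?S" using Comp_F by (simp add: sigma_simps)
      obtain h' where h': "h' \<in> arr ?S" "src ?S h' = (Ident B T, a)" "tgt ?S h' = (u \<cdot>[B] k, w)"
        "farr G h' = h"
        using G.full[OF aS ukw, of h] by auto
      have "over_arr ?S h' = Ident B T" using G.G_over_arr[OF h'(1)] h'(4) oh by simp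
      then obtain \<phi> where he: "h' = ((Ident B T, a), (u \<cdot>[B] k, w), Ident B T, \<phi>)"
        using h' by (cases h') (auto simp: sigma_simps)
      have \<phi>: "\<phi> \<in> arr q" "src q \<phi> = a" "tgt q \<phi> = w"
        "(u \<cdot>[B] k) \<cdot>[B] over_arr q \<phi> = Ident B T \<cdot>[B] Ident B T"
        using h'(1) unfolding he sigma_simps by auto
      have o\<phi> [simp]: "Cod B (over_arr q \<phi>) = Dom B k" "Dom B (over_arr q \<phi>) = T"
        using \<phi> q.over_Cod[of \<phi>] q.over_Dom[of \<phi>] by simp_all
      have uk: "u \<cdot>[B] k \<cdot>[B] over_arr q \<phi> = Ident B T" using \<phi>(1,4) by simp
      \<comment> \<open>Since \<open>u k\<close> after \<open>over_arr q \<phi>\<close> is an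
        identity, \<open>k\<close> after \<open>over_arr q \<phi>\<close> is a section of
        \<open>u\<close>; over this section the same \<open>\<phi>\<close> is an arrow into
        \<open>(k, w)\<close>.\<close>
      let ?k' = "((Ident B T, a), (k, w), k \<cdot>[B] over_arr q \<phi>, \<phi>)"
      have k' [simp]: "?k' \<in> arr ?S" unfolding sigma_simps using \<phi> by simp
      have xk: "?x \<odot>[?S] ?k' = h'" unfolding he sigma_simps using \<phi> uk by simp
      show ?thesis
      proof (rule ex1I[of _ "i \<odot>[p] farr G ?k'"])
        have "?y \<odot>[p] i \<odot>[p] farr G ?k' = farr G ?x \<odot>[p] farr G ?k'"
          using over_iso_cancel(1)[OF ij, of "farr G ?k'"] by (simp add: sigma_simps(3,4))
        also have "\<dots> = farr G (?x \<odot>[?S] ?k')"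
          by (rule G.G_simps(6)[symmetric]) (simp_all add: sigma_simps(3,4))
        finally show "i \<odot>[p] farr G ?k' \<in> hom (Tot p) (fobj G (Ident B T, a)) Z \<and>
          ?y \<odot>[p] i \<odot>[p] farr G ?k' = h"
          unfolding xk h'(4) by (simp add: hom_def sigma_simps(3,4))
      next
        fix l assume l: "l \<in> hom (Tot p) (fobj G (Ident B T, a)) Z \<and> ?y \<odot>[p] l = h"
        have ls [simp]: "l \<in> arr p" "src p l = fobj G (Ident B T, a)" "tgt p l =
          Z" and yl: "?y \<odot>[p] l = h"
          using l by (auto simp: hom_def)
        obtain l' where l': "l' \<in> arr ?S" "src ?S l' = (Ident B T, a)" "tgt ?S l' = (k, w)" "farr G l' =
          j \<odot>[p] l"
          using G.full[OF aS kw, of "j \<odot>[p] l"] by auto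
        have "farr G (?x \<odot>[?S] l') = farr G ?x \<odot>[p] j \<odot>[p] l"
          using l' by (subst G.G_simps(6)) (simp_all add: sigma_simps(3,4))
        also have "\<dots> = h" using yl by (simp add: sigma_simps(3,4))
        finally have "farr G (?x \<odot>[?S] l') = farr G (?x \<odot>[?S] ?k')" using xk h'(4) by simp
        then have eq: "?x \<odot>[?S] l' = ?x \<odot>[?S] ?k'"
          by (rule G.faithful[rotated -1])
            (use l' s.total.Comp_simps[of l' ?x] s.total.Comp_simps[of ?k' ?x] in \<open>simp_all add: sigma_simps(3,4)\<close>)
        obtain f \<psi> where le: "l' = ((Ident B T, a), (k, w), f, \<psi>)" using l'(2,3)
          by (cases l') (auto simp: sigma_simps)
        have \<psi>: "\<psi> \<in> arr q" "src q \<psi> = a" "tgt q \<psi> = w"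
          "k \<cdot>[B] over_arr q \<psi> = f \<cdot>[B] Ident B T" "f \<in> Arr B" "Dom B f = T"
          using l'(1) unfolding le sigma_simps by auto
        \<comment> \<open>The injection \<open>?x\<close> acts as an identity on components, so a
          competing factorization has the same \<open>\<phi>\<close>. Its base arrow is then forced
          by the square condition, the display map at its source being an identity.\<close>
        have "\<psi> = \<phi>" using eq \<phi> \<psi> unfolding le sigma_simps by simp
        moreover have "f = k \<cdot>[B] over_arr q \<psi>" using \<psi> by simp
        ultimately have "l' = ?k'" by (simp add: le)
        then have "j \<odot>[p] l = farr G ?k'" using l'(4) by simp
        then show "l = i \<odot>[p] farr G ?k'" using over_iso_cancel(2)[OF ij, of l] by simp
      qed
    qed
    then show "\<exists>x. opcartesian B p x \<and> over_arr p x = u \<and> src p x = Z \<and>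
        (\<forall>h \<in> hom (Tot p) (fobj G (Ident B T, a)) (tgt p x). over_arr p h =
          Ident B (over_obj p (fobj G (Ident B T, a))) \<longrightarrow>
         (\<exists>!k. k \<in> hom (Tot p) (fobj G (Ident B T, a)) Z \<and> x \<odot>[p] k = h))"
      using oy y(2,4) unfolding oGa by (intro exI[of _ ?y]) blast
  qed
  have free: "coproduct_free B F p (fobj G (Ident B X, a))"
    if [simp]: "X \<in> Obj B" "a \<in> ob q" "over_obj q a = X" for X a
  proof (rule coproduct_freeI)
    have aS [simp]: "(Ident B X, a) \<in> ob ?S" by (simp add: sigma_simps)
    show "fobj G (Ident B X, a) \<in> ob p" by simp
    fix f assume [simp]: "f \<in> Arr B" and "Cod B f = over_obj p (fobj G (Ident B X, a))"
    then have fX [simp]: "Cod B f = X" by (simp add: sigma_simps)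
    let ?x = "((Ident B (Dom B f), src q (lift q f a)), (Ident B (Cod B f), a), f, lift q f a)"
    have x: "cartesian B ?S ?x" by (rule cart) simp_all
    have "splits B F p (fobj G (Ident B (Dom B f), src q (lift q f a)))"
      by (rule splits) simp_all
    then show "\<exists>c. cartesian B p c \<and> tgt p c = fobj G (Ident B X, a) \<and> over_arr p c =
      f \<and> splits B F p (src p c)"
      using G.preserves_cartesian[OF x] s.cartesian_Arr[OF x]
      by (intro exI[of _ "farr G ?x"]) (simp add: sigma_simps(3,4,8))
  qed
  obtain g a i j where ga: "(g, a) \<in> ob ?S" and ij: "over_iso B p (fobj G (g, a)) \<alpha> i j"
    using G.eso[OF \<alpha>] by auto
  have [simp]: "g \<in> F" "a \<in> ob q" "over_obj q a = Dom B g" using ga by (simp_all add: sigma_simps)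
  let ?\<beta> = "fobj G (Ident B (Dom B g), a)"
  have oS [simp]: "(Ident B (Dom B g), a) \<in> ob ?S" by (simp add: sigma_simps)
  have \<beta>: "?\<beta> \<in> ob p" "over_obj p ?\<beta> = Dom B g" by (simp_all add: sigma_simps)
  have "opcartesian B ?S ((Ident B (Dom B g), a), (g \<cdot>[B] Ident B (Dom B g), a), g, Ident (Tot q) a)"
    by (rule inj) simp_all
  then have x: "opcartesian B ?S ((Ident B (Dom B g), a), (g, a), g, Ident (Tot q) a)" (is "opcartesian B ?S ?x") by simp
  note [simp] = s.opcartesian_Arr[OF x]
  \<comment> \<open>The chosen coprojection and the image of the injection are both opcartesian over
    \<open>g\<close> out of \<open>?\<beta>\<close>, so the chosen coproduct is vertically
    isomorphic to the image of \<open>(g, a)\<close>.\<close>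
  obtain k l where "over_iso B p (tgt p (\<iota> g ?\<beta>)) (tgt p (farr G ?x)) k l"
    by (rule opcartesian_over_iso[of "\<iota> g ?\<beta>" "farr G ?x"])
      (use \<beta> G.preserves_opcartesian[OF x] in \<open>simp_all add: sigma_simps(3,8)\<close>)
  then have "over_iso B p (tgt p (\<iota> g ?\<beta>)) (fobj G (g, a)) k l" by (simp add: sigma_simps(4))
  from over_iso_trans[OF this ij] show ?thesis
    using \<beta> free[of "Dom B g" a] by (intro bexI[of _ g] bexI[of _ ?\<beta>]) auto
qed

end

section \<open>Products as coproducts of the opposite\<close>

lemma fibre_simps:
  "X \<in> Obj (fibre B p A) \<longleftrightarrow> X \<in> ob p \<and> over_obj p X = A"
  "x \<in> Arr (fibre B p A) \<longleftrightarrow> x \<in> arr p \<and> over_arr p x = Ident B A"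
  "Dom (fibre B p A) = src p" "Cod (fibre B p A) = tgt p"
  "Ident (fibre B p A) = Ident (Tot p)" "Comp (fibre B p A) = Comp (Tot p)"
  by (auto simp: fibre_def)

locale product_fibration = display_fibration B F p
  for B :: "('ob, 'ab) cat" and F :: "'ab set" and p :: "('oe, 'ae, 'ob, 'ab) fib" +
  fixes P :: "('oe, 'ae, 'ab) products"
  assumes products: "has_products B F p P"
begin

abbreviation "R v \<equiv> Prd P v"
abbreviation "\<eta> v \<equiv> prd_unit P v"
abbreviation "\<epsilon> v \<equiv> prd_counit P v"

lemma adjunction:
  "v \<in> F \<Longrightarrow> adjunction (fibre B p (Cod B v)) (fibre B p (Dom B v)) (reindex B p v) (R v) (\<eta> v) (\<epsilon> v)"
  using products by (simp add: has_products_def)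

lemma R_simps [simp]:
  assumes "v \<in> F"
  shows "\<beta> \<in> ob p \<Longrightarrow> over_obj p \<beta> = Dom B v \<Longrightarrow>
    fobj (R v) \<beta> \<in> ob p"
    and "\<beta> \<in> ob p \<Longrightarrow> over_obj p \<beta> = Dom B v \<Longrightarrow>
      over_obj p (fobj (R v) \<beta>) = Cod B v"
    and "e \<in> arr p \<Longrightarrow> over_arr p e = Ident B (Dom B v) \<Longrightarrow>
      farr (R v) e \<in> arr p"
    and "e \<in> arr p \<Longrightarrow> over_arr p e = Ident B (Dom B v) \<Longrightarrow>
      src p (farr (R v) e) = fobj (R v) (src p e)"
    and "e \<in> arr p \<Longrightarrow> over_arr p e = Ident B (Dom B v) \<Longrightarrow>
      tgt p (farr (R v) e) = fobj (R v) (tgt p e)"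
    and "e \<in> arr p \<Longrightarrow> over_arr p e = Ident B (Dom B v) \<Longrightarrow>
      over_arr p (farr (R v) e) = Ident B (Cod B v)"
  using adjunction[OF assms] by (auto simp: adjunction_def is_functor_def fibre_simps hom_def)

lemma R_Comp:
  "v \<in> F \<Longrightarrow> e \<in> arr p \<Longrightarrow> over_arr p e =
    Ident B (Dom B v) \<Longrightarrow> d \<in> arr p \<Longrightarrow>
    over_arr p d = Ident B (Dom B v) \<Longrightarrow> src p d = tgt p e \<Longrightarrow>
    farr (R v) (d \<odot>[p] e) = farr (R v) d \<odot>[p] farr (R v) e"
  using adjunction[of v] by (simp add: adjunction_def is_functor_def fibre_simps)

lemma reindex_Comp:
  "v \<in> F \<Longrightarrow> e \<in> arr p \<Longrightarrow> over_arr p e =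
    Ident B (Cod B v) \<Longrightarrow> d \<in> arr p \<Longrightarrow>
    over_arr p d = Ident B (Cod B v) \<Longrightarrow> src p d = tgt p e \<Longrightarrow>
    farr (reindex B p v) (d \<odot>[p] e) = farr (reindex B p v) d \<odot>[p] farr (reindex B p v) e"
  using adjunction[of v] by (simp add: adjunction_def is_functor_def fibre_simps)

lemma unit_simps [simp]:
  assumes "v \<in> F" "X \<in> ob p" "over_obj p X = Cod B v"
  shows "\<eta> v X \<in> arr p" "src p (\<eta> v X) = X"
    "tgt p (\<eta> v X) = fobj (R v) (src p (lift p v X))" "over_arr p (\<eta> v X) = Ident B (Cod B v)"
  using adjunction[OF assms(1)] assms(2,3)
  by (auto simp: adjunction_def nat_trans_def id_ftr_def comp_ftr_def fibre_simps hom_def)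

lemma counit_simps [simp]:
  assumes "v \<in> F" "\<beta> \<in> ob p" "over_obj p \<beta> = Dom B v"
  shows "\<epsilon> v \<beta> \<in> arr p" "src p (\<epsilon> v \<beta>) =
    src p (lift p v (fobj (R v) \<beta>))"
    "tgt p (\<epsilon> v \<beta>) = \<beta>" "over_arr p (\<epsilon> v \<beta>) = Ident B (Dom B v)"
  using adjunction[OF assms(1)] assms(2,3)
  by (auto simp: adjunction_def nat_trans_def id_ftr_def comp_ftr_def fibre_simps hom_def)

lemma unit_natural:
  "v \<in> F \<Longrightarrow> k \<in> arr p \<Longrightarrow> over_arr p k =
    Ident B (Cod B v) \<Longrightarrow>
    \<eta> v (tgt p k) \<odot>[p] k = farr (R v) (farr (reindex B p v) k) \<odot>[p] \<eta> v (src p k)"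
  using adjunction[of v] by (simp add: adjunction_def nat_trans_def id_ftr_def comp_ftr_def fibre_simps)

lemma counit_natural:
  "v \<in> F \<Longrightarrow> e \<in> arr p \<Longrightarrow> over_arr p e =
    Ident B (Dom B v) \<Longrightarrow>
    \<epsilon> v (tgt p e) \<odot>[p] farr (reindex B p v) (farr (R v) e) = e \<odot>[p] \<epsilon> v (src p e)"
  using adjunction[of v] by (simp add: adjunction_def nat_trans_def id_ftr_def comp_ftr_def fibre_simps)

lemma triangles:
  "v \<in> F \<Longrightarrow> X \<in> ob p \<Longrightarrow> over_obj p X = Cod B v \<Longrightarrow>
    \<epsilon> v (src p (lift p v X)) \<odot>[p] farr (reindex B p v) (\<eta> v X) =
      Ident (Tot p) (src p (lift p v X))"
  "v \<in> F \<Longrightarrow> \<beta> \<in> ob p \<Longrightarrow> over_obj p \<beta> =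
    Dom B v \<Longrightarrow>
    farr (R v) (\<epsilon> v \<beta>) \<odot>[p] \<eta> v (fobj (R v) \<beta>) =
      Ident (Tot p) (fobj (R v) \<beta>)"
  using adjunction[of v] by (simp_all add: adjunction_def fibre_simps)

text \<open>Together with \<open>transpose_unique\<close> this turns the unit-counit form of the
  adjunction into a bijection of hom-sets; each of the two lemmas rests on one triangle
  identity.\<close>

lemma transpose:
  assumes [simp]: "v \<in> F" "X \<in> ob p" "over_obj p X = Cod B v" "e \<in> arr p" "over_arr p e =
    Ident B (Dom B v)"
    and De: "src p e = src p (lift p v X)" and Ce [simp]: "tgt p e = \<beta>"
  shows "\<epsilon> v \<beta> \<odot>[p] farr (reindex B p v) (farr (R v) e \<odot>[p] \<eta> v X) = e"
proof -
  note [simp] = De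
  have [simp]: "\<beta> \<in> ob p" using total.Obj_Cod[of e] by simp
  have [simp]: "over_obj p \<beta> = Dom B v" using over_Cod[of e] by simp
  have "farr (reindex B p v) (farr (R v) e \<odot>[p] \<eta> v X) =
    farr (reindex B p v) (farr (R v) e) \<odot>[p] farr (reindex B p v) (\<eta> v X)"
    by (rule reindex_Comp) simp_all
  then have "\<epsilon> v \<beta> \<odot>[p] farr (reindex B p v) (farr (R v) e \<odot>[p] \<eta> v X) =
    (\<epsilon> v \<beta> \<odot>[p] farr (reindex B p v) (farr (R v) e)) \<odot>[p] farr (reindex B p v) (\<eta> v X)"
    by simp
  also have "\<dots> = e"
    using counit_natural[of v e] triangles(1)[of v X] by simp
  finally show ?thesis .
qed

lemma transpose_unique:
  assumes [simp]: "v \<in> F" "\<beta> \<in> ob p" "over_obj p \<beta> = Dom B v" "k \<in> arr p"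
    "over_arr p k = Ident B (Cod B v)"
    and Ck [simp]: "tgt p k = fobj (R v) \<beta>"
  shows "k = farr (R v) (\<epsilon> v \<beta> \<odot>[p] farr (reindex B p v) k) \<odot>[p] \<eta> v (src p k)"
proof -
  have "farr (R v) (\<epsilon> v \<beta> \<odot>[p] farr (reindex B p v) k) =
    farr (R v) (\<epsilon> v \<beta>) \<odot>[p] farr (R v) (farr (reindex B p v) k)"
    by (rule R_Comp) simp_all
  then have "farr (R v) (\<epsilon> v \<beta> \<odot>[p] farr (reindex B p v) k) \<odot>[p] \<eta> v (src p k) =
    farr (R v) (\<epsilon> v \<beta>) \<odot>[p] farr (R v) (farr (reindex B p v) k) \<odot>[p] \<eta> v (src p k)"
    by simp
  also have "\<dots> = farr (R v) (\<epsilon> v \<beta>) \<odot>[p] \<eta> v (tgt p k) \<odot>[p] k"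
    by (simp only: unit_natural[of v k, symmetric] assms)
  also have "\<dots> = (farr (R v) (\<epsilon> v \<beta>) \<odot>[p] \<eta> v (fobj (R v) \<beta>)) \<odot>[p] k"
    unfolding Ck by (rule total.Comp_assoc[symmetric]) simp_all
  also have "\<dots> = k" by (simp add: triangles(2))
  finally show ?thesis ..
qed

text \<open>The counit \<open>u\<^sup>*\<Pi>\<^sub>u\<beta> \<rightarrow> \<beta>\<close>, read in
  the opposite as an arrow \<open>\<beta> \<rightarrow> \<Pi>\<^sub>u\<beta>\<close> over
  \<open>u\<close>.\<close>

definition coprojection :: "'ab \<Rightarrow> 'oe \<Rightarrow> 'ab \<times> 'oe \<times> 'ae" where
  "coprojection u \<beta> = (u, fobj (R u) \<beta>, \<epsilon> u \<beta>)"

lemma opp_vertical_Comp_eq: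
  assumes e: "(u, Y, e) \<in> arr (opp B p)" and k: "k \<in> arr p" "over_arr p k = Ident B (Cod B u)"
    "tgt p k = Y"
  shows "opp_vertical B p k \<odot>[opp B p] (u, Y, e) = (u, src p k, e \<odot>[p] farr (reindex B p u) k)"
proof -
  have [simp]: "u \<in> Arr B" using e by (simp add: opp_simps)
  show ?thesis
    using e k by (subst opp_vertical_Comp[OF e, where A =
      "Cod B u"]) (simp_all add: reindex_def vfactor_cfactor)
qed

lemma coprojection_Arr:
  "u \<in> F \<Longrightarrow> \<beta> \<in> ob p \<Longrightarrow> over_obj p \<beta> =
    Dom B u \<Longrightarrow> coprojection u \<beta> \<in> arr (opp B p)"
  by (simp add: coprojection_def opp_simps)

lemma coprojection_simps:
  assumes "u \<in> F" "\<beta> \<in> ob p" "over_obj p \<beta> = Dom B u"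
  shows "src (opp B p) (coprojection u \<beta>) = \<beta>" "tgt (opp B p) (coprojection u \<beta>) =
    fobj (R u) \<beta>"
    "over_arr (opp B p) (coprojection u \<beta>) = u"
  using assms by (simp_all add: coprojection_def opp_simps)

text \<open>By \<open>opcartesian_if_vertical\<close> only arrows over \<open>u\<close> have to be
  extended. Such an arrow out of \<open>\<beta>\<close> is some
  \<open>e : u\<^sup>*X \<rightarrow> \<beta>\<close>, and its vertical extension is the reversal of
  the transpose \<open>X \<rightarrow> \<Pi>\<^sub>u\<beta>\<close>.\<close>

lemma coprojection_opcartesian:
  assumes [simp]: "u \<in> F" "\<beta> \<in> ob p" "over_obj p \<beta> = Dom B u"
  shows "opcartesian B (opp B p) (coprojection u \<beta>)"
proof -
  interpret o: cloven_fibration B "opp B p" by (rule opp_cloven)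
  note i = coprojection_Arr[OF assms] coprojection_simps[OF assms]
  show ?thesis
  proof (rule o.opcartesian_if_vertical, unfold i(2-4))
    show "coprojection u \<beta> \<in> arr (opp B p)" by (rule i)
  next
    fix z assume z: "z \<in> arr (opp B p)" "src (opp B p) z = \<beta>" "over_arr (opp B p) z = u"
    obtain X e where ze: "z = (u, X, e)" using z(3) by (cases z) (auto simp: opp_simps)
    have [simp]: "X \<in> ob p" "over_obj p X = Cod B u" "e \<in> arr p" "src p e = src p (lift p u X)"
      "over_arr p e = Ident B (Dom B u)" "tgt p e = \<beta>"
      using z by (simp_all add: ze opp_simps)
    let ?k = "farr (R u) e \<odot>[p] \<eta> u X"
    have k: "?k \<in> arr p" "over_arr p ?k = Ident B (Cod B u)" "tgt p ?k = fobj (R u) \<beta>" "src p ?k = X"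
      by simp_all
    have "opp_vertical B p ?k \<odot>[opp B p] coprojection u \<beta> = z"
      unfolding coprojection_def ze
        by (subst opp_vertical_Comp_eq) (use i k transpose[of u X e \<beta>] in \<open>simp_all add: coprojection_def\<close>)
    then show "\<exists>k. k \<in> arr (opp B p) \<and> src (opp B p) k = fobj (R u) \<beta> \<and>
      tgt (opp B p) k = tgt (opp B p) z \<and> over_arr (opp B p) k = Ident B (Cod B u) \<and>
      k \<odot>[opp B p] coprojection u \<beta> = z"
      using opp_vertical_simps(1-4)[OF k(1,2)] k(3,4)
        by (intro exI[of _ "opp_vertical B p ?k"]) (simp add: ze opp_simps(4))
  next
    fix k l assume kl: "k \<in> arr (opp B p)" "l \<in> arr (opp B p)"
      "src (opp B p) k = fobj (R u) \<beta>" "src (opp B p) l = fobj (R u) \<beta>"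
      "tgt (opp B p) k = tgt (opp B p) l"
      "over_arr (opp B p) k = Ident B (Cod B u)" "over_arr (opp B p) l = Ident B (Cod B u)"
      and eq: "k \<odot>[opp B p] coprojection u \<beta> = l \<odot>[opp B p] coprojection u \<beta>"
    have A: "Cod B u \<in> Obj B" by simp
    obtain k' where k': "k' \<in> arr p" "over_arr p k' = Ident B (Cod B u)" "src p k' = tgt (opp B p) l"
      "tgt p k' = fobj (R u) \<beta>" "k = opp_vertical B p k'"
      using opp_verticalE[OF kl(1,6) A] kl(3,5) by metis
    obtain l' where l': "l' \<in> arr p" "over_arr p l' = Ident B (Cod B u)" "src p l' = tgt (opp B p) l"
      "tgt p l' = fobj (R u) \<beta>" "l = opp_vertical B p l'"
      using opp_verticalE[OF kl(2,7) A] kl(4) by metis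
    have "\<epsilon> u \<beta> \<odot>[p] farr (reindex B p u) k' =
      \<epsilon> u \<beta> \<odot>[p] farr (reindex B p u) l'"
      using eq opp_vertical_Comp_eq[OF i(1)[unfolded coprojection_def] k'(1,2,4)] opp_vertical_Comp_eq[OF i(1)[unfolded coprojection_def] l'(1,2,4)]
      unfolding k'(5) l'(5) coprojection_def by simp
    then have "k' = l'"
      using transpose_unique[OF assms k'(1,2,4)] transpose_unique[OF assms l'(1,2,4)] k'(3) l'(3) by metis
    then show "k = l" by (simp add: k' l')
  qed
qed

text \<open>The induced arrow of the opposite has as third component the very arrow \<open>e\<close>
  whose transpose is \<open>bc_map\<close>. It is therefore the opcartesian coprojection along
  \<open>u\<close> followed by the reversed Beck-Chevalley map, which is invertible.\<close>

lemma coprojection_beck_chevalley: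
  assumes h [simp]: "h \<in> F" and \<beta> [simp]: "\<beta> \<in> ob p" "over_obj p \<beta> =
    Dom B h" and j [simp]: "j \<in> Arr B" "Cod B j = Cod B h"
  shows "opcartesian B (opp B p) (cfactor (opp B p) (lift (opp B p) j (tgt (opp B p) (coprojection h \<beta>)))
    (coprojection h \<beta> \<odot>[opp B p] lift (opp B p) (pb_snd B j h) \<beta>) (pb_fst B j h))"
proof -
  interpret o: cloven_fibration B "opp B p" by (rule opp_cloven)
  define u where "u = pb_fst B j h"
  define g where "g = pb_snd B j h"
  have [simp]: "u \<in> F" "Cod B u = Dom B j" "g \<in> Arr B" "Dom B g = Dom B u" "Cod B g = Dom B h"
    "h \<cdot>[B] g = j \<cdot>[B] u"
    by (simp_all add: u_def g_def)
  define Z where "Z = fobj (R h) \<beta>"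
  have Z [simp]: "Z \<in> ob p" "over_obj p Z = Cod B h" by (simp_all add: Z_def)
  let ?Z = "src p (lift p j Z)" and ?\<beta> = "src p (lift p g \<beta>)"
  define \<theta> where "\<theta> = vfactor B p (lift2 B p j u Z) (lift2 B p h g Z)"
  have \<theta> [simp]: "\<theta> \<in> arr p" "src p \<theta> = src p (lift p u ?Z)"
     "tgt p \<theta> = src p (lift p g (src p (lift p h Z)))" "over_arr p \<theta> = Ident B (Dom B u)"
    unfolding \<theta>_def by simp_all
  define e where "e = farr (reindex B p g) (\<epsilon> h \<beta>) \<odot>[p] \<theta>"
  have \<epsilon> [simp]: "src p (\<epsilon> h \<beta>) = src p (lift p h Z)" by (simp add: Z_def)
  have e [simp]: "e \<in> arr p" "src p e = src p (lift p u ?Z)" "tgt p e = ?\<beta>" "over_arr p e =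
    Ident B (Dom B u)"
    unfolding e_def by simp_all
  define bc where "bc = bc_map B p P h j u g \<beta>"
  have bc_eq: "bc = farr (R u) e \<odot>[p] \<eta> u ?Z"
    unfolding bc_def bc_map_def Let_def e_def \<theta>_def Z_def reindex_obj ..
  then have bc [simp]: "bc \<in> arr p" "src p bc = ?Z" "tgt p bc = fobj (R u) ?\<beta>" "over_arr p bc =
    Ident B (Dom B j)"
    by simp_all
  have "iso (fibre B p (Dom B j)) bc"
    using products h pb_is_pullback[OF h j] \<beta> unfolding has_products_def bc_def
    by (auto simp: fibre_simps u_def[symmetric] g_def[symmetric])
  then have "iso (Tot p) bc"
    unfolding iso_def hom_def fibre_simps by auto
  then obtain bc' where "over_iso B p ?Z (fobj (R u) ?\<beta>) bc bc'"
    using over_iso_if_iso[of bc "Dom B j"] by auto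
  then have iso: "over_iso B (opp B p) (fobj (R u) ?\<beta>) ?Z (opp_vertical B p bc) (opp_vertical B p bc')"
    by (rule opp_over_iso[OF over_iso_sym])
  have i: "coprojection u ?\<beta> \<in> arr (opp B p)" "tgt (opp B p) (coprojection u ?\<beta>) =
    fobj (R u) ?\<beta>"
    "src (opp B p) (coprojection u ?\<beta>) = ?\<beta>" "over_arr (opp B p) (coprojection u ?\<beta>) = u"
    by (simp_all add: coprojection_Arr coprojection_simps)
  have ib: "opp_vertical B p bc \<odot>[opp B p] coprojection u ?\<beta> = (u, ?Z, e)"
    unfolding coprojection_def
      by (subst opp_vertical_Comp_eq) (use i(1) in \<open>simp_all add: coprojection_def\<close>, simp add: bc_eq, rule transpose, simp_all)
  \<comment> \<open>The equation that characterizes the induced arrow; the canonical isomorphism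
    \<open>\<theta>\<close> inside \<open>bc_map\<close> is absorbed by the cocycle rule.\<close>
  have 1: "(j, Z, Ident (Tot p) ?Z) \<odot>[opp B p] (u, ?Z, e) =
    coprojection h \<beta> \<odot>[opp B p] (g, \<beta>, Ident (Tot p) ?\<beta>)"
  proof -
    let ?v = "vfactor B p (lift p (j \<cdot>[B] u) Z) (lift2 B p j u Z)" and ?w =
      "vfactor B p (lift p (j \<cdot>[B] u) Z) (lift2 B p h g Z)"
    have vw: "\<theta> \<odot>[p] ?v = ?w" unfolding \<theta>_def by (rule vfactor_mult) simp_all
    have v: "?v \<in> arr p" "tgt p ?v = src p (lift p u ?Z)" "?w \<in> arr p"
      "tgt p ?w = src p (lift p g (src p (lift p h Z)))"
      by simp_all
    have l: "(j, Z, Ident (Tot p) ?Z) \<odot>[opp B p] (u, ?Z, e) = (j \<cdot>[B] u, Z, e \<odot>[p] ?v)"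
      by (subst opp_Comp_eq) (simp_all add: v)
    have "coprojection h \<beta> \<odot>[opp B p] (g, \<beta>, Ident (Tot p) ?\<beta>) =
      (j \<cdot>[B] u, Z, farr (reindex B p g) (\<epsilon> h \<beta>) \<odot>[p] ?w)"
      unfolding coprojection_def Z_def[symmetric] by (subst opp_Comp_eq) (simp_all add: v)
    moreover have "e \<odot>[p] ?v = farr (reindex B p g) (\<epsilon> h \<beta>) \<odot>[p] ?w"
      unfolding e_def by (simp add: v vw)
    ultimately show ?thesis using l by simp
  qed
  have "cfactor (opp B p) (lift (opp B p) j (tgt (opp B p) (coprojection h \<beta>)))
    (coprojection h \<beta> \<odot>[opp B p] lift (opp B p) (pb_snd B j h) \<beta>) (pb_fst B j h) = (u, ?Z, e)"
  proof (rule o.cfactor_eqI)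
    show "cartesian B (opp B p) (lift (opp B p) j (tgt (opp B p) (coprojection h \<beta>)))"
      by (rule opp_lift_cartesian) (simp_all add: coprojection_simps)
    show "lift (opp B p) j (tgt (opp B p) (coprojection h \<beta>)) \<odot>[opp B p] (u, ?Z, e) =
      coprojection h \<beta> \<odot>[opp B p] lift (opp B p) (pb_snd B j h) \<beta>"
      using 1 by (simp add: coprojection_simps Z_def[symmetric] g_def[symmetric] opp_simps(9))
  qed (simp_all add: coprojection_simps opp_simps(2,3,4,8,9) Z_def[symmetric] u_def[symmetric])
  moreover have "opcartesian B (opp B p) (u, ?Z, e)"
    unfolding ib[symmetric]
      by (rule o.opcartesian_Comp_iso) (use iso i(2) in \<open>simp_all add: coprojection_opcartesian\<close>)
  ultimately show ?thesis by simp
qed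

lemma opp_coproduct_fibration: "coproduct_fibration B F (opp B p) coprojection"
proof -
  interpret o: display_fibration B F "opp B p" by (rule opp_display_fibration)
  show ?thesis
    by unfold_locales
      (simp_all only: opp_simps(1) opp_simps(7) coprojection_opcartesian coprojection_simps(1,3) coprojection_beck_chevalley)
qed

text \<open>A pair \<open>(g, k)\<close> is the triple \<open>(g, \<beta>, k)\<close> of the
  opposite. Its composite with the coprojection lies over \<open>u g\<close> and has as third
  component \<open>k\<close> after the section counit, up to the lift of an identity. Equality with
  the reversed \<open>h\<close> thus says at once that \<open>g\<close> is a section and that
  \<open>h\<close> factors as required.\<close>

lemma quantifier_splitting_iff: "quantifier_splitting B F p P \<alpha> \<longleftrightarrow>
  splits B F (opp B p) \<alpha>"
proof -
  interpret o: coproduct_fibration B F "opp B p" coprojection by (rule opp_coproduct_fibration)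
  define L where "L = (\<lambda>u \<beta>. \<forall>h \<in> hom (fibre B p (Cod B u)) (fobj (R u) \<beta>) \<alpha>.
           \<exists>!(g, k). is_section B u g \<and>
             k \<in> hom (fibre B p (Cod B u)) (fobj (reindex B p g) \<beta>) \<alpha> \<and>
             h = k \<odot>[p] section_counit B p P u g \<beta>)"
  define M where "M = (\<lambda>u \<beta>. \<forall>h \<in> hom (Tot (opp B p)) \<alpha> (tgt (opp B p) (coprojection u \<beta>)).
      over_arr (opp B p) h = Ident B (Cod B u) \<longrightarrow>
         (\<exists>!k. k \<in> hom (Tot (opp B p)) \<alpha> \<beta> \<and>
           coprojection u \<beta> \<odot>[opp B p] k = h))"
  have main: "L u \<beta> \<longleftrightarrow> M u \<beta>"
    if [simp]: "\<alpha> \<in> ob p" "u \<in> F" and u: "Cod B u =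
      over_obj p \<alpha>" and [simp]: "\<beta> \<in> ob p" "over_obj p \<beta> = Dom B u" for u \<beta>
  proof -
    define A where "A = Cod B u"
    have A [simp]: "A \<in> Obj B" "Cod B u = A" "over_obj p \<alpha> = A" using u by (simp_all add: A_def)
    define \<Pi> where "\<Pi> = fobj (R u) \<beta>"
    have \<Pi> [simp]: "\<Pi> \<in> ob p" "over_obj p \<Pi> = A" by (simp_all add: \<Pi>_def)
    have \<epsilon> [simp]: "src p (\<epsilon> u \<beta>) = src p (lift p u \<Pi>)" by (simp add: \<Pi>_def)
    define Q where "Q = (\<lambda>h (g, k). is_section B u g \<and>
      k \<in> hom (fibre B p A) (fobj (reindex B p g) \<beta>) \<alpha> \<and>
             h = k \<odot>[p] section_counit B p P u g \<beta>)"
    define Q' where "Q' = (\<lambda>h k. k \<in> hom (Tot (opp B p)) \<alpha> \<beta> \<and>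
      coprojection u \<beta> \<odot>[opp B p] k = h)"
    have QQ: "Q' (opp_vertical B p h) (g, Y, k) \<longleftrightarrow> Y = \<beta> \<and> Q h (g, k)"
      if h [simp]: "h \<in> arr p" "over_arr p h = Ident B A" "src p h = \<Pi>" "tgt p h = \<alpha>" for h g Y k
    proof -
      \<comment> \<open>\<open>?m\<close> collects the typing conditions that either side implies;
        under them both sides reduce to one equation in \<open>p\<close>.\<close>
      let ?m = "Y = \<beta> \<and> is_section B u g \<and> k \<in> arr p \<and> over_arr p k = Ident B A \<and>
         src p k = src p (lift p g \<beta>) \<and> tgt p k = \<alpha>"
      have Q'm: ?m if "Q' (opp_vertical B p h) (g, Y, k)"
      proof -
        have Y [simp]: "Y = \<beta>" and g [simp]: "g \<in> Arr B" and [simp]: "Cod B g =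
          Dom B u" and k: "k \<in> arr p"
          "over_arr p k = Ident B (Dom B g)" "src p k = src p (lift p g \<beta>)" "tgt p k = \<alpha>"
          and eq: "coprojection u \<beta> \<odot>[opp B p] (g, \<beta>, k) = opp_vertical B p h"
          using that unfolding Q'_def by (auto simp: hom_def opp_simps(2,3,4))
        have Dg: "Dom B g = A" using over_Cod[OF k(1)] k(2,4) by simp
        have "u \<cdot>[B] g = Ident B A"
          using eq by (simp add: coprojection_def opp_simps(6) opp_vertical_simps(5)[of h A])
        then show ?thesis using k Dg by (simp add: is_section_def hom_def)
      qed
      have Qm: ?m if "Y = \<beta> \<and> Q h (g, k)"
        using that unfolding Q_def by (auto simp: hom_def fibre_simps)
      have "Q' (opp_vertical B p h) (g, Y, k) \<longleftrightarrow> Y = \<beta> \<and> Q h (g, k)" if ?m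
      proof -
        have Y [simp]: "Y = \<beta>" and g [simp]: "g \<in> Arr B" "Dom B g = A" "Cod B g = Dom B u"
          "u \<cdot>[B] g = Ident B A"
          and k [simp]: "k \<in> arr p" "over_arr p k = Ident B A" "src p k = src p (lift p g \<beta>)"
            "tgt p k = \<alpha>"
          using that by (auto simp: is_section_def hom_def)
        define s where "s = vfactor B p (Ident (Tot p) \<Pi>) (lift2 B p u g \<Pi>)"
        have s [simp]: "s \<in> arr p" "src p s = \<Pi>" "tgt p s = src p (lift p g (src p (lift p u \<Pi>)))"
          "over_arr p s = Ident B A" "lift2 B p u g \<Pi> \<odot>[p] s = Ident (Tot p) \<Pi>"
          unfolding s_def by simp_all
        define i where "i = lift p (Ident B A) \<Pi>"
        have i [simp]: "i \<in> arr p" "tgt p i = \<Pi>" "over_arr p i = Ident B A" "cartesian B p i"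
          by (simp_all add: i_def)
        have sc: "section_counit B p P u g \<beta> = farr (reindex B p g) (\<epsilon> u \<beta>) \<odot>[p] s"
          unfolding section_counit_def Let_def s_def \<Pi>_def ..
        have "lift2 B p u g \<Pi> \<odot>[p] s \<odot>[p] i = i"
          using total.Comp_assoc[of i s "lift2 B p u g \<Pi>"] by simp
        \<comment> \<open>For \<open>u g\<close> an identity, the canonical isomorphism produced by
          composition starts at the chosen reindexing along that identity, whereas the one in
          \<open>section_counit\<close> starts at \<open>\<Pi>\<close> itself; they differ by
          \<open>i\<close>.\<close>
        then have vs: "vfactor B p i (lift2 B p u g \<Pi>) = s \<odot>[p] i"
          by (intro vfactor_eqI) simp_all
        have eq: "coprojection u \<beta> \<odot>[opp B p] (g, \<beta>, k) =
          (Ident B A, \<Pi>, (k \<odot>[p] section_counit B p P u g \<beta>) \<odot>[p] i)"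
          unfolding coprojection_def \<Pi>_def[symmetric] sc
          by (subst opp_Comp_eq) (simp_all add: i_def[symmetric] vs)
        have vh: "opp_vertical B p h = (Ident B A, \<Pi>, h \<odot>[p] i)"
          by (simp add: opp_vertical_simps(5)[of h A] i_def)
        have cancel: "a = b" if "a \<odot>[p] i = b \<odot>[p] i" "a \<in> arr p" "b \<in> arr p" "src p a =
          \<Pi>" "src p b = \<Pi>" for a b
        proof -
          obtain i' where "over_iso B p (src p i) \<Pi> i i'" using lift_Ident_iso[of \<Pi> A]
            by (auto simp: i_def)
          then show ?thesis using that over_iso_cancel_right(2)[of _ _ i i'] by metis
        qed
        have sc_Arr: "section_counit B p P u g \<beta> \<in> arr p" "src p (section_counit B p P u g \<beta>) =
          \<Pi>"
          "tgt p (section_counit B p P u g \<beta>) = src p (lift p g \<beta>)"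
          unfolding sc by simp_all
        have "(g, \<beta>, k) \<in> hom (Tot (opp B p)) \<alpha> \<beta>"
          by (simp add: hom_def opp_simps(2,3,4))
        then have "Q' (opp_vertical B p h) (g, \<beta>, k) \<longleftrightarrow>
          (k \<odot>[p] section_counit B p P u g \<beta>) \<odot>[p] i = h \<odot>[p] i"
          unfolding Q'_def eq vh by blast
        also have "\<dots> \<longleftrightarrow> k \<odot>[p] section_counit B p P u g \<beta> = h"
          using cancel[of "k \<odot>[p] section_counit B p P u g \<beta>" h] sc_Arr by auto
        also have "\<dots> \<longleftrightarrow> Q h (g, k)"
          unfolding Q_def by (auto simp: hom_def fibre_simps is_section_def)
        finally show ?thesis by simp
      qed
      then show ?thesis using Q'm Qm by blast
    qed
    \<comment> \<open>Unique existence has to be transferred between pairs and triples; the extra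
      middle entry of a triple is forced to be \<open>\<beta>\<close>.\<close>
    have ex: "(\<exists>!x. Q h x) \<longleftrightarrow> (\<exists>!x. Q' (opp_vertical B p h) x)"
      if h: "h \<in> arr p" "over_arr p h = Ident B A" "src p h = \<Pi>" "tgt p h = \<alpha>" for h
    proof
      assume "\<exists>!x. Q h x"
      then obtain x where x: "Q h x" "\<And>y. Q h y \<Longrightarrow> y = x" by blast
      obtain g k where e: "x = (g, k)" by (cases x)
      show "\<exists>!x. Q' (opp_vertical B p h) x"
      proof (rule ex1I[of _ "(g, \<beta>, k)"])
        show "Q' (opp_vertical B p h) (g, \<beta>, k)" using x(1) unfolding e QQ[OF h] by simp
        fix y assume y: "Q' (opp_vertical B p h) y"
        obtain g' Y k' where ye: "y = (g', Y, k')" by (cases y)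
        have "Y = \<beta>" "Q h (g', k')" using y unfolding ye QQ[OF h] by auto
        then show "y = (g, \<beta>, k)" using x(2)[of "(g', k')"] unfolding ye e by blast
      qed
    next
      assume "\<exists>!x. Q' (opp_vertical B p h) x"
      then obtain x where x: "Q' (opp_vertical B p h) x" "\<And>y. Q' (opp_vertical B p h) y \<Longrightarrow>
        y = x" by blast
      obtain g Y k where e: "x = (g, Y, k)" by (cases x)
      have "Y = \<beta>" "Q h (g, k)" using x(1) unfolding e QQ[OF h] by auto
      moreover have "g' = g \<and> k' = k" if "Q h (g', k')" for g' k'
        using x(2)[of "(g', \<beta>, k')"] that unfolding e QQ[OF h] by simp
      ultimately show "\<exists>!x. Q h x" by (intro ex1I[of _ "(g, k)"]) fast+
    qed
    have L: "L u \<beta> \<longleftrightarrow> (\<forall>h. h \<in> arr p \<and> over_arr p h =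
      Ident B A \<and> src p h = \<Pi> \<and> tgt p h = \<alpha> \<longrightarrow> (\<exists>!x. Q h x))"
      unfolding L_def Q_def \<Pi>_def by (auto simp: hom_def fibre_simps)
    have M: "M u \<beta> \<longleftrightarrow> (\<forall>h. h \<in> arr (opp B p) \<and> over_arr (opp B p) h =
      Ident B A \<and>
       src (opp B p) h = \<alpha> \<and> tgt (opp B p) h = \<Pi> \<longrightarrow> (\<exists>!x. Q' h x))"
    proof -
      have c: "tgt (opp B p) (coprojection u \<beta>) = \<Pi>" by (simp add: coprojection_simps \<Pi>_def)
      have "M u \<beta> \<longleftrightarrow> (\<forall>h \<in> hom (Tot (opp B p)) \<alpha> \<Pi>. over_arr (opp B p) h = Ident B A \<longrightarrow> (\<exists>!x. Q' h x))"
        unfolding M_def Q'_def c A(2) ..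
      then show ?thesis unfolding hom_def by blast
    qed
    show ?thesis unfolding L M
    proof (intro iffI allI impI)
      fix h assume a: "\<forall>h. h \<in> arr p \<and> over_arr p h = Ident B A \<and> src p h = \<Pi> \<and>
        tgt p h = \<alpha> \<longrightarrow> (\<exists>!x. Q h x)"
        and h: "h \<in> arr (opp B p) \<and> over_arr (opp B p) h = Ident B A \<and>
       src (opp B p) h = \<alpha> \<and> tgt (opp B p) h = \<Pi>"
      obtain k where "k \<in> arr p" "over_arr p k = Ident B A" "src p k = \<Pi>" "tgt p k = \<alpha>" "h =
        opp_vertical B p k"
        using opp_verticalE[of h A] h by auto
      then show "\<exists>!x. Q' h x" using a ex by blast
    next
      fix h assume a: "\<forall>h. h \<in> arr (opp B p) \<and> over_arr (opp B p) h = Ident B A \<and>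
         src (opp B p) h = \<alpha> \<and> tgt (opp B p) h = \<Pi> \<longrightarrow> (\<exists>!x. Q' h x)"
        and h: "h \<in> arr p \<and> over_arr p h = Ident B A \<and> src p h = \<Pi> \<and> tgt p h = \<alpha>"
      have "opp_vertical B p h \<in> arr (opp B p)" "over_arr (opp B p) (opp_vertical B p h) = Ident B A"
        "src (opp B p) (opp_vertical B p h) = \<alpha>" "tgt (opp B p) (opp_vertical B p h) = \<Pi>"
        using opp_vertical_simps(1-4)[of h A] h by simp_all
      then have "\<exists>!x. Q' (opp_vertical B p h) x" using a by blast
      then show "\<exists>!x. Q h x" using ex h by blast
    qed
  qed
  have "quantifier_splitting B F p P \<alpha> \<longleftrightarrow> \<alpha> \<in> ob p \<and>
     (\<forall>u \<in> F. Cod B u =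
       over_obj p \<alpha> \<longrightarrow> (\<forall>\<beta> \<in> Obj (fibre B p (Dom B u)). L u \<beta>))"
    unfolding quantifier_splitting_def L_def ..
  moreover have "splits B F (opp B p) \<alpha> \<longleftrightarrow> \<alpha> \<in> ob p \<and>
     (\<forall>u \<in> F. Cod B u =
       over_obj p \<alpha> \<longrightarrow> (\<forall>\<beta> \<in> ob p. over_obj p \<beta> =
       Dom B u \<longrightarrow> M u \<beta>))"
    unfolding o.splits_iff M_def opp_simps(1) opp_simps(7) ..
  moreover have "(\<forall>u \<in> F. Cod B u =
    over_obj p \<alpha> \<longrightarrow> (\<forall>\<beta> \<in> Obj (fibre B p (Dom B u)). L u \<beta>)) \<longleftrightarrow>
     (\<forall>u \<in> F. Cod B u =
       over_obj p \<alpha> \<longrightarrow> (\<forall>\<beta> \<in> ob p. over_obj p \<beta> =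
       Dom B u \<longrightarrow> M u \<beta>))"
    if \<alpha>: "\<alpha> \<in> ob p"
  proof -
    have "(\<forall>\<beta> \<in> Obj (fibre B p (Dom B u)). L u \<beta>) \<longleftrightarrow>
      (\<forall>\<beta> \<in> ob p. over_obj p \<beta> = Dom B u \<longrightarrow> M u \<beta>)"
      if "u \<in> F" "Cod B u = over_obj p \<alpha>" for u
      using main[OF \<alpha> that] unfolding Ball_def fibre_simps(1) by blast
    then show ?thesis by blast
  qed
  ultimately show ?thesis by blast
qed

text \<open>By \<open>coproduct_freeI\<close> one cartesian arrow over each base arrow is enough,
  and the chosen lifts of \<open>p\<close> and of its opposite have the same source.\<close>

lemma quantifier_free_iff: "quantifier_free B F p P \<alpha> \<longleftrightarrow>
  coproduct_free B F (opp B p) \<alpha>"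
proof -
  interpret o: cloven_fibration B "opp B p" by (rule opp_cloven)
  show ?thesis
  proof
    assume q: "quantifier_free B F p P \<alpha>"
    show "coproduct_free B F (opp B p) \<alpha>"
    proof (rule o.coproduct_freeI)
      show a: "\<alpha> \<in> ob (opp B p)" using q by (simp add: quantifier_free_def opp_simps)
      fix f assume f: "f \<in> Arr B" "Cod B f = over_obj (opp B p) \<alpha>"
      then have "splits B F (opp B p) (src p (lift p f \<alpha>))"
        using q unfolding quantifier_free_def quantifier_splitting_iff by (simp add: opp_simps)
      then show "\<exists>c. cartesian B (opp B p) c \<and> tgt (opp B p) c = \<alpha> \<and>
        over_arr (opp B p) c = f \<and>
        splits B F (opp B p) (src (opp B p) c)"
        using f a opp_lift_cartesian[of f \<alpha>]
          by (intro exI[of _ "lift (opp B p) f \<alpha>"]) (simp add: opp_simps)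
    qed
  next
    assume c: "coproduct_free B F (opp B p) \<alpha>"
    then have a: "\<alpha> \<in> ob p" by (simp add: coproduct_free_def opp_simps)
    moreover have "splits B F (opp B p) (src p (lift p f \<alpha>))" if "f \<in> Arr B" "Cod B f =
      over_obj p \<alpha>" for f
    proof -
      have "splits B F (opp B p) (src (opp B p) (lift (opp B p) f \<alpha>))"
        using c opp_lift_cartesian[of f \<alpha>] a that unfolding coproduct_free_def
          by (simp add: opp_simps(4,9))
      then show ?thesis using a that by (simp add: opp_simps)
    qed
    ultimately show "quantifier_free B F p P \<alpha>"
      unfolding quantifier_free_def quantifier_splitting_iff by simp
  qed
qed

lemma isomorphic_fibre_iff:
  assumes X: "X \<in> ob p" "over_obj p X = A" and [simp]: "A \<in> Obj B"
  shows "isomorphic (fibre B p A) X Y \<longleftrightarrow> (\<exists>i j. over_iso B p X Y i j)"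
proof
  assume "isomorphic (fibre B p A) X Y"
  then obtain f where f: "f \<in> arr p" "over_arr p f = Ident B A" "src p f = X" "tgt p f = Y"
    "iso (fibre B p A) f"
    by (auto simp: isomorphic_def hom_def fibre_simps)
  then have "iso (Tot p) f" by (auto simp: iso_def hom_def fibre_simps)
  then show "\<exists>i j. over_iso B p X Y i j" using over_iso_if_iso[of f A] f by auto
next
  assume "\<exists>i j. over_iso B p X Y i j"
  then obtain i j where ij: "over_iso B p X Y i j" by blast
  note s = over_isoD(1-10)[OF ij]
  have "iso (fibre B p A) i"
    using s X unfolding iso_def hom_def fibre_simps by auto
  then show "isomorphic (fibre B p A) X Y"
    using s X unfolding isomorphic_def by (intro bexI[of _ i]) (auto simp: hom_def fibre_simps)
qed

text \<open>Reversal exchanges the two arrows of a vertical isomorphism.\<close>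

lemma opp_over_iso_iff: "(\<exists>i j. over_iso B (opp B p) X Y i j) \<longleftrightarrow>
  (\<exists>i j. over_iso B p X Y i j)"
proof
  interpret o: cloven_fibration B "opp B p" by (rule opp_cloven)
  assume "\<exists>i j. over_iso B (opp B p) X Y i j"
  then obtain i j where ij: "over_iso B (opp B p) X Y i j" by blast
  note s = o.over_isoD[OF ij, unfolded opp_simps(1) opp_simps(7)[of B p]]
  let ?A = "over_obj p X"
  have A [simp]: "?A \<in> Obj B" "X \<in> ob p" "Y \<in> ob p" "over_obj p Y = ?A" using s by simp_all
  obtain k where k [simp]: "k \<in> arr p" "over_arr p k = Ident B ?A" "src p k = Y" "tgt p k = X" and ik: "i =
    opp_vertical B p k"
    using opp_verticalE[OF s(1,7) A(1)] s(3,4) by metis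
  obtain l where l [simp]: "l \<in> arr p" "over_arr p l = Ident B ?A" "src p l = X" "tgt p l = Y" and jl: "j =
    opp_vertical B p l"
    using opp_verticalE[OF s(2,8) A(1)] s(5,6) by metis
  have "opp_vertical B p (k \<odot>[p] l) = opp_vertical B p (Ident (Tot p) X)"
    using s(9) unfolding ik jl by (simp add: opp_vertical_mult[where A = ?A] opp_vertical_Ident)
  then have "k \<odot>[p] l = Ident (Tot p) X"
    by (rule opp_vertical_eqI[where A = ?A, rotated -1]) simp_all
  moreover have "opp_vertical B p (l \<odot>[p] k) = opp_vertical B p (Ident (Tot p) Y)"
    using s(10) unfolding ik jl by (simp add: opp_vertical_mult[where A = ?A] opp_vertical_Ident)
  then have "l \<odot>[p] k = Ident (Tot p) Y"
    by (rule opp_vertical_eqI[where A = ?A, rotated -1]) simp_all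
  ultimately have "over_iso B p X Y l k" by (simp add: over_iso_def hom_def)
  then show "\<exists>i j. over_iso B p X Y i j" by blast
next
  assume "\<exists>i j. over_iso B p X Y i j"
  then show "\<exists>i j. over_iso B (opp B p) X Y i j" using opp_over_iso by blast
qed

lemma enough_iff:
  "enough_quantifier_free B F p P \<longleftrightarrow>
    (\<forall>\<alpha> \<in> ob (opp B p). \<exists>u \<in> F. \<exists>\<beta> \<in> ob (opp B p).
     over_obj (opp B p) \<beta> = Dom B u \<and> coproduct_free B F (opp B p) \<beta> \<and>
     (\<exists>i j. over_iso B (opp B p) (tgt (opp B p) (coprojection u \<beta>)) \<alpha> i j))"
proof -
  define X where "X = (\<lambda>\<alpha> u \<beta>. Cod B u = over_obj p \<alpha> \<and>
    quantifier_free B F p P \<beta> \<and>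
    isomorphic (fibre B p (Cod B u)) \<alpha> (fobj (R u) \<beta>))"
  define Y where "Y = (\<lambda>\<alpha> u \<beta>. coproduct_free B F (opp B p) \<beta> \<and>
    (\<exists>i j. over_iso B (opp B p) (tgt (opp B p) (coprojection u \<beta>)) \<alpha> i j))"
  have "X \<alpha> u \<beta> \<longleftrightarrow> Y \<alpha> u \<beta>"
    if [simp]: "\<alpha> \<in> ob p" "u \<in> F" "\<beta> \<in> ob p" "over_obj p \<beta> =
      Dom B u" for \<alpha> u \<beta>
  proof -
    have "(\<exists>i j. over_iso B p (fobj (R u) \<beta>) \<alpha> i j) \<longleftrightarrow>
      (\<exists>i j. over_iso B p \<alpha> (fobj (R u) \<beta>) i j)"
      using over_iso_sym by blast
    \<comment> \<open>The vertical isomorphism already fixes the codomain of \<open>u\<close>, which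
      is why the coproduct side does not state it.\<close>
    moreover have "Cod B u = over_obj p \<alpha>" if "over_iso B p \<alpha> (fobj (R u) \<beta>) i j" for i j
      using over_isoD(13)[OF that] by simp
    ultimately show ?thesis
      unfolding X_def Y_def quantifier_free_iff coprojection_simps[OF that(2-4)] opp_over_iso_iff
      using isomorphic_fibre_iff[OF that(1) _ Obj_Cod, of u "fobj (R u) \<beta>"] by auto
  qed
  moreover have "enough_quantifier_free B F p P \<longleftrightarrow>
      has_products B F p P \<and>
        (\<forall>\<alpha> \<in> ob p. \<exists>u \<in> F. \<exists>\<beta> \<in> Obj (fibre B p (Dom B u)). X \<alpha> u \<beta>)"
    unfolding enough_quantifier_free_def X_def ..
  ultimately have "enough_quantifier_free B F p P \<longleftrightarrow>
      (\<forall>\<alpha> \<in> ob p. \<exists>u \<in> F. \<exists>\<beta> \<in> ob p. over_obj p \<beta> =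
        Dom B u \<and> Y \<alpha> u \<beta>)"
    using products fibre_simps(1)[of _ B p] by blast
  then show ?thesis unfolding Y_def opp_simps(1) opp_simps(7)[of B p] .
qed

text \<open>\<open>p\<close> is equivalent to the opposite of a coproduct completion. Taking
  opposites once more and cancelling the double opposite makes \<open>opp B p\<close> equivalent to
  a coproduct completion, in which the free objects are at hand. The object and arrow types of
  \<open>q\<close> are independent of those of \<open>p\<close>.\<close>

lemma enough_if_completion:
  assumes "has_units B F" "has_dependent_coproducts B F" and q: "cloven_fibration B q"
    and eq: "fibred_equivalent B p (product_completion B F q)"
  shows "enough_quantifier_free B F p P"
proof -
  interpret q: display_fibration B F q by (intro display_fibration.intro q display_map_category_axioms)
  interpret oq: display_fibration B F "opp B q" by (rule q.opp_display_fibration)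
  interpret o: coproduct_fibration B F "opp B p" coprojection by (rule opp_coproduct_fibration)
  have s: "cloven_fibration B (sigma B F (opp B q))" by (rule oq.sigma_cloven)
  have os: "cloven_fibration B (opp B (sigma B F (opp B q)))" by (rule cloven_fibration.opp_cloven[OF s])
  have oos: "cloven_fibration B (opp B (opp B (sigma B F (opp B q))))"
    by (rule cloven_fibration.opp_cloven[OF os])
  have over: "cloven_fibration B r \<Longrightarrow> category_over B r" for r :: "('x, 'y, 'ob, 'ab) fib"
    unfolding cloven_fibration_def cloven_fibration_axioms_def category_over_def category_over_axioms_def by blast
  note pc = q.product_completion_equivalence
  have "fibred_equivalent B p (opp B (sigma B F (opp B q)))"
    using fibred_equivalent_trans[OF category_over_axioms fibrewise_equivalence.axioms(1)[OF pc] fibrewise_equivalence.axioms(2)[OF pc] eq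
      fibrewise_equivalence.fibred_equivalent[OF pc]] .
  then obtain G where "fibrewise_equivalence B p (opp B (sigma B F (opp B q))) G"
    by (rule fibred_equivalentE[OF category_over_axioms fibrewise_equivalence.axioms(2)[OF pc]])
  then have "fibrewise_equivalence B (opp B p) (opp B (opp B (sigma B F (opp B q))))
     (opp_ftr B p (opp B (sigma B F (opp B q))) G)"
    by (rule opp_fibrewise_equivalence[OF cloven_fibration_axioms os])
  then have 1: "fibred_equivalent B (opp B (opp B (sigma B F (opp B q)))) (opp B p)"
    by (rule fibred_equivalent_sym[OF fibrewise_equivalence.fibred_equivalent])
  have 2: "fibred_equivalent B (sigma B F (opp B q)) (opp B (opp B (sigma B F (opp B q))))"
    by (rule fibrewise_equivalence.fibred_equivalent[OF opp_opp_fibrewise_equivalence[OF s]])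
  obtain H where H: "fibrewise_equivalence B (sigma B F (opp B q)) (opp B p) H"
    by (rule fibred_equivalentE[OF over[OF s] o.category_over_axioms
          fibred_equivalent_trans[OF over[OF s] over[OF oos] o.category_over_axioms 2 1]])
  show ?thesis
    unfolding enough_iff
    using o.enough_if_sigma_equivalence[OF oq.cloven_fibration_axioms H assms(1,2)] by blast
qed

end

section \<open>Restriction to a class of objects stable under reindexing\<close>

definition restrict_fib :: "('oe, 'ae, 'ob, 'ab) fib \<Rightarrow> ('oe \<Rightarrow> bool) \<Rightarrow> ('oe, 'ae, 'ob, 'ab) fib" where
  "restrict_fib p S = p\<lparr>Tot := (Tot p)\<lparr>Obj := {X \<in> ob p. S X},
     Arr := {x \<in> arr p. S (src p x) \<and> S (tgt p x)}\<rparr>\<rparr>"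

lemma restrict_fib_simps:
  "ob (restrict_fib p S) = {X \<in> ob p. S X}"
  "arr (restrict_fib p S) = {x \<in> arr p. S (src p x) \<and> S (tgt p x)}"
  "src (restrict_fib p S) = src p" "tgt (restrict_fib p S) = tgt p"
  "Ident (Tot (restrict_fib p S)) = Ident (Tot p)" "Comp (Tot (restrict_fib p S)) = Comp (Tot p)"
  "proj (restrict_fib p S) = proj p" "lift (restrict_fib p S) = lift p"
  by (simp_all add: restrict_fib_def)

context cloven_fibration
begin

text \<open>The factorization found in \<open>p\<close> runs between retained objects, and the
  restriction keeps all arrows between these.\<close>

lemma restrict_cartesian:
  assumes x: "cartesian B p x" and S: "S (src p x)" "S (tgt p x)"
  shows "cartesian B (restrict_fib p S) x"
  unfolding cartesian_def
proof (intro conjI ballI impI; (unfold restrict_fib_simps)?)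
  show "x \<in> {x \<in> arr p. S (src p x) \<and> S (tgt p x)}" using S cartesian_Arr[OF x] by simp
  fix z w assume z: "z \<in> {x \<in> arr p. S (src p x) \<and> S (tgt p x)}"
    and w: "w \<in> hom B (over_obj p (src p z)) (over_obj p (src p x))"
    and c: "tgt p z = tgt p x \<and> over_arr p x \<cdot>[B] w = over_arr p z"
  have "\<exists>!k. k \<in> hom (Tot p) (src p z) (src p x) \<and> over_arr p k = w \<and> x \<odot>[p] k = z"
    using x z w c unfolding cartesian_def restrict_fib_simps by blast
  moreover have "k \<in> hom (Tot (restrict_fib p S)) (src p z) (src p x) \<longleftrightarrow>
    k \<in> hom (Tot p) (src p z) (src p x)" for k
    using z S unfolding hom_def restrict_fib_simps by auto
  ultimately show "\<exists>!k. k \<in> hom (Tot (restrict_fib p S)) (src p z) (src p x) \<and> over_arr p k =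
    w \<and> x \<odot>[p] k = z"
    by simp
qed

lemma restrict_cloven:
  assumes S: "\<And>u X. u \<in> Arr B \<Longrightarrow> X \<in> ob p \<Longrightarrow> over_obj p X =
    Cod B u \<Longrightarrow> S X \<Longrightarrow> S (src p (lift p u X))"
  shows "cloven_fibration B (restrict_fib p S)"
proof -
  have "category (Tot (restrict_fib p S))"
    by unfold_locales (auto simp: restrict_fib_simps hom_def)
  then interpret r: category "Tot (restrict_fib p S)" .
  show ?thesis
  proof
    show "is_functor (Tot (restrict_fib p S)) B (proj (restrict_fib p S))"
      unfolding is_functor_def by (auto simp: restrict_fib_simps hom_def)
    fix u X assume u: "u \<in> Arr B" and X: "X \<in> ob (restrict_fib p S)" "over_obj (restrict_fib p S) X =
      Cod B u"
    then have X': "X \<in> ob p" "S X" "over_obj p X = Cod B u" by (auto simp: restrict_fib_simps)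
    then show "lift (restrict_fib p S) u X \<in> arr (restrict_fib p S) \<and>
      tgt (restrict_fib p S) (lift (restrict_fib p S) u X) = X \<and>
      over_arr (restrict_fib p S) (lift (restrict_fib p S) u X) = u"
      using u S[OF u X'(1,3,2)] by (simp add: restrict_fib_simps)
    show "cartesian B (restrict_fib p S) (lift (restrict_fib p S) u X)"
      unfolding restrict_fib_simps using u X' S[OF u X'(1,3,2)] by (intro restrict_cartesian) simp_all
  qed
qed

text \<open>Composition in the opposite is defined through \<open>THE\<close> over the arrows of the
  fibration, so the two compositions are not equal by definition. They agree because the
  factorizations taken in \<open>p\<close> run between objects satisfying \<open>S\<close>, and
  factorizations in the restriction are unique.\<close>

lemma opp_restrict:
  assumes S: "\<And>u X. u \<in> Arr B \<Longrightarrow> X \<in> ob p \<Longrightarrow> over_obj p X =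
    Cod B u \<Longrightarrow> S X \<Longrightarrow> S (src p (lift p u X))"
  shows "full_subfibration (opp B (restrict_fib p S)) (opp B p) S"
proof -
  interpret r: cloven_fibration B "restrict_fib p S" by (rule restrict_cloven[where S = S]) (rule S)
  have arr: "(u, X, e) \<in> arr (opp B (restrict_fib p S)) \<longleftrightarrow>
    (u, X, e) \<in> arr (opp B p) \<and> S (tgt p e) \<and> S X" for u X e
    using S[of u X] by (auto simp: opp_simps restrict_fib_simps)
  have comp: "y \<odot>[opp B (restrict_fib p S)] x = y \<odot>[opp B p] x"
    if x: "x \<in> arr (opp B (restrict_fib p S))" and y: "y \<in> arr (opp B (restrict_fib p S))"
      and yx: "src (opp B (restrict_fib p S)) y = tgt (opp B (restrict_fib p S)) x" for x y
  proof -
    obtain u X e v Z d where eqs: "x = (u, X, e)" "y = (v, Z, d)" by (cases x, cases y) auto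
    have [simp]: "u \<in> Arr B" "v \<in> Arr B" "tgt p d = X" "X \<in> ob p" "Z \<in> ob p"
        "over_obj p X = Cod B u" "over_obj p Z = Cod B v" "e \<in> arr p" "d \<in> arr p"
        "src p e = src p (lift p u X)" "src p d = src p (lift p v Z)"
        "over_arr p e = Ident B (Dom B u)" "over_arr p d = Ident B (Dom B v)" "S X" "S Z"
      using x y yx unfolding eqs arr by (auto simp: opp_simps restrict_fib_simps)
    have [simp]: "Cod B u = Dom B v" using over_Cod[of d] by simp
    have [simp]: "S (src p (lift p u X))" "S (src p (lift p v Z))" "S (src p (lift p (v \<cdot>[B] u) Z))"
      by (rule S; simp)+
    have 1: "cfactor (restrict_fib p S) (lift p v Z) (lift p (v \<cdot>[B] u) Z) u =
      cfactor p (lift p v Z) (lift p (v \<cdot>[B] u) Z) u"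
      by (rule r.cfactor_eqI) (simp_all add: restrict_fib_simps restrict_cartesian)
    let ?k = "d \<odot>[p] cfactor p (lift p v Z) (lift p (v \<cdot>[B] u) Z) u"
    have 2: "cfactor (restrict_fib p S) (lift p u X) ?k (Ident B (Dom B u)) =
      cfactor p (lift p u X) ?k (Ident B (Dom B u))"
      by (rule r.cfactor_eqI) (simp_all add: restrict_fib_simps restrict_cartesian)
    show ?thesis unfolding eqs opp_simps restrict_fib_simps 1 2 ..
  qed
  show ?thesis
    unfolding full_subfibration_def
  proof (intro conjI ballI impI)
    show "ob (opp B (restrict_fib p S)) = {X \<in> ob (opp B p). S X}"
      by (simp add: opp_simps restrict_fib_simps)
    show "arr (opp B (restrict_fib p S)) = {x \<in> arr (opp B p).
      S (src (opp B p) x) \<and> S (tgt (opp B p) x)}"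
    proof (rule set_eqI)
      fix x :: "'ab \<times> 'oe \<times> 'ae"
      obtain u X e where "x = (u, X, e)" by (cases x)
      then show "x \<in> arr (opp B (restrict_fib p S)) \<longleftrightarrow> x \<in> {x \<in> arr (opp B p).
          S (src (opp B p) x) \<and> S (tgt (opp B p) x)}"
        using arr[of u X e] by (simp only: mem_Collect_eq opp_simps(3,4))
    qed
  next
    fix X show "over_obj (opp B (restrict_fib p S)) X = over_obj (opp B p) X"
      "Ident (Tot (opp B (restrict_fib p S))) X = Ident (Tot (opp B p)) X"
      by (simp_all add: opp_simps restrict_fib_simps)
  next
    fix x :: "'ab \<times> 'oe \<times> 'ae"
    show "src (opp B (restrict_fib p S)) x = src (opp B p) x"
      "tgt (opp B (restrict_fib p S)) x = tgt (opp B p) x"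
      "over_arr (opp B (restrict_fib p S)) x = over_arr (opp B p) x"
      by (cases x; simp add: opp_simps restrict_fib_simps)+
  qed (rule comp)
qed

end

section \<open>The fibration of quantifier-free objects and its completion\<close>

context product_fibration
begin

text \<open>Restricting \<open>p\<close> itself, and not its opposite, lets \<open>q\<close> keep
  the types of \<open>p\<close>. The opposite of \<open>q\<close> is the full subfibration of
  \<open>opp B p\<close> on the free objects, so its coproduct completion is equivalent to
  \<open>opp B p\<close>; passing to opposites again and cancelling the double opposite gives
  \<open>p\<close>.\<close>

lemma completion_if_enough:
  assumes enough: "enough_quantifier_free B F p P"
  shows "\<exists>q :: ('oe, 'ae, 'ob, 'ab) fib. cloven_fibration B q \<and>
    fibred_equivalent B p (product_completion B F q)"
proof -
  interpret o: coproduct_fibration B F "opp B p" coprojection by (rule opp_coproduct_fibration)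
  define S where "S = coproduct_free B F (opp B p)"
  define q where "q = restrict_fib p S"
  \<comment> \<open>A cartesian arrow into the reindexing of \<open>X\<close> composed with the
    chosen lift is a cartesian arrow into \<open>X\<close>, so freeness is inherited.\<close>
  have S: "S (src p (lift p u X))" if u: "u \<in> Arr B" "X \<in> ob p" "over_obj p X = Cod B u" "S X" for u X
  proof -
    have c: "cartesian B (opp B p) (lift (opp B p) u X)"
      by (rule opp_lift_cartesian) fact+
    have "coproduct_free B F (opp B p) (src (opp B p) (lift (opp B p) u X))"
      unfolding coproduct_free_def
    proof (intro conjI allI impI)
      show "src (opp B p) (lift (opp B p) u X) \<in> ob (opp B p)"
        using u by (simp add: opp_simps)
      fix d assume d: "cartesian B (opp B p) d" "tgt (opp B p) d = src (opp B p) (lift (opp B p) u X)"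
      then have "cartesian B (opp B p) (lift (opp B p) u X \<odot>[opp B p] d)"
        using c by (intro o.cartesian_Comp) simp_all
      then show "splits B F (opp B p) (src (opp B p) d)"
        using u(4) d o.cartesian_Arr[OF d(1)] o.cartesian_Arr[OF c]
          o.total.Comp_simps[of d "lift (opp B p) u X"]
        unfolding S_def coproduct_free_def by (metis opp_simps(4,9))
    qed
    then show ?thesis using u by (simp add: S_def opp_simps)
  qed
  have q: "cloven_fibration B q" unfolding q_def by (rule restrict_cloven[where S = S]) (rule S)
  interpret q: display_fibration B F q by (intro display_fibration.intro q display_map_category_axioms)
  interpret oq: display_fibration B F "opp B q" by (rule q.opp_display_fibration)
  have s: "cloven_fibration B (sigma B F (opp B q))" by (rule oq.sigma_cloven)
  have oo: "cloven_fibration B (opp B (opp B p))" by (rule o.opp_cloven)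
  interpret oo: cloven_fibration B "opp B (opp B p)" by (rule oo)
  have "full_subfibration (opp B q) (opp B p) (coproduct_free B F (opp B p))"
    unfolding q_def S_def[symmetric] by (rule opp_restrict[where S = S]) (rule S)
  then obtain G where "fibrewise_equivalence B (sigma B F (opp B q)) (opp B p) G"
    using o.sigma_equivalence_if_enough[OF oq.cloven_fibration_axioms] enough[unfolded enough_iff] by blast
  then have "fibrewise_equivalence B (opp B (sigma B F (opp B q))) (opp B (opp B p))
      (opp_ftr B (sigma B F (opp B q)) (opp B p) G)"
    by (rule opp_fibrewise_equivalence[OF s o.cloven_fibration_axioms])
  note pc = fibrewise_equivalence_comp[OF q.product_completion_equivalence this]
  have "fibred_equivalent B p (product_completion B F q)"
    by (rule fibred_equivalent_trans[OF category_over_axioms oo.category_over_axioms fibrewise_equivalence.axioms(1)[OF pc]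
      fibrewise_equivalence.fibred_equivalent[OF opp_opp_fibrewise_equivalence[OF cloven_fibration_axioms]]
      fibred_equivalent_sym[OF fibrewise_equivalence.fibred_equivalent[OF pc]]])
  with q show ?thesis by blast
qed

end

text \<open>A formula of higher-order logic cannot quantify existentially over types. The witness
  for sufficiency can be built on the types of \<open>p\<close>, so the equivalence is stated for
  these; necessity is stated once more for a \<open>q\<close> on arbitrary types, which together
  gives the full content.\<close>

theorem theorem5p10:
  fixes B :: "('ob, 'ab) cat" and F :: "'ab set"
    and p :: "('oe, 'ae, 'ob, 'ab) fib" and P :: "('oe, 'ae, 'ab) products"
  assumes "display_map_category B F"
    and "has_units B F"
    and "has_dependent_coproducts B F"
    and "cloven_fibration B p"
    and "has_products B F p P"
  shows "((\<exists>q :: ('oe, 'ae, 'ob, 'ab) fib.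
             cloven_fibration B q \<and> fibred_equivalent B p (product_completion B F q))
           \<longleftrightarrow> enough_quantifier_free B F p P)
       \<and> (\<forall>q :: ('oq, 'aq, 'ob, 'ab) fib.
             cloven_fibration B q \<and> fibred_equivalent B p (product_completion B F q)
             \<longrightarrow> enough_quantifier_free B F p P)"
proof -
  interpret product_fibration B F p P
    using assms by (intro product_fibration.intro display_fibration.intro product_fibration_axioms.intro)
  have "enough_quantifier_free B F p P" if "cloven_fibration B q \<and>
    fibred_equivalent B p (product_completion B F q)"
    for q :: "('oe, 'ae, 'ob, 'ab) fib"
    using enough_if_completion[OF assms(2,3)] that by blast
  moreover have "enough_quantifier_free B F p P" if "cloven_fibration B q \<and>
    fibred_equivalent B p (product_completion B F q)"
    for q :: "('oq, 'aq, 'ob, 'ab) fib"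
    using enough_if_completion[OF assms(2,3)] that by blast
  ultimately show ?thesis using completion_if_enough by blast
qed

end
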